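(* Let $x(n)=\sum_{l=1}^{L}A_l e^{j2\pi f_l n}+w(n)$, $n=0,\ldots,N-1$, with $L\ge 2$, and let $f_l=(\hat m_l+\delta_l)/N$, where $\hat m_l$ is the (correct) maximum bin of the $l$-th component and $\delta_l\in[-0.5,0.5]$ is its frequency residual. Suppose that the minimum frequency separation satisfies $\Delta=\min_{p\ne l}|f_p-f_l|\sim O(1)$, i.e. it is independent of $N$. Then the iterative leakage-subtraction estimator described in the context converges to the fixed point, with the following properties. (1) The $L$-dimensional asymptotic (as $N\to\infty$) fixed point is at the true frequency residuals $(\delta_1,\ldots,\delta_L)$. (2) The convergence rate $r_L$ satisfies, almost surely, $$ r_L\le \sqrt{L}\;O\!\left(\max_{l,p=1,\ldots,L,\ l\ne p}\left\{\sqrt{\Gamma_{l,p}},\ \sqrt{\frac{\ln N}{N}}\right\}\right),\qquad \Gamma_{l,p}=\frac{|A_l|^2}{\langle N(f_l-f_p)\rangle^2}\sim |A_l|^2\,O(N^{-2}),$$ where $\langle\cdot\rangle$ denotes the nearest integer. (3) Asymptotically, the estimator is unbiased and, for each $p=1,\ldots,L$, the theoretical variance of the distribution of $\hat f_p$ is $$\sigma^2_{\hat f_p}=\frac{\pi^2}{64\,\rho_p N^3},$$ which is approximately $1.0147$ times the asymptotic Cramér–Rao lower bound $\mathrm{ACRLB}_{f_p}$.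
   Context: Signal model: $A_l\in\mathbb{C}\setminus\{0\}$, $f_l\in[-0.5,0.5]$, $L$ is known, and $w(n)$ is additive (white, circular complex) Gaussian noise with zero mean and variance $\sigma^2$. The SNR of component $l$ is $\rho_l=|A_l|^2/\sigma^2$. The asymptotic CRLB is $\mathrm{ACRLB}_{f_p}=\dfrac{6}{4\pi^2\rho_p N^3}$. All asymptotics are as $N\to\infty$. Estimator. Maximum bins $\hat m_l$ are integers obtained from the maxima of the $N$-point periodogram $\left|\sum_n x(n)e^{-j2\pi kn/N}\right|^2$. Start with all residual and amplitude estimates equal to $0$. For $q=1,\ldots,Q$ and, within each $q$, for $p=1,\ldots,L$ consecutively, using the current estimates $\hat\delta_l,\hat A_l$: (i) compute $X_{p,\pm0.5}=\frac1N\sum_{n=0}^{N-1}x(n)e^{-j\frac{2\pi}{N}(\hat m_p+\hat\delta_p\pm0.5)n}$ and, with $M_{l,p}=\hat m_l-\hat m_p$, the leakage-subtracted coefficients $$\hat S_{p,\pm0.5}=X_{p,\pm0.5}-\sum_{l\ne p}\frac{\hat A_l}{N}\,\frac{1+e^{j2\pi(\hat\delta_l-\hat\delta_p)}}{1-e^{j\frac{2\pi}{N}(M_{l,p}+\hat\delta_l-\hat\delta_p\mp0.5)}};$$ (ii) set $\hat h=\frac12\frac{\hat S_{p,0.5}+\hat S_{p,-0.5}}{\hat S_{p,0.5}-\hat S_{p,-0.5}}$, $\hat z^{-1}=\cos(\pi/N)-2j\hat h\sin(\pi/N)$, and update $\hat\delta_p\leftarrow\hat\delta_p-\frac{N}{2\pi}\,\mathrm{Im}\{\ln\hat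 z^{-1}\}$, $\hat f_p=(\hat m_p+\hat\delta_p)/N$; (iii) update $$\hat A_p=\frac1N\sum_{n=0}^{N-1}x(n)e^{-j2\pi\hat f_pn}-\sum_{l\ne p}\frac{\hat A_l}{N}\,\frac{1-e^{j2\pi N(\hat f_l-\hat f_p)}}{1-e^{j2\pi(\hat f_l-\hat f_p)}}.$$ The final output is $\hat f_l=(\hat m_l+\hat\delta_l)/N$, $l=1,\ldots,L$. Convergence and rate. Let $H_p(\nu_1,\ldots,\nu_L)$ be the updated estimate of $\delta_p$ produced by one application of (i)–(ii) when the current residual estimates are $\nu_1,\ldots,\nu_L\in[-0.5,0.5]$ (amplitude estimates being computed from these by (iii)). A fixed point is a point $(\nu_1,\ldots,\nu_L)$ with $(H_1,\ldots,H_L)(\nu_1,\ldots,\nu_L)=(\nu_1,\ldots,\nu_L)$. The convergence rate $r_L$ is the contraction constant in Euclidean norm: $\sum_{l}|H_l(\nu^{(2)})-H_l(\nu^{(1)})|^2\le r_L^2\sum_l|\nu_l^{(2)}-\nu_l^{(1)}|^2$ for all $\nu^{(1)},\nu^{(2)}\in[-0.5,0.5]^L$.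
   Formalization: Frequency differences are kept away from 1, since -0.5 and 0.5 alias to the same tone; property (3) takes Q at least 2 (false for Q=1) and at most polynomial in N; the fixed point may lie slightly outside the cube when a residual is near its boundary. *)

theory Defs
  imports "HOL-Probability.Probability" "HOL-Library.Landau_Symbols"
begin

text \<open>
  Components are indexed by \<open>{..<L}\<close>; vectors of length \<open>L\<close> are functions on \<open>nat\<close> of which only
  the values below \<open>L\<close> matter. \<open>cis t\<close> is \<open>exp (\<i> t)\<close>.
\<close>

subsection \<open>Signal model\<close>

text \<open>White circular complex Gaussian noise of mean \<open>0\<close> and variance \<open>\<sigma>\<^sup>2\<close>: all the real and imaginary
  parts are independent, each with variance \<open>\<sigma>\<^sup>2/2\<close>.\<close>

definition white_circular_gaussian :: "'a measure \<Rightarrow> (nat \<Rightarrow> 'a \<Rightarrow> complex) \<Rightarrow> real \<Rightarrow> bool" where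
  "white_circular_gaussian M w \<sigma> \<longleftrightarrow>
     prob_space.indep_vars M (\<lambda>_. borel)
       (\<lambda>(n, b) \<omega>. if b then Re (w n \<omega>) else Im (w n \<omega>)) (UNIV :: (nat \<times> bool) set) \<and>
     (\<forall>n. distributed M lborel (\<lambda>\<omega>. Re (w n \<omega>)) (normal_density 0 (\<sigma> / sqrt 2)) \<and>
          distributed M lborel (\<lambda>\<omega>. Im (w n \<omega>)) (normal_density 0 (\<sigma> / sqrt 2)))"

definition observation ::
  "nat \<Rightarrow> (nat \<Rightarrow> complex) \<Rightarrow> (nat \<Rightarrow> real) \<Rightarrow> (nat \<Rightarrow> 'a \<Rightarrow> complex) \<Rightarrow> 'a \<Rightarrow> nat \<Rightarrow> complex" where
  "observation L A f w \<omega> n = (\<Sum>l<L. A l * cis (2 * pi * f l * real n)) + w n \<omega>"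

definition SNR :: "complex \<Rightarrow> real \<Rightarrow> real" where
  "SNR a \<sigma> = (cmod a)\<^sup>2 / \<sigma>\<^sup>2"

definition ACRLB :: "real \<Rightarrow> nat \<Rightarrow> real" where
  "ACRLB \<rho> N = 6 / (4 * pi\<^sup>2 * \<rho> * real N ^ 3)"

definition min_separation :: "nat \<Rightarrow> (nat \<Rightarrow> real) \<Rightarrow> real" where
  "min_separation L f = Min {\<bar>f p - f l\<bar> | p l. p < L \<and> l < L \<and> p \<noteq> l}"

definition leakage_Gamma :: "(nat \<Rightarrow> complex) \<Rightarrow> (nat \<Rightarrow> real) \<Rightarrow> nat \<Rightarrow> nat \<Rightarrow> nat \<Rightarrow> real" where
  "leakage_Gamma A f N l p = (cmod (A l))\<^sup>2 / (real_of_int (round (real N * (f l - f p))))\<^sup>2"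

definition rate_bound :: "nat \<Rightarrow> (nat \<Rightarrow> complex) \<Rightarrow> (nat \<Rightarrow> real) \<Rightarrow> nat \<Rightarrow> real" where
  "rate_bound L A f N =
     Max {max (sqrt (leakage_Gamma A f N l p)) (sqrt (ln (real N) / real N)) | l p.
          l < L \<and> p < L \<and> l \<noteq> p}"

subsection \<open>The estimator\<close>

text \<open>Throughout, \<open>x\<close> is the data, \<open>m\<close> the maximum bins, \<open>d\<close> and \<open>a\<close> the current residual and
  amplitude estimates; the offset \<open>s\<close> is \<open>1/2\<close> or \<open>-1/2\<close>.\<close>

definition freq_est :: "nat \<Rightarrow> (nat \<Rightarrow> int) \<Rightarrow> (nat \<Rightarrow> real) \<Rightarrow> nat \<Rightarrow> real" where
  "freq_est N m d l = (real_of_int (m l) + d l) / real N"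

definition dft_coeff ::
  "nat \<Rightarrow> (nat \<Rightarrow> complex) \<Rightarrow> (nat \<Rightarrow> int) \<Rightarrow> (nat \<Rightarrow> real) \<Rightarrow> nat \<Rightarrow> real \<Rightarrow> complex" where
  "dft_coeff N x m d p s =
     (1 / of_nat N) *
     (\<Sum>n<N. x n * cis (- (2 * pi / real N * (real_of_int (m p) + d p + s) * real n)))"

definition leak_subtracted ::
  "nat \<Rightarrow> nat \<Rightarrow> (nat \<Rightarrow> complex) \<Rightarrow> (nat \<Rightarrow> int) \<Rightarrow> (nat \<Rightarrow> real) \<Rightarrow> (nat \<Rightarrow> complex) \<Rightarrow>
   nat \<Rightarrow> real \<Rightarrow> complex" where
  "leak_subtracted L N x m d a p s =
     dft_coeff N x m d p s -
     (\<Sum>l\<in>{..<L} - {p}. a l / of_nat N *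
        ((1 + cis (2 * pi * (d l - d p))) /
         (1 - cis (2 * pi / real N * (real_of_int (m l - m p) + d l - d p - s)))))"

definition residual_update ::
  "nat \<Rightarrow> nat \<Rightarrow> (nat \<Rightarrow> complex) \<Rightarrow> (nat \<Rightarrow> int) \<Rightarrow> (nat \<Rightarrow> real) \<Rightarrow> (nat \<Rightarrow> complex) \<Rightarrow>
   nat \<Rightarrow> real" where
  "residual_update L N x m d a p =
     (let S1 = leak_subtracted L N x m d a p (1/2);
          S2 = leak_subtracted L N x m d a p (-1/2);
          h = 1/2 * ((S1 + S2) / (S1 - S2));
          zinv = of_real (cos (pi / real N)) - 2 * \<i> * h * of_real (sin (pi / real N))
      in d p - real N / (2 * pi) * Im (Ln zinv))"

definition amplitude_update ::
  "nat \<Rightarrow> nat \<Rightarrow> (nat \<Rightarrow> complex) \<Rightarrow> (nat \<Rightarrow> int) \<Rightarrow> (nat \<Rightarrow> real) \<Rightarrow> (nat \<Rightarrow> complex) \<Rightarrow>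
   nat \<Rightarrow> complex" where
  "amplitude_update L N x m d a p =
     (1 / of_nat N) * (\<Sum>n<N. x n * cis (- (2 * pi * freq_est N m d p * real n))) -
     (\<Sum>l\<in>{..<L} - {p}. a l / of_nat N *
        ((1 - cis (2 * pi * real N * (freq_est N m d l - freq_est N m d p))) /
         (1 - cis (2 * pi * (freq_est N m d l - freq_est N m d p)))))"

text \<open>The amplitude update uses the residual estimate that has just been updated.\<close>

definition component_step ::
  "nat \<Rightarrow> nat \<Rightarrow> (nat \<Rightarrow> complex) \<Rightarrow> (nat \<Rightarrow> int) \<Rightarrow> nat \<Rightarrow>
   (nat \<Rightarrow> real) \<times> (nat \<Rightarrow> complex) \<Rightarrow> (nat \<Rightarrow> real) \<times> (nat \<Rightarrow> complex)" where
  "component_step L N x m p = (\<lambda>(d, a).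
     let d' = d(p := residual_update L N x m d a p)
     in (d', a(p := amplitude_update L N x m d' a p)))"

definition sweep ::
  "nat \<Rightarrow> nat \<Rightarrow> (nat \<Rightarrow> complex) \<Rightarrow> (nat \<Rightarrow> int) \<Rightarrow>
   (nat \<Rightarrow> real) \<times> (nat \<Rightarrow> complex) \<Rightarrow> (nat \<Rightarrow> real) \<times> (nat \<Rightarrow> complex)" where
  "sweep L N x m = fold (component_step L N x m) [0..<L]"

definition residual_est ::
  "nat \<Rightarrow> nat \<Rightarrow> (nat \<Rightarrow> complex) \<Rightarrow> (nat \<Rightarrow> int) \<Rightarrow> nat \<Rightarrow> nat \<Rightarrow> real" where
  "residual_est L N x m Q = fst ((sweep L N x m ^^ Q) (\<lambda>_. 0, \<lambda>_. 0))"

definition final_freq_est ::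
  "nat \<Rightarrow> nat \<Rightarrow> (nat \<Rightarrow> complex) \<Rightarrow> (nat \<Rightarrow> int) \<Rightarrow> nat \<Rightarrow> nat \<Rightarrow> real" where
  "final_freq_est L N x m Q = freq_est N m (residual_est L N x m Q)"

subsection \<open>The iteration map, its fixed points and its rate\<close>

text \<open>The amplitude estimates belonging to given residuals satisfy the amplitude equation for all
  components simultaneously. This linear system has the Gram matrix of the estimated exponentials
  as its matrix, hence exactly one solution when the estimated frequencies are distinct modulo 1.
  With this choice the fixed points of the map below are exactly the residual parts of the stationary
  states of \<open>sweep\<close>.\<close>

definition amplitudes_of ::
  "nat \<Rightarrow> nat \<Rightarrow> (nat \<Rightarrow> complex) \<Rightarrow> (nat \<Rightarrow> int) \<Rightarrow> (nat \<Rightarrow> real) \<Rightarrow> nat \<Rightarrow> complex" where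
  "amplitudes_of L N x m \<nu> =
     (SOME a. (\<forall>p<L. a p = amplitude_update L N x m \<nu> a p) \<and> (\<forall>p\<ge>L. a p = 0))"

definition iteration_map ::
  "nat \<Rightarrow> nat \<Rightarrow> (nat \<Rightarrow> complex) \<Rightarrow> (nat \<Rightarrow> int) \<Rightarrow> (nat \<Rightarrow> real) \<Rightarrow> nat \<Rightarrow> real" where
  "iteration_map L N x m \<nu> p = residual_update L N x m \<nu> (amplitudes_of L N x m \<nu>) p"

definition is_fixed_point ::
  "nat \<Rightarrow> nat \<Rightarrow> (nat \<Rightarrow> complex) \<Rightarrow> (nat \<Rightarrow> int) \<Rightarrow> (nat \<Rightarrow> real) \<Rightarrow> bool" where
  "is_fixed_point L N x m \<nu> \<longleftrightarrow> (\<forall>p<L. iteration_map L N x m \<nu> p = \<nu> p)"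

definition residual_cube :: "nat \<Rightarrow> (nat \<Rightarrow> real) set" where
  "residual_cube L = {\<nu>. \<forall>l<L. \<nu> l \<in> {-1/2..1/2}}"

text \<open>The least contraction constant on the cube; it is \<open>\<infinity>\<close> if there is none.\<close>

definition convergence_rate ::
  "nat \<Rightarrow> nat \<Rightarrow> (nat \<Rightarrow> complex) \<Rightarrow> (nat \<Rightarrow> int) \<Rightarrow> ereal" where
  "convergence_rate L N x m =
     Inf {ereal r | r. 0 \<le> r \<and>
       (\<forall>\<nu>1\<in>residual_cube L. \<forall>\<nu>2\<in>residual_cube L.
          (\<Sum>l<L. \<bar>iteration_map L N x m \<nu>2 l - iteration_map L N x m \<nu>1 l\<bar>\<^sup>2)
            \<le> r\<^sup>2 * (\<Sum>l<L. \<bar>\<nu>2 l - \<nu>1 l\<bar>\<^sup>2))}"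

end

theory Submission
  imports Defs "HOL-Complex_Analysis.Cauchy_Integral_Theorem" "HOL-Real_Asymp.Real_Asymp"
begin

text \<open>
  Write \<open>D(t)\<close> for the DFT coefficient of a unit exponential that is \<open>t\<close> bins away. Both the
  leakage-subtracted coefficients and the amplitude update have the form
  \<open>A\<^sub>p D(\<delta>\<^sub>p - d\<^sub>p - s) + E\<close>, where the interference \<open>E\<close> collects differences of far leakage terms
  and one noise coefficient. Without interference the update of \<open>d\<^sub>p\<close> is exact; with it the estimate
  of \<open>z\<^sup>-\<^sup>1\<close> is multiplied by \<open>1 + \<xi>/N\<close> with \<open>\<xi>\<close> a smooth function of \<open>E\<close> vanishing at \<open>0\<close>, so the error
  \<open>-N/(2\<pi>) Im Ln (1 + \<xi>/N)\<close> is as small, and as Lipschitz in the current estimates, as \<open>E\<close>.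

  Far leakage and its derivative are \<open>O(1/N)\<close>. The noise enters only through the maximum \<open>N T\<close> of the
  moduli of the partial sums of \<open>w(k) exp (-2\<pi>j f\<^sub>l k)\<close>: Abel summation bounds the noise coefficient and
  its Lipschitz constant by a multiple of \<open>T\<close>, uniformly over all candidate frequencies. Chernoff's inequality and
  a union bound give \<open>T = O(\<surd>(ln N / N))\<close> outside an event of polynomially small probability, hence
  almost surely for all large \<open>N\<close>. So the sweep is a contraction around a unique fixed point at
  distance \<open>O(\<surd>(ln N / N))\<close> from the true residuals.

  After two sweeps the error equals an explicit linear functional of the noise, of variance
  \<open>\<pi>\<^sup>2 / (64 \<rho> N)\<close>, up to \<open>O(ln N / N)\<close>; on the exceptional event the error is at most polynomial in
  \<open>N\<close>, which its probability outweighs.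
\<close>

subsection \<open>The Dirichlet kernel\<close>

text \<open>Two obstacles shape the argument. First, the bins are random and known only to lie
  within half a bin of the truth. Everything is therefore expanded around the deterministic
  frequencies \<open>f l\<close>: after substituting \<open>m l = N f l - \<delta> l\<close>, the
  estimates enter only through the errors \<open>d l - \<delta> l\<close>. The noise then has to be
  controlled at \<open>L\<close> fixed frequencies, and the union bound never sees the bins. Second,
  the amplitude update is not contracting in its own residual: an error in the residual changes the
  coefficient by an amount of the order of the amplitude. The update of residual and amplitude
  together contracts only because the amplitude is computed from the residual just updated, whose
  variation is already small. All contraction estimates are in the maximum norm over the components,
  written out coordinate by coordinate, since vectors are functions on \<open>nat\<close> of which
  only \<open>L\<close> values matter.\<close>

lemma cis_minus_one_norm: "cmod (cis x - 1) = 2 * \<bar>sin (x / 2)\<bar>"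
  using dist_exp_i_1[of x] by (simp add: cis_conv_exp)

lemma cis_lipschitz: "cmod (cis x - cis y) \<le> \<bar>x - y\<bar>"
proof -
  have "cmod (cis x - cis y) = cmod (cis y * (cis (x - y) - 1))"
    by (simp add: algebra_simps cis_mult)
  also have "\<dots> = 2 * \<bar>sin ((x - y) / 2)\<bar>"
    by (simp add: norm_mult cis_minus_one_norm)
  also have "\<dots> \<le> \<bar>x - y\<bar>"
    using abs_sin_x_le_abs_x[of "(x - y) / 2"] by simp
  finally show ?thesis .
qed

lemma cis_second_order: "cmod (cis x - 1 - \<i> * x) \<le> x\<^sup>2 / 2"
  using iexp_approx1[of x 1] by (simp add: cis_conv_exp numeral_2_eq_2 power2_eq_square algebra_simps)

text \<open>The cubic Taylor bound leaves the factor \<open>1 - x\<^sup>2 / 6\<close>, and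
  \<open>1.89\<^sup>2 < 18/5\<close>. The range is \<open>3.15 * (3/5)\<close>: it covers
  \<open>pi * (1/2 - u)\<close> for every \<open>u\<close> between 0 and 11/10.\<close>

lemma abs_sin_lower:
  fixes x :: real
  assumes "\<bar>x\<bar> \<le> 189/100"
  shows "2/5 * \<bar>x\<bar> \<le> \<bar>sin x\<bar>"
proof -
  have "\<bar>sin x - x\<bar> \<le> \<bar>x\<bar> ^ 3 / 6"
    using Maclaurin_sin_bound[of x 3] by (simp add: eval_nat_numeral sin_coeff_def)
  moreover have "\<bar>x\<bar> ^ 3 / 6 \<le> 3/5 * \<bar>x\<bar>"
  proof -
    have "\<bar>x\<bar> * \<bar>x\<bar> \<le> 189/100 * (189/100)"
      using assms by (intro mult_mono) auto
    then have "\<bar>x\<bar> * (\<bar>x\<bar> * \<bar>x\<bar>) \<le> \<bar>x\<bar> * (18/5)"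
      by (intro mult_left_mono) auto
    then show ?thesis by (simp add: power3_eq_cube)
  qed
  ultimately show ?thesis by linarith
qed

text \<open>Every coefficient used by the estimator is a combination of values of this kernel: the leakage
  of a unit exponential that is \<open>t\<close> bins away.\<close>

definition dirichlet :: "nat \<Rightarrow> real \<Rightarrow> complex" where
  "dirichlet N t = (1 / of_nat N) * (\<Sum>n<N. cis (2 * pi * t * real n / real N))"

lemma dirichlet_0 [simp]: "N > 0 \<Longrightarrow> dirichlet N 0 = 1"
  by (simp add: dirichlet_def)

lemma norm_dirichlet_le: "cmod (dirichlet N t) \<le> 1"
proof -
  have "cmod (\<Sum>n<N. cis (2 * pi * t * real n / real N)) \<le> (\<Sum>n<N. 1)"
    by (intro sum_norm_le) simp
  then show ?thesis
    by (cases "N = 0") (simp_all add: dirichlet_def norm_mult norm_divide field_simps)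
qed

lemma dirichlet_lipschitz: "cmod (dirichlet N t - dirichlet N t') \<le> 2 * pi * \<bar>t - t'\<bar>"
proof (cases "N = 0")
  case False
  have "cmod (\<Sum>n<N. cis (2 * pi * t * real n / real N) - cis (2 * pi * t' * real n / real N))
      \<le> (\<Sum>n<N. 2 * pi * \<bar>t - t'\<bar>)"
  proof (intro sum_norm_le)
    fix n assume n: "n \<in> {..<N}"
    have "cmod (cis (2 * pi * t * real n / real N) - cis (2 * pi * t' * real n / real N))
        \<le> \<bar>2 * pi * t * real n / real N - 2 * pi * t' * real n / real N\<bar>"
      by (rule cis_lipschitz)
    also have "\<dots> = 2 * pi * \<bar>t - t'\<bar> * (real n / real N)"
      by (simp flip: right_diff_distrib left_diff_distrib diff_divide_distrib add: abs_mult)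
    also have "\<dots> \<le> 2 * pi * \<bar>t - t'\<bar> * 1"
      using n by (intro mult_left_mono) (auto simp: divide_le_eq)
    finally show "cmod (cis (2 * pi * t * real n / real N) - cis (2 * pi * t' * real n / real N))
        \<le> 2 * pi * \<bar>t - t'\<bar>" by simp
  qed
  then show ?thesis
    using False
    by (simp add: dirichlet_def norm_mult norm_divide field_simps flip: sum_subtractf right_diff_distrib diff_divide_distrib)
qed (simp add: dirichlet_def)

lemma dirichlet_geometric:
  assumes "N > 0"
  shows "dirichlet N t * (1 - cis (2 * pi * t / real N)) = (1 - cis (2 * pi * t)) / of_nat N"
proof -
  have "(1 - cis (2 * pi * t / real N)) * (\<Sum>n<N. cis (2 * pi * t / real N) ^ n)
      = 1 - cis (2 * pi * t / real N) ^ N"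
    by (rule one_diff_power_eq[symmetric])
  moreover have "cis (2 * pi * t / real N) ^ n = cis (2 * pi * t * real n / real N)" for n
    by (simp add: Complex.DeMoivre mult.commute)
  ultimately show ?thesis
    using assms by (simp add: dirichlet_def mult.commute)
qed

lemma dirichlet_eq:
  assumes "N > 0" "cis (2 * pi * t / real N) \<noteq> 1"
  shows "dirichlet N t = 1 / of_nat N * ((1 - cis (2 * pi * t)) / (1 - cis (2 * pi * t / real N)))"
  using dirichlet_geometric[OF assms(1), of t] assms by (simp add: divide_simps mult.assoc) (simp add: algebra_simps)

text \<open>Half a bin to either side turns \<open>cis (2 * pi * u)\<close> into its negative, so
  both coefficients share one numerator; it is the \<open>1 + cis\<close> of the estimator.\<close>

lemma dirichlet_half_bins:
  assumes "N > 0"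
  shows "dirichlet N (u - 1/2) * (1 - cis (2 * pi * (u - 1/2) / real N)) = (1 + cis (2 * pi * u)) / of_nat N"
    and "dirichlet N (u + 1/2) * (1 - cis (2 * pi * (u + 1/2) / real N)) = (1 + cis (2 * pi * u)) / of_nat N"
  unfolding dirichlet_geometric[OF assms]
  by (simp_all add: algebra_simps cis_divide[symmetric] cis_mult[symmetric])

text \<open>Eliminating the shared numerator leaves an equation linear in
  \<open>cis (- (2 * pi * u / real N))\<close>. Its solution is the estimator's formula for
  \<open>zinv\<close>, which is why the update is exact without interference.\<close>

lemma dirichlet_half_bins_relation:
  assumes "N > 0"
  shows "dirichlet N (u - 1/2) * (cis (- (pi / real N)) - cis (- (2 * pi * u / real N)))
       = dirichlet N (u + 1/2) * (cis (pi / real N) - cis (- (2 * pi * u / real N)))"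
proof -
  have "cis (- (2 * pi * u / real N)) * (1 - cis (2 * pi * (u - 1/2) / real N))
      = cis (- (2 * pi * u / real N)) - cis (- (pi / real N))"
    using assms by (simp add: algebra_simps cis_mult) (simp add: field_simps)
  moreover have "cis (- (2 * pi * u / real N)) * (1 - cis (2 * pi * (u + 1/2) / real N))
      = cis (- (2 * pi * u / real N)) - cis (pi / real N)"
    using assms by (simp add: algebra_simps cis_mult) (simp add: field_simps)
  moreover have "cis (- (2 * pi * u / real N)) * (dirichlet N (u - 1/2) * (1 - cis (2 * pi * (u - 1/2) / real N)))
      = cis (- (2 * pi * u / real N)) * (dirichlet N (u + 1/2) * (1 - cis (2 * pi * (u + 1/2) / real N)))"
    by (simp only: dirichlet_half_bins[OF assms])
  ultimately show ?thesis by algebra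
qed

text \<open>The zeros of \<open>cos (pi * u)\<close> at 1/2 and -1/2 are simple and matched by those
  of the quadratic; the next ones, at 3/2 and -3/2, lie outside the range. The factor
  \<open>u\<^sup>2 - 1/4\<close> will cancel against the denominators of the two kernels.\<close>

lemma abs_cos_lower:
  assumes "\<bar>u\<bar> \<le> 11/10"
  shows "3/4 * \<bar>u\<^sup>2 - 1/4\<bar> \<le> \<bar>cos (pi * u)\<bar>"
proof -
  have main: "3/4 * \<bar>u\<^sup>2 - 1/4\<bar> \<le> \<bar>cos (pi * u)\<bar>" if "0 \<le> u" "u \<le> 11/10" for u :: real
  proof -
    have pi: "3.14 \<le> pi" "pi \<le> 3.15" using pi_approx by auto
    have v: "\<bar>1/2 - u\<bar> \<le> 3/5" using that by (auto simp: abs_if)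
    have "\<bar>pi * (1/2 - u)\<bar> = pi * \<bar>1/2 - u\<bar>" by (simp add: abs_mult)
    also have "\<dots> \<le> 3.15 * (3/5)" using pi v by (intro mult_mono) auto
    finally have "2/5 * \<bar>pi * (1/2 - u)\<bar> \<le> \<bar>sin (pi * (1/2 - u))\<bar>"
      by (intro abs_sin_lower) simp
    also have "sin (pi * (1/2 - u)) = cos (pi * u)"
      by (simp add: algebra_simps cos_sin_eq)
    finally have *: "2/5 * (pi * \<bar>1/2 - u\<bar>) \<le> \<bar>cos (pi * u)\<bar>"
      by (simp add: abs_mult)
    have "\<bar>u\<^sup>2 - 1/4\<bar> = \<bar>1/2 - u\<bar> * (u + 1/2)"
    proof -
      have "u\<^sup>2 - 1/4 = (u - 1/2) * (u + 1/2)" by (simp add: power2_eq_square algebra_simps)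
      then show ?thesis using that by (simp add: abs_mult abs_minus_commute)
    qed
    also have "\<dots> \<le> \<bar>1/2 - u\<bar> * (8/5)"
      using that by (intro mult_left_mono) auto
    finally have "3/4 * \<bar>u\<^sup>2 - 1/4\<bar> \<le> 6/5 * \<bar>1/2 - u\<bar>" by simp
    also have "\<dots> \<le> 2/5 * (pi * \<bar>1/2 - u\<bar>)"
      using mult_right_mono[of 3 pi "\<bar>1/2 - u\<bar>"] pi by simp
    finally show ?thesis using * by linarith
  qed
  show ?thesis
    using main[of "\<bar>u\<bar>"] assms by (cases "u \<ge> 0") (auto simp: abs_if)
qed

lemma dirichlet_diff_product:
  assumes "N > 0"
  shows "(dirichlet N (u - 1/2) - dirichlet N (u + 1/2))
      * ((1 - cis (2 * pi * (u - 1/2) / real N)) * (1 - cis (2 * pi * (u + 1/2) / real N)))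
      = (1 + cis (2 * pi * u)) / of_nat N * (cis (2 * pi * (u - 1/2) / real N) - cis (2 * pi * (u + 1/2) / real N))"
  using dirichlet_half_bins[OF assms, of u] by algebra

text \<open>This difference is the denominator of \<open>h\<close> for a unit tone at offset
  \<open>u\<close>. In the product formula both sides are comparable to
  \<open>\<bar>u\<^sup>2 - 1/4\<bar>\<close>; dividing it out leaves a bound independent of
  \<open>N\<close> and \<open>u\<close>.\<close>

lemma dirichlet_diff_lower:
  assumes "N \<ge> 2" "\<bar>u\<bar> \<le> 11/10"
  shows "1/20 \<le> cmod (dirichlet N (u - 1/2) - dirichlet N (u + 1/2))"
proof -
  have pi: "3.14 \<le> pi" "pi \<le> 3.15" using pi_approx by auto
  have N: "N > 0" "real N \<ge> 2" using assms by auto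
  define \<beta> where "\<beta> = pi / real N"
  have \<beta>: "\<beta> > 0" "\<beta> \<le> 189/100" using N pi by (auto simp: \<beta>_def field_simps)
  have ne: "cis (2 * pi / real N) \<noteq> 1"
  proof -
    have "sin (2 * pi / real N / 2) > 0"
      using N by (intro sin_gt_zero) (auto simp: field_simps)
    then show ?thesis using cis_minus_one_norm[of "2 * pi / real N"] by auto
  qed
  \<comment> \<open>At the first two points the product formula reads \<open>0 = 0\<close>. The
    difference there has modulus 1, since the kernel is 1 at 0 and vanishes at 1 and -1.\<close>
  consider "u = 1/2" | "u = -1/2" | "u\<^sup>2 \<noteq> 1/4"
    by (metis power2_eq_iff power_one_over four_x_squared power2_eq_square minus_divide_left
        mult.right_neutral)
  then show ?thesis
  proof cases
    case 1
    have "dirichlet N 1 * (1 - cis (2 * pi / real N)) = 0"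
      using dirichlet_geometric[OF N(1), of 1] by simp
    then have "dirichlet N 1 = 0" using ne by simp
    then show ?thesis unfolding 1 using N by simp
  next
    case 2
    have "dirichlet N (- 1) * (1 - cis (- (2 * pi / real N))) = 0"
      using dirichlet_geometric[OF N(1), of "- 1"] by (simp add: cis_cnj[symmetric])
    moreover have "cis (- (2 * pi / real N)) \<noteq> 1"
      using ne by (metis cis_cnj complex_cnj_cnj complex_cnj_one)
    ultimately have "dirichlet N (- 1) = 0" by simp
    then show ?thesis unfolding 2 using N by simp
  next
    case 3
    define R where "R = cmod (dirichlet N (u - 1/2) - dirichlet N (u + 1/2))"
    have f: "cmod (1 - cis (2 * pi * v / real N)) \<le> 2 * pi * \<bar>v\<bar> / real N" for v
      using cis_lipschitz[of 0 "2 * pi * v / real N"] by (simp add: abs_mult)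
    have 1: "cmod (1 + cis (2 * pi * u)) = 2 * \<bar>cos (pi * u)\<bar>"
    proof -
      have "cis (pi + 2 * pi * u) = - cis (2 * pi * u)" by (simp add: cis_mult[symmetric])
      then have "cmod (1 + cis (2 * pi * u)) = cmod (cis (pi + 2 * pi * u) - 1)"
        by (metis norm_minus_cancel minus_diff_eq diff_minus_eq_add add.commute minus_add_distrib add_uminus_conv_diff)
      also have "\<dots> = 2 * \<bar>sin (pi / 2 + pi * u)\<bar>"
        by (simp add: cis_minus_one_norm add_divide_distrib)
      finally show ?thesis by (simp add: sin_add)
    qed
    have 2: "cmod (cis (2 * pi * (u - 1/2) / real N) - cis (2 * pi * (u + 1/2) / real N)) = 2 * sin \<beta>"
    proof -
      have "cis (2 * pi * (u - 1/2) / real N) - cis (2 * pi * (u + 1/2) / real N)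
          = - (cis (2 * pi * (u - 1/2) / real N) * (cis (2 * \<beta>) - 1))"
        using N by (simp add: algebra_simps cis_mult \<beta>_def) (simp add: field_simps)
      then have "cmod (cis (2 * pi * (u - 1/2) / real N) - cis (2 * pi * (u + 1/2) / real N)) = 2 * \<bar>sin \<beta>\<bar>"
        by (simp add: norm_mult cis_minus_one_norm)
      moreover have "sin \<beta> \<ge> 0" using N \<beta> by (intro sin_ge_zero) (auto simp: \<beta>_def field_simps)
      ultimately show ?thesis by simp
    qed
    have s\<beta>: "sin \<beta> \<ge> 2/5 * \<beta>"
      using abs_sin_lower[of \<beta>] \<beta> sin_ge_zero[of \<beta>] N by (auto simp: \<beta>_def field_simps)
    have "2 * (3/4 * \<bar>u\<^sup>2 - 1/4\<bar>) / real N * (2 * (2/5 * \<beta>)) \<le> 2 * \<bar>cos (pi * u)\<bar> / real N * (2 * sin \<beta>)"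
      using abs_cos_lower[OF assms(2)] s\<beta> \<beta> N by (intro mult_mono divide_right_mono) auto
    also have "\<dots> = R * (cmod (1 - cis (2 * pi * (u - 1/2) / real N)) * cmod (1 - cis (2 * pi * (u + 1/2) / real N)))"
      using dirichlet_diff_product[OF N(1), of u, THEN arg_cong, of cmod]
      unfolding norm_mult 1 2 norm_divide R_def by simp
    also have "\<dots> \<le> R * ((2 * pi * \<bar>u - 1/2\<bar> / real N) * (2 * pi * \<bar>u + 1/2\<bar> / real N))"
      by (intro mult_left_mono mult_mono f) (auto simp: R_def)
    also have "\<dots> = R * (4 * pi\<^sup>2 * \<bar>u\<^sup>2 - 1/4\<bar> / (real N)\<^sup>2)"
    proof -
      have "\<bar>u - 1/2\<bar> * \<bar>u + 1/2\<bar> = \<bar>u\<^sup>2 - 1/4\<bar>"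
        unfolding abs_mult[symmetric] by (simp add: power2_eq_square algebra_simps)
      then show ?thesis by (simp add: power2_eq_square field_simps)
    qed
    finally have "6/5 * pi * \<bar>u\<^sup>2 - 1/4\<bar> / (real N)\<^sup>2 \<le> R * (4 * pi\<^sup>2 * \<bar>u\<^sup>2 - 1/4\<bar> / (real N)\<^sup>2)"
      by (simp add: \<beta>_def power2_eq_square)
    \<comment> \<open>The outcome is that \<open>R\<close> is at least
      \<open>6/5 / (4 * pi)\<close>, about 0.095, so 1/20 leaves room.\<close>
    then have "6/5 * pi \<le> R * (4 * pi\<^sup>2)"
      using 3 N by (simp add: field_simps)
    then have "6/5 \<le> R * (4 * pi)" by (simp add: power2_eq_square)
    moreover have "R * (4 * pi) \<le> R * 12.6" using pi by (intro mult_left_mono) (auto simp: R_def)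
    ultimately show ?thesis unfolding R_def by linarith
  qed
qed

subsection \<open>Noise coefficients and far leakage\<close>

text \<open>Abel summation: the weights \<open>g\<close> contribute only their final value and their
  total variation, so bounds on the partial sums of \<open>y\<close> alone serve for all weights at
  once.\<close>

lemma norm_partial_summation_le:
  fixes y g :: "nat \<Rightarrow> complex"
  assumes "\<And>n. n \<le> N \<Longrightarrow> cmod (\<Sum>k<n. y k) \<le> S"
    and "cmod (g N) \<le> G" and "\<And>n. n < N \<Longrightarrow> cmod (g (Suc n) - g n) \<le> G'"
  shows "cmod (\<Sum>n<N. y n * g n) \<le> S * (G + real N * G')"
proof -
  have S: "0 \<le> S" using assms(1)[of 0] by simp
  have "(\<Sum>n<K. y n * g n) = (\<Sum>k<K. y k) * g K - (\<Sum>n<K. (\<Sum>k<Suc n. y k) * (g (Suc n) - g n))" for K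
    by (induction K) (simp_all add: algebra_simps)
  then have "cmod (\<Sum>n<N. y n * g n)
      \<le> cmod ((\<Sum>k<N. y k) * g N) + cmod (\<Sum>n<N. (\<Sum>k<Suc n. y k) * (g (Suc n) - g n))"
    by (metis norm_triangle_ineq4)
  also have "\<dots> \<le> S * G + (\<Sum>n<N. S * G')"
    using assms S unfolding norm_mult
    by (intro add_mono sum_norm_le) (auto simp: norm_mult intro!: mult_mono simp del: sum.lessThan_Suc)
  finally show ?thesis by (simp add: algebra_simps)
qed

text \<open>The frequency is split into a fixed \<phi> and an offset of \<open>t\<close> bins. Only
  the offset depends on the estimates, so all candidates share the partial sums at \<phi>.\<close>

definition noise_coeff :: "nat \<Rightarrow> (nat \<Rightarrow> complex) \<Rightarrow> real \<Rightarrow> real \<Rightarrow> complex" where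
  "noise_coeff N v \<phi> t =
     1 / of_nat N * (\<Sum>n<N. v n * cis (- (2 * pi * \<phi> * real n)) * cis (- (2 * pi * t * real n / real N)))"

definition partial_noise_bounded :: "nat \<Rightarrow> (nat \<Rightarrow> complex) \<Rightarrow> real \<Rightarrow> real \<Rightarrow> bool" where
  "partial_noise_bounded N v \<phi> T \<longleftrightarrow>
     (\<forall>n\<le>N. cmod (\<Sum>k<n. v k * cis (- (2 * pi * \<phi> * real k))) \<le> real N * T)"

context
  fixes N :: nat and v :: "nat \<Rightarrow> complex" and \<phi> T :: real
  assumes N: "N > 0" and bounded: "partial_noise_bounded N v \<phi> T"
begin

lemma noise_level_nonneg: "0 \<le> T"
  using bounded N by (auto simp: partial_noise_bounded_def dest!: spec[of _ 0] simp: zero_le_mult_iff)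

text \<open>Over \<open>N\<close> steps the weights turn by at most \<open>4 * pi\<close> in total;
  14 bounds \<open>1 + 4 * pi\<close>.\<close>

lemma noise_coeff_bound:
  assumes "\<bar>t\<bar> \<le> 2"
  shows "cmod (noise_coeff N v \<phi> t) \<le> 14 * T"
proof -
  define g where "g n = cis (- (2 * pi * t * real n / real N))" for n
  have "cmod (\<Sum>n<N. v n * cis (- (2 * pi * \<phi> * real n)) * g n)
      \<le> real N * T * (1 + real N * (2 * pi * \<bar>t\<bar> / real N))"
  proof (rule norm_partial_summation_le)
    fix n
    have "- (2 * pi * t * real (Suc n) / real N) - - (2 * pi * t * real n / real N) = - (2 * pi * t / real N)"
      using N by (simp add: field_simps)
    then show "cmod (g (Suc n) - g n) \<le> 2 * pi * \<bar>t\<bar> / real N"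
      unfolding g_def by (intro cis_lipschitz[THEN order_trans]) (simp add: abs_mult)
  qed (use bounded in \<open>auto simp: partial_noise_bounded_def g_def\<close>)
  also have "\<dots> \<le> real N * T * 14"
  proof (intro mult_left_mono)
    have "pi * \<bar>t\<bar> \<le> 3.15 * 2" using assms pi_approx by (intro mult_mono) auto
    then show "1 + real N * (2 * pi * \<bar>t\<bar> / real N) \<le> 14" using N by simp
  qed (simp add: noise_level_nonneg)
  finally show ?thesis
    using N by (simp add: noise_coeff_def g_def norm_mult norm_divide field_simps)
qed

lemma noise_coeff_lipschitz:
  assumes "\<bar>t\<bar> \<le> 2"
  shows "cmod (noise_coeff N v \<phi> t - noise_coeff N v \<phi> t') \<le> 95 * T * \<bar>t - t'\<bar>"
proof -
  define a where "a = - (2 * pi * t / real N)"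
  define a' where "a' = - (2 * pi * t' / real N)"
  define g where "g n = cis (a * real n) - cis (a' * real n)" for n
  have diff: "\<bar>a - a'\<bar> = 2 * pi * \<bar>t - t'\<bar> / real N"
    by (simp add: a_def a'_def abs_mult abs_minus_commute flip: diff_divide_distrib right_diff_distrib)
  have abs_a: "\<bar>a\<bar> * real N \<le> 13"
  proof -
    have "pi * \<bar>t\<bar> \<le> 3.15 * 2" using assms pi_approx by (intro mult_mono) auto
    then show ?thesis using N by (simp add: a_def abs_mult)
  qed
  have cis_a: "cmod (cis (a * real n) - cis (a' * real n)) \<le> \<bar>a - a'\<bar> * real n" for n
    using cis_lipschitz[of "a * real n" "a' * real n"] by (simp add: abs_mult flip: left_diff_distrib)
  have "cmod (\<Sum>n<N. v n * cis (- (2 * pi * \<phi> * real n)) * g n)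
      \<le> real N * T * (\<bar>a - a'\<bar> * real N + real N * (14 * \<bar>a - a'\<bar>))"
  proof (rule norm_partial_summation_le)
    fix n assume n: "n < N"
    \<comment> \<open>Each term carries one difference of \<open>t\<close> and \<open>t'\<close>.
      The first also has the factor \<open>cis a - 1\<close> of order \<open>1/N\<close>, which
      compensates the growth of the phase difference up to index \<open>N\<close>. The sum of all
      contributions, \<open>15 * 2 * pi\<close>, is below 95.\<close>
    have "g (Suc n) - g n = (cis (a * real n) - cis (a' * real n)) * (cis a - 1)
        + cis (a' * real n) * (cis a - cis a')"
      by (simp add: g_def algebra_simps cis_mult)
    then have "cmod (g (Suc n) - g n)
        \<le> cmod (cis (a * real n) - cis (a' * real n)) * cmod (cis a - 1) + cmod (cis a - cis a')"
      by (metis norm_triangle_ineq norm_mult norm_cis mult_1)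
    also have "\<dots> \<le> \<bar>a - a'\<bar> * real N * \<bar>a\<bar> + \<bar>a - a'\<bar>"
    proof (intro add_mono mult_mono)
      show "cmod (cis (a * real n) - cis (a' * real n)) \<le> \<bar>a - a'\<bar> * real N"
        using n by (intro cis_a[THEN order_trans] mult_left_mono) auto
      show "cmod (cis a - 1) \<le> \<bar>a\<bar>" using cis_lipschitz[of a 0] by simp
    qed (auto intro: cis_lipschitz)
    also have "\<dots> = \<bar>a - a'\<bar> * (\<bar>a\<bar> * real N + 1)"
      by (simp add: algebra_simps)
    also have "\<dots> \<le> \<bar>a - a'\<bar> * 14" using abs_a by (intro mult_left_mono) auto
    finally show "cmod (g (Suc n) - g n) \<le> 14 * \<bar>a - a'\<bar>" by simp
  qed (use bounded cis_a in \<open>auto simp: partial_noise_bounded_def g_def\<close>)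
  also have "\<dots> = real N * T * (15 * (2 * pi * \<bar>t - t'\<bar>))"
    unfolding diff using N by (simp add: field_simps)
  also have "\<dots> \<le> real N * T * (95 * \<bar>t - t'\<bar>)"
    using mult_right_mono[of pi "3.15" "\<bar>t - t'\<bar>"] pi_approx noise_level_nonneg abs_ge_zero[of "t - t'"]
    by (intro mult_left_mono) (simp_all del: abs_ge_zero)
  finally have "cmod (\<Sum>n<N. v n * cis (- (2 * pi * \<phi> * real n)) * g n) \<le> real N * T * (95 * \<bar>t - t'\<bar>)" .
  moreover have "noise_coeff N v \<phi> t - noise_coeff N v \<phi> t'
      = 1 / of_nat N * (\<Sum>n<N. v n * cis (- (2 * pi * \<phi> * real n)) * g n)"
    by (simp add: noise_coeff_def g_def a_def a'_def sum_subtractf algebra_simps)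
  ultimately have "cmod (noise_coeff N v \<phi> t - noise_coeff N v \<phi> t')
      \<le> 1 / real N * (real N * T * (95 * \<bar>t - t'\<bar>))"
    using N by (simp only: norm_mult norm_divide norm_one norm_of_nat) (rule mult_left_mono, auto)
  also have "\<dots> = 95 * T * \<bar>t - t'\<bar>"
    using N by (simp add: field_simps)
  finally show ?thesis .
qed

end

section \<open>Quotient bounds and the leakage of distant tones\<close>

lemma norm_quotient_diff_le:
  fixes x y x' y' :: complex
  assumes "c > 0" "c \<le> cmod y" "c \<le> cmod y'" "cmod x' \<le> X"
  shows "cmod (x / y - x' / y') \<le> cmod (x - x') / c + X * cmod (y - y') / c\<^sup>2"
proof -
  have nz: "y \<noteq> 0" "y' \<noteq> 0" and X: "0 \<le> X"
    using assms norm_ge_zero[of x'] by (auto simp del: norm_ge_zero)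
  have "x / y - x' / y' = (x - x') / y + x' * (y' - y) / (y * y')"
    using nz by (simp add: field_simps)
  then have "cmod (x / y - x' / y') \<le> cmod (x - x') / cmod y + cmod x' * cmod (y' - y) / (cmod y * cmod y')"
    by (metis norm_triangle_ineq norm_divide norm_mult)
  also have "\<dots> \<le> cmod (x - x') / c + X * cmod (y' - y) / (c * c)"
    using assms X nz by (intro add_mono frac_le mult_mono) auto
  finally show ?thesis by (simp add: power2_eq_square norm_minus_commute)
qed

text \<open>A distance on the unit circle: \<open>x\<close> must stay away from 0, and also from 1
  and -1, where the exponential returns to 1. Hence frequency differences are bounded both from
  below and from above.\<close>

lemma one_minus_cis_lower:
  assumes "0 < \<gamma>" "\<gamma> / 2 \<le> \<bar>x\<bar>" "\<bar>x\<bar> \<le> 1 - \<gamma> / 2"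
  shows "\<gamma> \<le> cmod (1 - cis (2 * pi * x))"
proof -
  have pi: "3.14 \<le> pi" "pi \<le> 3.15" using pi_approx by auto
  \<comment> \<open>Reflection at 1/2 leaves \<open>\<bar>sin (pi * x)\<bar>\<close> unchanged and
    brings the argument into the range of \<open>abs_sin_lower\<close>.\<close>
  define y where "y = (if \<bar>x\<bar> \<le> 1/2 then \<bar>x\<bar> else 1 - \<bar>x\<bar>)"
  have y: "\<gamma> / 2 \<le> y" "y \<le> 1/2" using assms by (auto simp: y_def)
  have "\<bar>sin (pi * x)\<bar> = \<bar>sin (pi * \<bar>x\<bar>)\<bar>" by (auto simp: abs_if)
  also have "\<dots> = \<bar>sin (pi * y)\<bar>"
    by (auto simp: y_def algebra_simps sin_diff)
  finally have eq: "\<bar>sin (pi * x)\<bar> = \<bar>sin (pi * y)\<bar>" .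
  have y0: "0 \<le> y" using y assms(1) by linarith
  then have "pi * y \<le> 3.15 * (1/2)" using pi y by (intro mult_mono) auto
  then have "2/5 * \<bar>pi * y\<bar> \<le> \<bar>sin (pi * y)\<bar>"
    using pi y0 by (intro abs_sin_lower) (simp add: abs_mult)
  then have "2/5 * (pi * y) \<le> \<bar>sin (pi * y)\<bar>" using pi y0 by (simp add: abs_mult)
  moreover have "3 * y \<le> pi * y" using pi y0 by (intro mult_right_mono) auto
  ultimately have "\<gamma> \<le> 2 * \<bar>sin (pi * x)\<bar>"
    using y eq by linarith
  then show ?thesis
    using cis_minus_one_norm[of "2 * pi * x"] by (simp add: norm_minus_commute)
qed

text \<open>The Lipschitz constant of a quotient with numerators at most 2 and denominators at least
  \<gamma>, both changing at a rate of at most \<open>2 * pi\<close>. It also dominates the plain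
  bound \<open>2 / \<gamma>\<close>.\<close>

definition leakage_const :: "real \<Rightarrow> real" where
  "leakage_const \<gamma> = 2 * pi * (1 / \<gamma> + 2 / \<gamma>\<^sup>2)"

lemma leakage_const_pos: "\<gamma> > 0 \<Longrightarrow> leakage_const \<gamma> > 0"
  by (auto simp: leakage_const_def intro!: mult_pos_pos add_pos_pos)

text \<open>Away from its pole the closed form is a smooth quotient divided by \<open>N\<close>; as
  offsets are counted in bins, both size and slope are of order \<open>1/N\<close>.\<close>

lemma dirichlet_far:
  assumes "N > 0" "0 < \<gamma>" "\<gamma> / 2 \<le> \<bar>t / real N\<bar>" "\<bar>t / real N\<bar> \<le> 1 - \<gamma> / 2"
    "\<gamma> / 2 \<le> \<bar>t' / real N\<bar>" "\<bar>t' / real N\<bar> \<le> 1 - \<gamma> / 2"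
  shows dirichlet_far_bound: "cmod (dirichlet N t) \<le> leakage_const \<gamma> / real N"
    and dirichlet_far_lipschitz:
      "cmod (dirichlet N t - dirichlet N t') \<le> leakage_const \<gamma> / real N * \<bar>t - t'\<bar>"
proof -
  have pi: "3.14 \<le> pi" using pi_approx by auto
  have lower: "\<gamma> \<le> cmod (1 - cis (2 * pi * t / real N))" "\<gamma> \<le> cmod (1 - cis (2 * pi * t' / real N))"
    using one_minus_cis_lower[of \<gamma> "t / real N"] one_minus_cis_lower[of \<gamma> "t' / real N"] assms by auto
  then have ne: "cis (2 * pi * t / real N) \<noteq> 1" "cis (2 * pi * t' / real N) \<noteq> 1"
    using assms(2) by auto
  have two: "cmod (1 - cis y) \<le> 2" for y
    using norm_triangle_ineq4[of 1 "cis y"] by simp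
  have cis: "cmod ((1 - cis y) - (1 - cis z)) \<le> \<bar>y - z\<bar>" for y z
    using cis_lipschitz[of z y] by (simp add: abs_minus_commute)
  have "cmod ((1 - cis (2 * pi * t)) / (1 - cis (2 * pi * t / real N))) \<le> 2 / \<gamma>"
    unfolding norm_divide using two lower assms by (intro frac_le) auto
  also have "\<dots> \<le> 2 * pi * (1 / \<gamma> + 2 / \<gamma>\<^sup>2)"
  proof -
    have "2 * 1 * (1 / \<gamma>) \<le> 2 * pi * (1 / \<gamma> + 2 / \<gamma>\<^sup>2)"
      using assms pi by (intro mult_mono) auto
    then show ?thesis by simp
  qed
  finally have "cmod ((1 - cis (2 * pi * t)) / (1 - cis (2 * pi * t / real N))) \<le> leakage_const \<gamma>"
    by (simp only: leakage_const_def)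
  moreover have "cmod (dirichlet N t) = cmod ((1 - cis (2 * pi * t)) / (1 - cis (2 * pi * t / real N))) / real N"
    using dirichlet_eq[OF assms(1) ne(1)] by (simp add: norm_mult norm_divide)
  ultimately show "cmod (dirichlet N t) \<le> leakage_const \<gamma> / real N"
    by (simp add: divide_right_mono)
  have "cmod ((1 - cis (2 * pi * t)) / (1 - cis (2 * pi * t / real N))
        - (1 - cis (2 * pi * t')) / (1 - cis (2 * pi * t' / real N)))
      \<le> cmod ((1 - cis (2 * pi * t)) - (1 - cis (2 * pi * t'))) / \<gamma>
        + 2 * cmod ((1 - cis (2 * pi * t / real N)) - (1 - cis (2 * pi * t' / real N))) / \<gamma>\<^sup>2"
    using lower assms two by (intro norm_quotient_diff_le) auto
  also have "\<dots> \<le> (2 * pi * \<bar>t - t'\<bar>) / \<gamma> + 2 * (2 * pi * \<bar>t - t'\<bar>) / \<gamma>\<^sup>2"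
  proof (intro add_mono divide_right_mono mult_left_mono)
    show "cmod ((1 - cis (2 * pi * t)) - (1 - cis (2 * pi * t'))) \<le> 2 * pi * \<bar>t - t'\<bar>"
      using cis[of "2 * pi * t" "2 * pi * t'"] by (simp add: abs_mult flip: right_diff_distrib)
    have "cmod ((1 - cis (2 * pi * t / real N)) - (1 - cis (2 * pi * t' / real N))) \<le> 2 * pi * \<bar>t - t'\<bar> / real N"
      using cis[of "2 * pi * t / real N" "2 * pi * t' / real N"]
      by (simp add: abs_mult flip: right_diff_distrib diff_divide_distrib)
    also have "\<dots> \<le> 2 * pi * \<bar>t - t'\<bar>"
      using assms(1) divide_left_mono[of 1 "real N" "2 * pi * \<bar>t - t'\<bar>"] by simp
    finally show "cmod ((1 - cis (2 * pi * t / real N)) - (1 - cis (2 * pi * t' / real N))) \<le> 2 * pi * \<bar>t - t'\<bar>" .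
  qed (use assms in auto)
  also have "\<dots> = leakage_const \<gamma> * \<bar>t - t'\<bar>"
    by (simp add: leakage_const_def algebra_simps)
  finally have "cmod (1 / of_nat N * ((1 - cis (2 * pi * t)) / (1 - cis (2 * pi * t / real N))
        - (1 - cis (2 * pi * t')) / (1 - cis (2 * pi * t' / real N))))
      \<le> 1 / real N * (leakage_const \<gamma> * \<bar>t - t'\<bar>)"
    unfolding norm_mult norm_divide[of 1] by (intro mult_mono) auto
  then show "cmod (dirichlet N t - dirichlet N t') \<le> leakage_const \<gamma> / real N * \<bar>t - t'\<bar>"
    unfolding dirichlet_eq[OF assms(1) ne(1)] dirichlet_eq[OF assms(1) ne(2)]
    by (simp add: right_diff_distrib)
qed

subsection \<open>Interference in the cleaned coefficients\<close>

text \<open>A single outcome: \<open>v\<close> is a realisation of the noise and \<open>T\<close>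
  its level, so the analysis of the estimator is deterministic. The condition
  \<open>6 \<le> \<gamma> * real N\<close> says that 3 bins are at most \<open>\<gamma> / 2\<close>,
  hence offsets up to 3 bins keep distinct tones apart on the circle.\<close>

locale multitone =
  fixes L N :: nat and A :: "nat \<Rightarrow> complex" and f :: "nat \<Rightarrow> real" and v x :: "nat \<Rightarrow> complex"
    and m :: "nat \<Rightarrow> int" and \<delta> :: "nat \<Rightarrow> real" and \<alpha> b \<gamma> T :: real
  assumes \<alpha>_pos: "0 < \<alpha>" and amp_lower: "l < L \<Longrightarrow> \<alpha> \<le> cmod (A l)"
    and b_pos: "0 < b" and amp_upper: "l < L \<Longrightarrow> cmod (A l) \<le> b"
    and \<gamma>_pos: "0 < \<gamma>" and \<gamma>_le: "\<gamma> \<le> 1/2" and N_large: "6 \<le> \<gamma> * real N"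
    and sep: "\<lbrakk>p < L; l < L; p \<noteq> l\<rbrakk> \<Longrightarrow> \<gamma> \<le> \<bar>f l - f p\<bar>"
      "\<lbrakk>p < L; l < L; p \<noteq> l\<rbrakk> \<Longrightarrow> \<bar>f l - f p\<bar> \<le> 1 - \<gamma>"
    and data: "x n = (\<Sum>l<L. A l * cis (2 * pi * f l * real n)) + v n"
    and bins: "l < L \<Longrightarrow> real N * f l = real_of_int (m l) + \<delta> l"
    and resid: "l < L \<Longrightarrow> \<bar>\<delta> l\<bar> \<le> 1/2"
    and noise: "l < L \<Longrightarrow> partial_noise_bounded N v (f l) T"
    and T_nonneg: "0 \<le> T"
begin

text \<open>Amplitude updates are at most \<open>b + perturb\<close>, so this bound is invariant
  once \<open>perturb\<close> is small.\<close>

definition amp_bound :: real where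
  "amp_bound = 2 * b + 2"

text \<open>The bracket adds up the three changes of a leakage difference: \<open>b\<close> for the
  true tone, twice \<open>amp_bound\<close> because the subtracted kernel depends on two residuals,
  and 1 for the amplitude estimate.\<close>

definition leak_level :: real where
  "leak_level = real L * (b + 2 * amp_bound + 1) * leakage_const \<gamma> / real N"

text \<open>Bounds both the size and the Lipschitz constant of the interference; 100 covers the
  constants 14 and 95 of the noise coefficient.\<close>

definition perturb :: real where
  "perturb = leak_level + 100 * T"

text \<open>The radius exceeds 1, the largest distance of a point of the cube from \<delta>, and
  stays below 3/2, the first offset at which the two half-bin coefficients coincide.\<close>

definition admissible :: "(nat \<Rightarrow> real) \<Rightarrow> (nat \<Rightarrow> complex) \<Rightarrow> bool" where
  "admissible d a \<longleftrightarrow> (\<forall>l<L. \<bar>d l - \<delta> l\<bar> \<le> 11/10 \<and> cmod (a l) \<le> amp_bound)"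

definition interference :: "real \<Rightarrow> (nat \<Rightarrow> real) \<Rightarrow> (nat \<Rightarrow> complex) \<Rightarrow> nat \<Rightarrow> complex" where
  "interference s d a p =
     (\<Sum>l\<in>{..<L} - {p}. A l * dirichlet N (real N * (f l - f p) - (d p - \<delta> p) - s)
        - a l * dirichlet N (real N * (f l - f p) + (d l - \<delta> l) - (d p - \<delta> p) - s))
     + noise_coeff N v (f p) (d p - \<delta> p + s)"

definition cleaned :: "real \<Rightarrow> (nat \<Rightarrow> real) \<Rightarrow> (nat \<Rightarrow> complex) \<Rightarrow> nat \<Rightarrow> complex" where
  "cleaned s d a p = A p * dirichlet N (\<delta> p - d p - s) + interference s d a p"

lemma N_ge: "12 \<le> real N"
proof -
  have "\<gamma> * real N \<le> 1/2 * real N" using \<gamma>_le by (intro mult_right_mono) auto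
  then show ?thesis using N_large by linarith
qed

lemma N_pos: "N > 0"
  using N_ge by (cases N) auto

lemma amp_bound_pos: "0 < amp_bound"
  using b_pos by (simp add: amp_bound_def)

lemma leakage_const_nonneg: "0 \<le> leakage_const \<gamma> / real N"
  using leakage_const_pos[OF \<gamma>_pos] by simp

lemma leak_level_nonneg: "0 \<le> leak_level"
  unfolding leak_level_def using b_pos amp_bound_pos leakage_const_pos[OF \<gamma>_pos] by simp

lemma perturb_nonneg: "0 \<le> perturb"
  using leak_level_nonneg T_nonneg by (simp add: perturb_def)

lemma far:
  assumes "p < L" "l < L" "p \<noteq> l" "\<bar>r\<bar> \<le> 3"
  shows "\<gamma> / 2 \<le> \<bar>(real N * (f l - f p) + r) / real N\<bar>"
    "\<bar>(real N * (f l - f p) + r) / real N\<bar> \<le> 1 - \<gamma> / 2"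
proof -
  have "(real N * (f l - f p) + r) / real N = (f l - f p) + r / real N"
    using N_pos by (simp add: field_simps)
  moreover have "\<bar>r / real N\<bar> \<le> \<gamma> / 2"
    using assms(4) N_large N_pos by (auto simp: field_simps)
  ultimately show "\<gamma> / 2 \<le> \<bar>(real N * (f l - f p) + r) / real N\<bar>"
    and "\<bar>(real N * (f l - f p) + r) / real N\<bar> \<le> 1 - \<gamma> / 2"
    using sep[OF assms(1-3)] by (simp_all only:)
qed

lemma leakage_bound:
  assumes "p < L" "l < L" "p \<noteq> l" "\<bar>r\<bar> \<le> 3"
  shows "cmod (dirichlet N (real N * (f l - f p) + r)) \<le> leakage_const \<gamma> / real N"
  by (rule dirichlet_far_bound[OF N_pos \<gamma>_pos far far]) (use assms in auto)

lemma leakage_lipschitz: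
  assumes "p < L" "l < L" "p \<noteq> l" "\<bar>r\<bar> \<le> 3" "\<bar>r'\<bar> \<le> 3"
  shows "cmod (dirichlet N (real N * (f l - f p) + r) - dirichlet N (real N * (f l - f p) + r'))
    \<le> leakage_const \<gamma> / real N * \<bar>r - r'\<bar>"
  using dirichlet_far_lipschitz[OF N_pos \<gamma>_pos far[of p l r] far[of p l r']] assms by simp

lemma leakage_ne_1:
  assumes "p < L" "l < L" "p \<noteq> l" "\<bar>r\<bar> \<le> 3"
  shows "cis (2 * pi * (real N * (f l - f p) + r) / real N) \<noteq> 1"
  using one_minus_cis_lower[OF \<gamma>_pos far[OF assms]] \<gamma>_pos by auto

lemma dft_coeff_eq:
  assumes p: "p < L"
  shows "dft_coeff N x m d p s =
     (\<Sum>l<L. A l * dirichlet N (real N * (f l - f p) - (d p - \<delta> p) - s))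
     + noise_coeff N v (f p) (d p - \<delta> p + s)"
proof -
  have mp: "real_of_int (m p) = real N * f p - \<delta> p"
    using bins[OF p] by simp
  have phase: "2 * pi / real N * (real_of_int (m p) + d p + s) * real n
      = 2 * pi * f p * real n + 2 * pi * (d p - \<delta> p + s) * real n / real N" for n
    unfolding mp using N_pos by (simp add: field_simps)
  have tone: "cis (2 * pi * f l * real n) * cis (- (2 * pi / real N * (real_of_int (m p) + d p + s) * real n))
      = cis (2 * pi * (real N * (f l - f p) - (d p - \<delta> p) - s) * real n / real N)" for l n
    unfolding phase cis_mult using N_pos by (intro arg_cong[where f = cis]) (simp add: field_simps)
  have noise: "cis (- (2 * pi / real N * (real_of_int (m p) + d p + s) * real n))
      = cis (- (2 * pi * f p * real n)) * cis (- (2 * pi * (d p - \<delta> p + s) * real n / real N))" for n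
    unfolding phase cis_mult by simp
  have "x n * cis (- (2 * pi / real N * (real_of_int (m p) + d p + s) * real n))
      = (\<Sum>l<L. A l * cis (2 * pi * (real N * (f l - f p) - (d p - \<delta> p) - s) * real n / real N))
        + v n * cis (- (2 * pi * f p * real n)) * cis (- (2 * pi * (d p - \<delta> p + s) * real n / real N))" for n
  proof -
    define E where "E = cis (- (2 * pi / real N * (real_of_int (m p) + d p + s) * real n))"
    have "x n * E = (\<Sum>l<L. A l * (cis (2 * pi * f l * real n) * E)) + v n * E"
      by (simp add: data distrib_right sum_distrib_right mult.assoc)
    also have "v n * E = v n * cis (- (2 * pi * f p * real n)) * cis (- (2 * pi * (d p - \<delta> p + s) * real n / real N))"
      by (simp only: E_def noise[of n]) (simp only: mult.assoc)
    finally show ?thesis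
      unfolding E_def tone .
  qed
  then have "(\<Sum>n<N. x n * cis (- (2 * pi / real N * (real_of_int (m p) + d p + s) * real n)))
      = (\<Sum>n<N. \<Sum>l<L. A l * cis (2 * pi * (real N * (f l - f p) - (d p - \<delta> p) - s) * real n / real N))
        + (\<Sum>n<N. v n * cis (- (2 * pi * f p * real n)) * cis (- (2 * pi * (d p - \<delta> p + s) * real n / real N)))"
    by (simp only: sum.distrib)
  also have "(\<Sum>n<N. \<Sum>l<L. A l * cis (2 * pi * (real N * (f l - f p) - (d p - \<delta> p) - s) * real n / real N))
      = (\<Sum>l<L. A l * (\<Sum>n<N. cis (2 * pi * (real N * (f l - f p) - (d p - \<delta> p) - s) * real n / real N)))"
    by (subst sum.swap) (simp add: sum_distrib_left)
  finally show ?thesis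
    unfolding dft_coeff_def noise_coeff_def dirichlet_def
    by (simp add: distrib_left sum_distrib_left mult_ac)
qed

lemma cleaned_eq:
  assumes p: "p < L"
  shows "cleaned s d a p = dft_coeff N x m d p s
    - (\<Sum>l\<in>{..<L} - {p}. a l * dirichlet N (real N * (f l - f p) + (d l - \<delta> l) - (d p - \<delta> p) - s))"
proof -
  have "(\<Sum>l<L. A l * dirichlet N (real N * (f l - f p) - (d p - \<delta> p) - s))
      = A p * dirichlet N (\<delta> p - d p - s)
        + (\<Sum>l\<in>{..<L} - {p}. A l * dirichlet N (real N * (f l - f p) - (d p - \<delta> p) - s))"
    using p by (subst sum.remove[of _ p]) auto
  then show ?thesis
    unfolding cleaned_def interference_def dft_coeff_eq[OF p] by (simp add: sum_subtractf)
qed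

lemma offset_le_3:
  assumes "\<forall>l<L. \<bar>d l - \<delta> l\<bar> \<le> 11/10" "p < L" "l < L" "\<bar>s\<bar> \<le> 1/2"
  shows "\<bar>(d l - \<delta> l) - (d p - \<delta> p) - s\<bar> \<le> 3"
  using assms(1)[rule_format, OF assms(2)] assms(1)[rule_format, OF assms(3)] assms(4) by linarith

lemma leak_subtracted_eq:
  assumes d: "\<forall>l<L. \<bar>d l - \<delta> l\<bar> \<le> 11/10" and p: "p < L" and s: "s = 1/2 \<or> s = -1/2"
  shows "leak_subtracted L N x m d a p s = cleaned s d a p"
proof -
  have s': "\<bar>s\<bar> \<le> 1/2" using s by auto
  have "a l / of_nat N * ((1 + cis (2 * pi * (d l - d p))) /
         (1 - cis (2 * pi / real N * (real_of_int (m l - m p) + d l - d p - s))))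
      = a l * dirichlet N (real N * (f l - f p) + (d l - \<delta> l) - (d p - \<delta> p) - s)"
    if l: "l \<in> {..<L} - {p}" for l
  proof -
    define t where "t = real N * (f l - f p) + ((d l - \<delta> l) - (d p - \<delta> p) - s)"
    have t: "t = real_of_int (m l - m p) + d l - d p - s"
      using bins[of l] bins[OF p] l by (simp add: t_def algebra_simps)
    have "cis (2 * pi * t) = cis (2 * pi * real_of_int (m l - m p)) * (cis (2 * pi * (d l - d p)) * cis (- (2 * pi * s)))"
      unfolding t cis_mult by (simp add: algebra_simps)
    \<comment> \<open>The bin difference is a whole number of turns and the half-bin offset is half
      a turn, which turns \<open>1 - cis\<close> into the \<open>1 + cis\<close> of the
      estimator.\<close>
    also have "cis (2 * pi * real_of_int (m l - m p)) = 1"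
      by (rule cis_multiple_2pi) (rule Ints_of_int)
    also have "cis (- (2 * pi * s)) = -1"
    proof -
      have "2 * pi * s = pi \<or> 2 * pi * s = - pi" using s by auto
      moreover have "cis (- pi) = - 1" by (simp add: complex_eq_iff)
      ultimately show ?thesis by (metis cis_pi minus_minus)
    qed
    finally have num: "1 - cis (2 * pi * t) = 1 + cis (2 * pi * (d l - d p))" by simp
    have "cis (2 * pi * t / real N) \<noteq> 1"
      unfolding t_def using l p offset_le_3[OF d p _ s', of l] by (intro leakage_ne_1) auto
    then have "dirichlet N t = 1 / of_nat N * ((1 - cis (2 * pi * t)) / (1 - cis (2 * pi * t / real N)))"
      by (rule dirichlet_eq[OF N_pos])
    moreover have "real N * (f l - f p) + (d l - \<delta> l) - (d p - \<delta> p) - s = t"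
      by (simp add: t_def)
    ultimately show ?thesis
      unfolding num by (simp only: t) simp
  qed
  then show ?thesis
    unfolding cleaned_eq[OF p] leak_subtracted_def by simp
qed

lemma amplitude_update_eq:
  assumes d: "\<forall>l<L. \<bar>d l - \<delta> l\<bar> \<le> 11/10" and p: "p < L"
  shows "amplitude_update L N x m d a p = cleaned 0 d a p"
proof -
  have "a l / of_nat N * ((1 - cis (2 * pi * real N * (freq_est N m d l - freq_est N m d p))) /
         (1 - cis (2 * pi * (freq_est N m d l - freq_est N m d p))))
      = a l * dirichlet N (real N * (f l - f p) + (d l - \<delta> l) - (d p - \<delta> p) - 0)"
    if l: "l \<in> {..<L} - {p}" for l
  proof -
    define t where "t = real N * (f l - f p) + ((d l - \<delta> l) - (d p - \<delta> p) - 0)"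
    have "t = real_of_int (m l - m p) + d l - d p"
      using bins[of l] bins[OF p] l by (simp add: t_def algebra_simps)
    then have t: "freq_est N m d l - freq_est N m d p = t / real N"
      by (simp add: freq_est_def diff_divide_distrib[symmetric])
    have "cis (2 * pi * t / real N) \<noteq> 1"
      unfolding t_def using l p offset_le_3[OF d p _, of l 0] by (intro leakage_ne_1) auto
    then have "dirichlet N t = 1 / of_nat N * ((1 - cis (2 * pi * t)) / (1 - cis (2 * pi * t / real N)))"
      by (rule dirichlet_eq[OF N_pos])
    moreover have "real N * (f l - f p) + (d l - \<delta> l) - (d p - \<delta> p) - 0 = t"
      by (simp add: t_def)
    moreover have "2 * pi * real N * (t / real N) = 2 * pi * t" "2 * pi * (t / real N) = 2 * pi * t / real N"
      using N_pos by auto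
    ultimately show ?thesis
      unfolding t by simp
  qed
  moreover have "1 / of_nat N * (\<Sum>n<N. x n * cis (- (2 * pi * freq_est N m d p * real n))) = dft_coeff N x m d p 0"
    by (simp add: dft_coeff_def freq_est_def mult.commute)
  ultimately show ?thesis
    unfolding cleaned_eq[OF p] amplitude_update_def by simp
qed

lemma noise_offset:
  assumes "\<bar>d p - \<delta> p\<bar> \<le> 11/10" "\<bar>s\<bar> \<le> 1/2"
  shows "\<bar>d p - \<delta> p + s\<bar> \<le> 2"
  using assms by linarith

lemma leak_coeff_sum:
  assumes "\<And>l. l \<in> {..<L} - {p} \<Longrightarrow> cmod (F l) \<le> (b + 2 * amp_bound + 1) * (leakage_const \<gamma> / real N) * r"
    and "0 \<le> r"
  shows "cmod (\<Sum>l\<in>{..<L} - {p}. F l) \<le> leak_level * r"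
proof -
  have "cmod (\<Sum>l\<in>{..<L} - {p}. F l)
      \<le> (\<Sum>l\<in>{..<L} - {p}. (b + 2 * amp_bound + 1) * (leakage_const \<gamma> / real N) * r)"
    by (intro sum_norm_le assms)
  also have "\<dots> \<le> (\<Sum>l<L. (b + 2 * amp_bound + 1) * (leakage_const \<gamma> / real N) * r)"
    using b_pos amp_bound_pos leakage_const_nonneg assms(2)
    by (intro sum_mono2 mult_nonneg_nonneg) (auto simp del: times_divide_eq_right)
  also have "\<dots> = leak_level * r" by (simp add: leak_level_def)
  finally show ?thesis .
qed

text \<open>Kept apart from the noise, because in the linearisation the leakage counts as a
  remainder of order \<open>1/N\<close> while the noise is the leading term.\<close>

lemma interference_noise_diff:
  assumes "admissible d a" "p < L" "\<bar>s\<bar> \<le> 1/2"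
  shows "cmod (interference s d a p - noise_coeff N v (f p) (d p - \<delta> p + s)) \<le> leak_level"
proof -
  have d: "\<forall>l<L. \<bar>d l - \<delta> l\<bar> \<le> 11/10" using assms(1) by (simp add: admissible_def)
  have "cmod (A l * dirichlet N (real N * (f l - f p) - (d p - \<delta> p) - s)
        - a l * dirichlet N (real N * (f l - f p) + (d l - \<delta> l) - (d p - \<delta> p) - s))
      \<le> (b + 2 * amp_bound + 1) * (leakage_const \<gamma> / real N) * 1" if "l \<in> {..<L} - {p}" for l
  proof -
    have l: "l < L" "p \<noteq> l" using that by auto
    have 1: "cmod (dirichlet N (real N * (f l - f p) + (- (d p - \<delta> p) - s))) \<le> leakage_const \<gamma> / real N"
      using d assms(2) noise_offset[of d p s] assms(3) by (intro leakage_bound assms l) auto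
    have 2: "cmod (dirichlet N (real N * (f l - f p) + ((d l - \<delta> l) - (d p - \<delta> p) - s))) \<le> leakage_const \<gamma> / real N"
      using offset_le_3[OF d assms(2) l(1) assms(3)] by (intro leakage_bound assms l)
    have "cmod (A l * dirichlet N (real N * (f l - f p) - (d p - \<delta> p) - s)
        - a l * dirichlet N (real N * (f l - f p) + (d l - \<delta> l) - (d p - \<delta> p) - s))
      \<le> cmod (A l) * cmod (dirichlet N (real N * (f l - f p) + (- (d p - \<delta> p) - s)))
        + cmod (a l) * cmod (dirichlet N (real N * (f l - f p) + ((d l - \<delta> l) - (d p - \<delta> p) - s)))"
      by (rule norm_triangle_ineq4[THEN order_trans]) (simp add: norm_mult algebra_simps)
    also have "\<dots> \<le> b * (leakage_const \<gamma> / real N) + amp_bound * (leakage_const \<gamma> / real N)"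
      using 1 2 amp_upper[OF l(1)] assms(1) l b_pos amp_bound_pos
      by (intro add_mono mult_mono) (auto simp: admissible_def)
    also have "\<dots> = (b + amp_bound) * (leakage_const \<gamma> / real N)"
      by (simp add: algebra_simps add_divide_distrib)
    also have "\<dots> \<le> (b + 2 * amp_bound + 1) * (leakage_const \<gamma> / real N) * 1"
      using amp_bound_pos leakage_const_nonneg by (simp only: mult_1_right) (intro mult_right_mono, auto)
    finally show ?thesis .
  qed
  from leak_coeff_sum[of p _ 1, OF this] show ?thesis
    by (simp add: interference_def)
qed

lemma interference_bound:
  assumes "admissible d a" "p < L" "\<bar>s\<bar> \<le> 1/2"
  shows "cmod (interference s d a p) \<le> perturb"
proof -
  have "\<bar>d p - \<delta> p + s\<bar> \<le> 2" using assms by (intro noise_offset) (auto simp: admissible_def)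
  from noise_coeff_bound[OF N_pos noise[OF assms(2)] this]
  have "cmod (noise_coeff N v (f p) (d p - \<delta> p + s)) \<le> 100 * T" using T_nonneg by linarith
  with interference_noise_diff[OF assms] norm_triangle_sub[of "interference s d a p" "noise_coeff N v (f p) (d p - \<delta> p + s)"]
  show ?thesis unfolding perturb_def by linarith
qed

lemma interference_lipschitz:
  assumes "admissible d a" "admissible d' a'" "p < L" "\<bar>s\<bar> \<le> 1/2"
    and close: "\<And>l. l < L \<Longrightarrow> \<bar>d l - d' l\<bar> \<le> \<rho>" "\<And>l. l < L \<Longrightarrow> cmod (a l - a' l) \<le> \<rho>"
  shows "cmod (interference s d a p - interference s d' a' p) \<le> perturb * \<rho>"
proof -
  let ?K = "leakage_const \<gamma> / real N"
  have \<rho>: "0 \<le> \<rho>" using close(1)[OF assms(3)] by linarith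
  have d: "\<forall>l<L. \<bar>d l - \<delta> l\<bar> \<le> 11/10" and d': "\<forall>l<L. \<bar>d' l - \<delta> l\<bar> \<le> 11/10"
    using assms(1,2) by (auto simp: admissible_def)
  let ?F = "\<lambda>d a l. A l * dirichlet N (real N * (f l - f p) - (d p - \<delta> p) - s)
        - a l * dirichlet N (real N * (f l - f p) + (d l - \<delta> l) - (d p - \<delta> p) - s)"
  have "cmod (?F d a l - ?F d' a' l) \<le> (b + 2 * amp_bound + 1) * ?K * \<rho>" if "l \<in> {..<L} - {p}" for l
  proof -
    have l: "l < L" "p \<noteq> l" using that by auto
    define D1 where "D1 = dirichlet N (real N * (f l - f p) + (- (d p - \<delta> p) - s))"
    define D1' where "D1' = dirichlet N (real N * (f l - f p) + (- (d' p - \<delta> p) - s))"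
    define D2 where "D2 = dirichlet N (real N * (f l - f p) + ((d l - \<delta> l) - (d p - \<delta> p) - s))"
    define D2' where "D2' = dirichlet N (real N * (f l - f p) + ((d' l - \<delta> l) - (d' p - \<delta> p) - s))"
    have 1: "cmod (D1 - D1') \<le> ?K * \<rho>"
    proof -
      have "cmod (D1 - D1') \<le> ?K * \<bar>(- (d p - \<delta> p) - s) - (- (d' p - \<delta> p) - s)\<bar>"
        unfolding D1_def D1'_def
        using d d' assms(3) noise_offset[of d p s] noise_offset[of d' p s] assms(4)
        by (intro leakage_lipschitz assms l) auto
      also have "\<dots> \<le> ?K * \<rho>"
        using close(1)[OF assms(3)] by (intro mult_left_mono leakage_const_nonneg) linarith
      finally show ?thesis .
    qed
    have 2: "cmod (D2 - D2') \<le> ?K * (2 * \<rho>)"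
    proof -
      have "cmod (D2 - D2') \<le> ?K * \<bar>((d l - \<delta> l) - (d p - \<delta> p) - s) - ((d' l - \<delta> l) - (d' p - \<delta> p) - s)\<bar>"
        unfolding D2_def D2'_def
        using offset_le_3[OF d assms(3) l(1) assms(4)] offset_le_3[OF d' assms(3) l(1) assms(4)]
        by (intro leakage_lipschitz assms l) auto
      also have "\<dots> \<le> ?K * (2 * \<rho>)"
        using close(1)[OF assms(3)] close(1)[OF l(1)] by (intro mult_left_mono leakage_const_nonneg) linarith
      finally show ?thesis .
    qed
    have 3: "cmod D2' \<le> ?K"
      unfolding D2'_def using offset_le_3[OF d' assms(3) l(1) assms(4)] by (intro leakage_bound assms l)
    \<comment> \<open>One change at a time: the kernel of the true tone, the subtracted kernel, the
      amplitude estimate. The last change meets a kernel that is already of order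
      \<open>1/N\<close>.\<close>
    have "?F d a l - ?F d' a' l = A l * (D1 - D1') - (a l * (D2 - D2') + (a l - a' l) * D2')"
      by (simp add: D1_def D1'_def D2_def D2'_def algebra_simps)
    then have "cmod (?F d a l - ?F d' a' l)
        \<le> cmod (A l) * cmod (D1 - D1') + (cmod (a l) * cmod (D2 - D2') + cmod (a l - a' l) * cmod D2')"
      by (metis (no_types, lifting) norm_triangle_ineq4 norm_triangle_ineq norm_mult add_left_mono order_trans)
    also have "\<dots> \<le> b * (?K * \<rho>) + (amp_bound * (?K * (2 * \<rho>)) + \<rho> * ?K)"
      using 1 2 3 amp_upper[OF l(1)] assms(1) l b_pos amp_bound_pos close(2)[OF l(1)] \<rho>
      by (intro add_mono mult_mono) (auto simp: admissible_def)
    also have "\<dots> = (b + 2 * amp_bound + 1) * ?K * \<rho>"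
      by (simp only: algebra_simps)
    finally show ?thesis .
  qed
  from leak_coeff_sum[OF this \<rho>]
  have 1: "cmod (\<Sum>l\<in>{..<L} - {p}. ?F d a l - ?F d' a' l) \<le> leak_level * \<rho>" .
  have 2: "cmod (noise_coeff N v (f p) (d p - \<delta> p + s) - noise_coeff N v (f p) (d' p - \<delta> p + s)) \<le> 100 * T * \<rho>"
  proof -
    have "\<bar>d p - \<delta> p + s\<bar> \<le> 2" using d assms(3,4) by (intro noise_offset) auto
    from noise_coeff_lipschitz[OF N_pos noise[OF assms(3)] this]
    have "cmod (noise_coeff N v (f p) (d p - \<delta> p + s) - noise_coeff N v (f p) (d' p - \<delta> p + s))
        \<le> 95 * T * \<bar>(d p - \<delta> p + s) - (d' p - \<delta> p + s)\<bar>" .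
    also have "\<dots> \<le> 100 * T * \<rho>"
      using T_nonneg close(1)[OF assms(3)] by (intro mult_mono) auto
    finally show ?thesis .
  qed
  have "interference s d a p - interference s d' a' p
      = (\<Sum>l\<in>{..<L} - {p}. ?F d a l - ?F d' a' l)
        + (noise_coeff N v (f p) (d p - \<delta> p + s) - noise_coeff N v (f p) (d' p - \<delta> p + s))"
    unfolding interference_def sum_subtractf[of "?F d a" "?F d' a'"] by simp
  then have "cmod (interference s d a p - interference s d' a' p) \<le> leak_level * \<rho> + 100 * T * \<rho>"
    using norm_triangle_le[OF add_mono[OF 1 2]] by (simp only:)
  then show ?thesis
    unfolding perturb_def distrib_right .
qed

end

subsection \<open>The residual update\<close>

text \<open>The derivative is bounded by 2 on the disc of radius 1/2, which is convex and, shifted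
  by 1, avoids the branch cut.\<close>

lemma Ln_one_plus_lipschitz:
  assumes "cmod z \<le> 1/2" "cmod z' \<le> 1/2"
  shows "cmod (Ln (1 + z) - Ln (1 + z')) \<le> 2 * cmod (z - z')"
proof -
  have "cmod (Ln (1 + z) - Ln (1 + z')) \<le> 2 * norm (z - z')"
  proof (rule field_differentiable_bound[where S = "cball 0 (1/2)" and f' = "\<lambda>z. 1 / (1 + z)"])
    fix y :: complex assume y: "y \<in> cball 0 (1/2)"
    have re: "Re (1 + y) > 0" using y abs_Re_le_cmod[of y] by auto
    then have nr: "1 + y \<notin> \<real>\<^sub>\<le>\<^sub>0" by (auto simp: complex_nonpos_Reals_iff)
    show "((\<lambda>z. Ln (1 + z)) has_field_derivative 1 / (1 + y)) (at y within cball 0 (1/2))"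
      by (rule derivative_eq_intros refl nr | simp add: inverse_eq_divide)+
    have "1 - cmod y \<le> cmod (1 + y)" using norm_triangle_sub[of 1 "- y"] by simp
    then have "1/2 \<le> cmod (1 + y)" using y by simp
    then show "cmod (1 / (1 + y)) \<le> 2" by (simp add: norm_divide divide_simps)
  qed (use assms in auto)
  then show ?thesis by simp
qed

lemma abs_Im_Ln_one_plus:
  assumes "cmod z \<le> 1/2"
  shows "\<bar>Im (Ln (1 + z))\<bar> \<le> 2 * cmod z"
  using Ln_one_plus_lipschitz[OF assms, of 0] abs_Im_le_cmod[of "Ln (1 + z)"] by simp

text \<open>Scaled so as to converge to \<open>2 * pi * \<i> * t\<close>; the factor
  \<open>N\<close> is divided out again in \<open>ratio / of_nat N\<close>.\<close>

definition rot :: "nat \<Rightarrow> real \<Rightarrow> complex" where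
  "rot N t = of_nat N * (cis (2 * pi * t / real N) - 1)"

lemma norm_rot_le: "cmod (rot N t) \<le> 2 * pi * \<bar>t\<bar>"
  using mult_left_mono[OF cis_lipschitz[of "2 * pi * t / real N" 0], of "real N"]
  by (cases "N = 0") (simp_all add: rot_def norm_mult abs_mult)

lemma rot_lipschitz: "cmod (rot N t - rot N t') \<le> 2 * pi * \<bar>t - t'\<bar>"
proof -
  have "rot N t - rot N t' = of_nat N * (cis (2 * pi * t / real N) - cis (2 * pi * t' / real N))"
    by (simp add: rot_def algebra_simps)
  then have "cmod (rot N t - rot N t') \<le> real N * \<bar>2 * pi * t / real N - 2 * pi * t' / real N\<bar>"
    using cis_lipschitz by (simp add: norm_mult mult_left_mono)
  also have "\<dots> \<le> 2 * pi * \<bar>t - t'\<bar>"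
    by (cases "N = 0") (simp_all add: abs_mult flip: diff_divide_distrib right_diff_distrib)
  finally show ?thesis .
qed

lemma rot_approx: "cmod (rot N t - 2 * pi * \<i> * t) \<le> (2 * pi * t)\<^sup>2 / (2 * real N)" if "N > 0"
proof -
  have "rot N t - 2 * pi * \<i> * t = of_nat N * (cis (2 * pi * t / real N) - 1 - \<i> * (2 * pi * t / real N))"
    using that by (simp add: rot_def algebra_simps)
  then have "cmod (rot N t - 2 * pi * \<i> * t) \<le> real N * ((2 * pi * t / real N)\<^sup>2 / 2)"
    using mult_left_mono[OF cis_second_order[of "2 * pi * t / real N"], of "real N"] by (simp add: norm_mult)
  also have "\<dots> = (2 * pi * t)\<^sup>2 / (2 * real N)"
    using that by (simp add: power2_eq_square field_simps)
  finally show ?thesis .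
qed

text \<open>The value of \<open>S1 - S2\<close> for a unit tone without interference.\<close>

definition half_bin_gain :: "nat \<Rightarrow> real \<Rightarrow> complex" where
  "half_bin_gain N u = dirichlet N (u - 1/2) - dirichlet N (u + 1/2)"

lemma half_bin_gain_lipschitz:
  "cmod (half_bin_gain N u - half_bin_gain N u') \<le> 4 * pi * \<bar>u - u'\<bar>"
proof -
  have "half_bin_gain N u - half_bin_gain N u'
      = (dirichlet N (u - 1/2) - dirichlet N (u' - 1/2)) - (dirichlet N (u + 1/2) - dirichlet N (u' + 1/2))"
    by (simp add: half_bin_gain_def)
  then show ?thesis
    using norm_triangle_ineq4[of "dirichlet N (u - 1/2) - dirichlet N (u' - 1/2)" "dirichlet N (u + 1/2) - dirichlet N (u' + 1/2)"]
      dirichlet_lipschitz[of N "u - 1/2" "u' - 1/2"] dirichlet_lipschitz[of N "u + 1/2" "u' + 1/2"]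
    by simp
qed

text \<open>At offset 0 both kernels equal \<open>-2 / rot\<close>, with arguments -1/2 and 1/2,
  where \<open>rot\<close> tends to \<open>-\<i> * pi\<close> and \<open>\<i> * pi\<close>. This
  limit enters the constant of the linearised error.\<close>

lemma half_bin_gain_0:
  assumes "real N \<ge> 12"
  shows "cmod (half_bin_gain N 0 + 4 * \<i> / pi) \<le> 20 / real N"
proof -
  have N: "N > 0" using assms by (cases N) auto
  have pi: "3.14 \<le> pi" "pi \<le> 3.15" using pi_approx by auto
  have r1: "cmod (rot N (- 1/2) - - (\<i> * pi)) \<le> 5 / real N"
   and r2: "cmod (rot N (1/2) - \<i> * pi) \<le> 5 / real N"
  proof -
    have "pi\<^sup>2 \<le> 3.15\<^sup>2" using pi by (intro power_mono) auto
    then have "(2 * pi * (1/2))\<^sup>2 / (2 * real N) \<le> 5 / real N"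
      using N by (simp add: field_simps)
    then show "cmod (rot N (- 1/2) - - (\<i> * pi)) \<le> 5 / real N" "cmod (rot N (1/2) - \<i> * pi) \<le> 5 / real N"
      using rot_approx[OF N, of "-1/2"] rot_approx[OF N, of "1/2"] by (simp_all add: mult.commute)
  qed
  have "5 / real N \<le> 5 / 12" using assms by (intro divide_left_mono) auto
  then have far: "1 \<le> cmod (rot N (- 1/2))" "1 \<le> cmod (rot N (1/2))"
    using r1 r2 norm_triangle_ineq3[of "rot N (- 1/2)" "- (\<i> * pi)"] norm_triangle_ineq3[of "rot N (1/2)" "\<i> * pi"] pi
    by (auto simp: norm_mult)
  have d1: "dirichlet N (- 1/2) = - 2 / rot N (- 1/2)"
  proof -
    have "dirichlet N (- 1/2) * rot N (- 1/2) = - 2"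
      using dirichlet_half_bins(1)[OF N, of 0] N by (simp add: rot_def field_simps)
    moreover have "rot N (- 1/2) \<noteq> 0" using far(1) by auto
    ultimately show ?thesis by (metis nonzero_mult_div_cancel_right)
  qed
  have d2: "dirichlet N (1/2) = - 2 / rot N (1/2)"
  proof -
    have "dirichlet N (1/2) * rot N (1/2) = - 2"
      using dirichlet_half_bins(2)[OF N, of 0] N by (simp add: rot_def field_simps)
    moreover have "rot N (1/2) \<noteq> 0" using far(2) by auto
    ultimately show ?thesis by (metis nonzero_mult_div_cancel_right)
  qed
  have "cmod (- 2 / rot N (- 1/2) - - 2 / - (\<i> * pi)) \<le> cmod (- 2 - - 2) / 1 + 2 * cmod (rot N (- 1/2) - - (\<i> * pi)) / 1\<^sup>2"
    using far pi by (intro norm_quotient_diff_le) (auto simp: norm_mult)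
  moreover have "cmod (- 2 / rot N (1/2) - - 2 / (\<i> * pi)) \<le> cmod (- 2 - - 2) / 1 + 2 * cmod (rot N (1/2) - \<i> * pi) / 1\<^sup>2"
    using far pi by (intro norm_quotient_diff_le) (auto simp: norm_mult)
  moreover have "half_bin_gain N 0 + 4 * \<i> / pi
      = (- 2 / rot N (- 1/2) - - 2 / - (\<i> * pi)) - (- 2 / rot N (1/2) - - 2 / (\<i> * pi))"
    unfolding half_bin_gain_def using d1 d2 by (simp add: field_simps)
  ultimately show ?thesis
    using r1 r2 norm_triangle_ineq4[of "- 2 / rot N (- 1/2) - - 2 / - (\<i> * pi)" "- 2 / rot N (1/2) - - 2 / (\<i> * pi)"]
    by (simp del: minus_divide_left)
qed

section \<open>Relative error of the estimated rotation\<close>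

context multitone
begin

text \<open>With \<open>z\<close> the exact rotation, the estimate of \<open>z\<^sup>-\<^sup>1\<close> is \<open>z\<^sup>-\<^sup>1 (1 + ratio / N)\<close>; without
  interference the ratio vanishes identically.\<close>

definition ratio_num :: "(nat \<Rightarrow> real) \<Rightarrow> (nat \<Rightarrow> complex) \<Rightarrow> nat \<Rightarrow> complex" where
  "ratio_num d a p = interference (1/2) d a p * rot N (\<delta> p - d p - 1/2)
     - interference (-1/2) d a p * rot N (\<delta> p - d p + 1/2)"

definition ratio_den :: "(nat \<Rightarrow> real) \<Rightarrow> (nat \<Rightarrow> complex) \<Rightarrow> nat \<Rightarrow> complex" where
  "ratio_den d a p = A p * half_bin_gain N (\<delta> p - d p)
     + (interference (1/2) d a p - interference (-1/2) d a p)"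

definition ratio :: "(nat \<Rightarrow> real) \<Rightarrow> (nat \<Rightarrow> complex) \<Rightarrow> nat \<Rightarrow> complex" where
  "ratio d a p = ratio_num d a p / ratio_den d a p"

text \<open>Quotient rule with denominators at least \<open>\<alpha> / 40\<close>:
  \<open>1360 = 34 * 40\<close> for the numerator and \<open>33600 = 21 * 40\<^sup>2\<close> for the
  denominator.\<close>

definition lip_const :: real where
  "lip_const = 1360 / \<alpha> + 33600 * (13 * b + 1) / \<alpha>\<^sup>2"

text \<open>\<open>4080 = 102 * 40\<close> and \<open>1600 = 40\<^sup>2\<close> come from
  linearising numerator and denominator of the ratio; the last summand pays for the quadratic term
  of the logarithm.\<close>

definition lin_const :: real where
  "lin_const = 4080 / \<alpha> + 1600 * (20 * b + 2) / \<alpha>\<^sup>2 + (840 / \<alpha>)\<^sup>2"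

lemma lip_const_pos: "0 < lip_const"
  using \<alpha>_pos b_pos by (simp add: lip_const_def add_pos_pos)

end

text \<open>The first bound keeps the denominator of the ratio above \<open>\<alpha> / 40\<close>
  and the ratio below 1. The second makes the amplitude equation a contraction. The third gives the
  joint update of a residual and its amplitude the contraction factor 1/2.\<close>

locale multitone_small = multitone +
  assumes perturb_small: "perturb \<le> \<alpha> / 10000" "perturb \<le> 1/2"
    "(lip_const * (1 + 7 * b) + 1) * perturb \<le> 1/2"
begin

lemma norm_rot_le_11: "cmod (rot N t) \<le> 21/2" if "\<bar>t\<bar> \<le> 8/5"
proof -
  have "pi * \<bar>t\<bar> \<le> 3.15 * (8/5)" using that pi_approx by (intro mult_mono) auto
  then show ?thesis using norm_rot_le[of N t] by simp
qed

context
  fixes d a p assumes adm: "admissible d a" and p: "p < L"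
begin

lemma interference_half_bounds:
  "cmod (interference (1/2) d a p) \<le> perturb" "cmod (interference (-1/2) d a p) \<le> perturb"
  using interference_bound[OF adm p] by auto

lemma offset_bound: "\<bar>\<delta> p - d p\<bar> \<le> 11/10"
  using adm p by (auto simp: admissible_def abs_minus_commute)

lemma ratio_num_bound: "cmod (ratio_num d a p) \<le> 21 * perturb"
proof -
  have "cmod (ratio_num d a p) \<le> cmod (interference (1/2) d a p) * cmod (rot N (\<delta> p - d p - 1/2))
     + cmod (interference (-1/2) d a p) * cmod (rot N (\<delta> p - d p + 1/2))"
    unfolding ratio_num_def by (rule norm_triangle_ineq4[THEN order_trans]) (simp add: norm_mult)
  also have "\<dots> \<le> perturb * (21/2) + perturb * (21/2)"
    using offset_bound by (intro add_mono mult_mono norm_rot_le_11 interference_half_bounds perturb_nonneg norm_ge_zero) linarith+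
  finally show ?thesis by simp
qed

lemma ratio_den_bound: "\<alpha> / 40 \<le> cmod (ratio_den d a p)"
proof -
  have "\<alpha> * (1/20) \<le> cmod (A p) * cmod (half_bin_gain N (\<delta> p - d p))"
    unfolding half_bin_gain_def
    using dirichlet_diff_lower[OF _ offset_bound] N_ge amp_lower[OF p] \<alpha>_pos by (intro mult_mono) auto
  moreover have "cmod (interference (1/2) d a p - interference (-1/2) d a p) \<le> 2 * perturb"
    using norm_triangle_ineq4[of "interference (1/2) d a p" "interference (-1/2) d a p"] interference_half_bounds by linarith
  ultimately show ?thesis
    using perturb_small(1) \<alpha>_pos
      norm_diff_ineq[of "A p * half_bin_gain N (\<delta> p - d p)" "interference (1/2) d a p - interference (-1/2) d a p"]
    unfolding ratio_den_def norm_mult by linarith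
qed

lemma ratio_bound: "cmod (ratio d a p) \<le> 840 / \<alpha> * perturb"
proof -
  have "cmod (ratio d a p) \<le> 21 * perturb / (\<alpha> / 40)"
    unfolding ratio_def norm_divide using ratio_num_bound ratio_den_bound \<alpha>_pos perturb_nonneg by (intro frac_le) auto
  then show ?thesis by simp
qed

lemma ratio_small: "cmod (ratio d a p / of_nat N) \<le> 1/12" "cmod (ratio d a p) \<le> 1"
proof -
  have "840 / \<alpha> * perturb \<le> 840 / \<alpha> * (\<alpha> / 10000)"
    using perturb_small \<alpha>_pos by (intro mult_left_mono) auto
  then show 1: "cmod (ratio d a p) \<le> 1" using ratio_bound \<alpha>_pos by simp
  show "cmod (ratio d a p / of_nat N) \<le> 1/12"
    unfolding norm_divide using 1 N_ge by (intro frac_le) auto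
qed

text \<open>The contributions of the tone itself cancel by the half-bin relation, so the deviation
  of \<open>zinv\<close> from the exact rotation is driven by the interference alone.\<close>

lemma residual_update_eq:
  "residual_update L N x m d a p = \<delta> p - real N / (2 * pi) * Im (Ln (1 + ratio d a p / of_nat N))"
proof -
  have d: "\<forall>l<L. \<bar>d l - \<delta> l\<bar> \<le> 11/10" using adm by (simp add: admissible_def)
  define u where "u = \<delta> p - d p"
  define \<beta> where "\<beta> = pi / real N"
  define \<theta> where "\<theta> = 2 * pi * u / real N"
  define E1 where "E1 = interference (1/2) d a p"
  define E2 where "E2 = interference (-1/2) d a p"
  define S1 where "S1 = A p * dirichlet N (u - 1/2) + E1"
  define S2 where "S2 = A p * dirichlet N (u + 1/2) + E2"
  define q where "q = ratio d a p / of_nat N"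
  have S1: "leak_subtracted L N x m d a p (1/2) = S1"
    by (subst leak_subtracted_eq[OF d p]) (simp_all add: cleaned_def S1_def u_def E1_def)
  have S2: "leak_subtracted L N x m d a p (-1/2) = S2"
    by (subst leak_subtracted_eq[OF d p]) (simp_all add: cleaned_def S2_def u_def E2_def)
  have den: "ratio_den d a p = S1 - S2"
    by (simp add: ratio_den_def half_bin_gain_def S1_def S2_def E1_def E2_def u_def algebra_simps)
  then have nz: "S1 - S2 \<noteq> 0" using ratio_den_bound \<alpha>_pos by auto
  have \<theta>\<beta>: "2 * pi * (u - 1/2) / real N = \<theta> - \<beta>" "2 * pi * (u + 1/2) / real N = \<theta> + \<beta>"
    using N_pos by (simp_all add: \<theta>_def \<beta>_def field_simps)
  have q: "(S1 - S2) * q = E1 * (cis (\<theta> - \<beta>) - 1) - E2 * (cis (\<theta> + \<beta>) - 1)"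
    using nz N_pos unfolding q_def ratio_def den ratio_num_def rot_def u_def[symmetric] \<theta>\<beta> E1_def[symmetric] E2_def[symmetric]
    by (simp add: field_simps)
  have rel: "dirichlet N (u - 1/2) * (cis (- \<beta>) - cis (- \<theta>)) = dirichlet N (u + 1/2) * (cis \<beta> - cis (- \<theta>))"
    using dirichlet_half_bins_relation[OF N_pos, of u] by (simp add: \<beta>_def \<theta>_def)
  have "S1 * (cis (- \<beta>) - cis (- \<theta>)) - S2 * (cis \<beta> - cis (- \<theta>))
      = E1 * (cis (- \<beta>) - cis (- \<theta>)) - E2 * (cis \<beta> - cis (- \<theta>))"
    unfolding S1_def S2_def using rel by algebra
  also have "\<dots> = cis (- \<theta>) * ((S1 - S2) * q)"
    unfolding q by (simp add: algebra_simps cis_mult)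
  finally have key: "S1 * cis (- \<beta>) - S2 * cis \<beta> = (S1 - S2) * (cis (- \<theta>) * (1 + q))"
    by (simp add: algebra_simps)
  \<comment> \<open>By Euler's formula the prescribed combination of \<open>h\<close> with cosine
    and sine is a quotient in which the two coefficients are rotated by \<beta> in opposite
    directions.\<close>
  have "complex_of_real (cos \<beta>) - 2 * \<i> * (1/2 * ((S1 + S2) / (S1 - S2))) * complex_of_real (sin \<beta>)
      = (S1 * cis (- \<beta>) - S2 * cis \<beta>) / (S1 - S2)"
  proof -
    have 1: "cis \<beta> = complex_of_real (cos \<beta>) + \<i> * complex_of_real (sin \<beta>)"
      and 2: "cis (- \<beta>) = complex_of_real (cos \<beta>) - \<i> * complex_of_real (sin \<beta>)"
      by (simp_all add: complex_eq_iff)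
    show ?thesis unfolding 1 2 using nz by (simp add: field_simps)
  qed
  also have "\<dots> = cis (- \<theta>) * (1 + q)" unfolding key using nz by simp
  finally have zinv: "complex_of_real (cos \<beta>) - 2 * \<i> * (1/2 * ((S1 + S2) / (S1 - S2))) * complex_of_real (sin \<beta>)
      = cis (- \<theta>) * (1 + q)" .
  have q_small: "cmod q \<le> 1/12" using ratio_small(1) by (simp add: q_def)
  then have Im_q: "\<bar>Im (Ln (1 + q))\<bar> \<le> 1/6" using abs_Im_Ln_one_plus[of q] by linarith
  have q_nz: "1 + q \<noteq> 0"
  proof
    assume "1 + q = 0"
    then have "q = - 1" by (simp add: eq_neg_iff_add_eq_0 add.commute)
    then show False using q_small by simp
  qed
  have \<theta>: "\<bar>\<theta>\<bar> \<le> 1"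
  proof -
    have "pi * \<bar>u\<bar> \<le> 63/20 * (11/10)" using offset_bound pi_approx by (intro mult_mono) (auto simp: u_def)
    then have "2 * (pi * \<bar>u\<bar>) \<le> real N" using N_ge by linarith
    then show ?thesis using N_pos by (simp add: \<theta>_def abs_mult)
  qed
  have "Ln (cis (- \<theta>) * (1 + q)) = - \<i> * \<theta> + Ln (1 + q)"
  proof -
    have "cis (- \<theta>) * (1 + q) = exp (- \<i> * \<theta> + Ln (1 + q))"
      unfolding exp_add exp_Ln[OF q_nz] cis_conv_exp by simp
    \<comment> \<open>The principal logarithms add because the total angle, at most
      \<open>1 + 1/6\<close>, does not reach the branch cut.\<close>
    moreover have "- pi < Im (- \<i> * \<theta> + Ln (1 + q))" "Im (- \<i> * \<theta> + Ln (1 + q)) \<le> pi"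
      using \<theta> Im_q pi_approx by auto
    ultimately show ?thesis by (metis Ln_exp)
  qed
  then have Im: "Im (Ln (cis (- \<theta>) * (1 + q))) = Im (Ln (1 + q)) - \<theta>" by simp
  have "real N / (2 * pi) * \<theta> = \<delta> p - d p" using N_pos by (simp add: \<theta>_def u_def)
  then show ?thesis
    unfolding residual_update_def S1 S2 Let_def \<beta>_def[symmetric] zinv q_def[symmetric] Im right_diff_distrib
    by simp
qed

lemma residual_update_error: "\<bar>residual_update L N x m d a p - \<delta> p\<bar> \<le> 840 / \<alpha> * perturb"
proof -
  have "\<bar>residual_update L N x m d a p - \<delta> p\<bar> = real N / (2 * pi) * \<bar>Im (Ln (1 + ratio d a p / of_nat N))\<bar>"
    by (simp add: residual_update_eq abs_mult)
  also have "\<dots> \<le> real N / (2 * pi) * (2 * cmod (ratio d a p / of_nat N))"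
    using ratio_small(1) by (intro mult_left_mono abs_Im_Ln_one_plus) auto
  also have "\<dots> = cmod (ratio d a p) / pi" using N_pos by (simp add: norm_divide)
  also have "\<dots> \<le> cmod (ratio d a p)"
    using pi_approx divide_left_mono[of 1 pi "cmod (ratio d a p)"] by simp
  finally show ?thesis using ratio_bound by linarith
qed

lemma residual_update_admissible: "\<bar>residual_update L N x m d a p - \<delta> p\<bar> \<le> 11/10"
proof -
  have "840 / \<alpha> * perturb \<le> 840 / \<alpha> * (\<alpha> / 10000)"
    using perturb_small \<alpha>_pos by (intro mult_left_mono) auto
  then show ?thesis using residual_update_error \<alpha>_pos by simp
qed

end

text \<open>The numerator of the ratio is linear in the interference. In the quotient rule every
  term therefore keeps one factor \<open>perturb\<close>, even where the gain or the rotation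
  changes at a rate of order 1.\<close>

lemma residual_update_lipschitz:
  assumes adm: "admissible d a" "admissible d' a'" and p: "p < L"
    and close: "\<And>l. l < L \<Longrightarrow> \<bar>d l - d' l\<bar> \<le> \<rho>" "\<And>l. l < L \<Longrightarrow> cmod (a l - a' l) \<le> \<rho>"
  shows "\<bar>residual_update L N x m d a p - residual_update L N x m d' a' p\<bar> \<le> lip_const * perturb * \<rho>"
proof -
  have pi: "3.14 \<le> pi" "pi \<le> 3.15" using pi_approx by auto
  have \<rho>: "0 \<le> \<rho>" using close(1)[OF p] by linarith
  define E1 where "E1 = interference (1/2) d a p"
  define E2 where "E2 = interference (-1/2) d a p"
  define E1' where "E1' = interference (1/2) d' a' p"
  define E2' where "E2' = interference (-1/2) d' a' p"
  define r1 where "r1 = rot N (\<delta> p - d p - 1/2)"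
  define r2 where "r2 = rot N (\<delta> p - d p + 1/2)"
  define r1' where "r1' = rot N (\<delta> p - d' p - 1/2)"
  define r2' where "r2' = rot N (\<delta> p - d' p + 1/2)"
  have E: "cmod (E1 - E1') \<le> perturb * \<rho>" "cmod (E2 - E2') \<le> perturb * \<rho>"
    unfolding E1_def E2_def E1'_def E2'_def by (intro interference_lipschitz adm p close; simp)+
  have E': "cmod E1' \<le> perturb" "cmod E2' \<le> perturb"
    unfolding E1'_def E2'_def using interference_half_bounds[OF adm(2) p] by auto
  have r: "cmod r1 \<le> 21/2" "cmod r2 \<le> 21/2"
    unfolding r1_def r2_def using offset_bound[OF adm(1) p] by (intro norm_rot_le_11; linarith)+
  have step: "2 * pi * \<bar>d p - d' p\<bar> \<le> 13/2 * \<rho>"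
    using mult_mono[of pi "3.15" "\<bar>d p - d' p\<bar>" \<rho>] pi close(1)[OF p] \<rho> by simp
  have rr: "cmod (r1 - r1') \<le> 13/2 * \<rho>" "cmod (r2 - r2') \<le> 13/2 * \<rho>"
    unfolding r1_def r2_def r1'_def r2'_def
    by (rule rot_lipschitz[THEN order_trans], use step in \<open>simp add: abs_minus_commute\<close>)+
  have "ratio_num d a p - ratio_num d' a' p
      = ((E1 - E1') * r1 + E1' * (r1 - r1')) - ((E2 - E2') * r2 + E2' * (r2 - r2'))"
    by (simp add: ratio_num_def E1_def E2_def E1'_def E2'_def r1_def r2_def r1'_def r2'_def algebra_simps)
  also have "cmod \<dots> \<le> (cmod (E1 - E1') * cmod r1 + cmod E1' * cmod (r1 - r1'))
      + (cmod (E2 - E2') * cmod r2 + cmod E2' * cmod (r2 - r2'))"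
    unfolding norm_mult[symmetric] by (intro norm_triangle_ineq4[THEN order_trans] add_mono norm_triangle_ineq)
  also have "\<dots> \<le> (perturb * \<rho> * (21/2) + perturb * (13/2 * \<rho>)) + (perturb * \<rho> * (21/2) + perturb * (13/2 * \<rho>))"
    using perturb_nonneg \<rho> by (intro add_mono mult_mono E E' r rr) auto
  finally have num: "cmod (ratio_num d a p - ratio_num d' a' p) \<le> 34 * perturb * \<rho>" by (simp add: algebra_simps)
  have "ratio_den d a p - ratio_den d' a' p
      = A p * (half_bin_gain N (\<delta> p - d p) - half_bin_gain N (\<delta> p - d' p)) + ((E1 - E1') - (E2 - E2'))"
    by (simp add: ratio_den_def E1_def E2_def E1'_def E2'_def algebra_simps)
  also have "cmod \<dots> \<le> cmod (A p) * cmod (half_bin_gain N (\<delta> p - d p) - half_bin_gain N (\<delta> p - d' p))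
      + (cmod (E1 - E1') + cmod (E2 - E2'))"
    unfolding norm_mult[symmetric]
    by (intro norm_triangle_ineq[THEN order_trans] add_mono order_refl norm_triangle_ineq4)
  also have "\<dots> \<le> b * (13 * \<rho>) + (perturb * \<rho> + perturb * \<rho>)"
  proof -
    have "cmod (half_bin_gain N (\<delta> p - d p) - half_bin_gain N (\<delta> p - d' p)) \<le> 13 * \<rho>"
      by (rule half_bin_gain_lipschitz[THEN order_trans]) (use step in \<open>simp add: abs_minus_commute\<close>)
    then show ?thesis
      using b_pos amp_upper[OF p] E by (intro add_mono mult_mono) auto
  qed
  also have "\<dots> \<le> b * (13 * \<rho>) + (1/2 * \<rho> + 1/2 * \<rho>)"
    using perturb_small(2) \<rho> by (intro add_mono mult_right_mono order_refl)
  finally have den: "cmod (ratio_den d a p - ratio_den d' a' p) \<le> (13 * b + 1) * \<rho>"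
    by (simp add: algebra_simps)
  have "cmod (ratio d a p - ratio d' a' p)
      \<le> cmod (ratio_num d a p - ratio_num d' a' p) / (\<alpha> / 40)
        + 21 * perturb * cmod (ratio_den d a p - ratio_den d' a' p) / (\<alpha> / 40)\<^sup>2"
    unfolding ratio_def using \<alpha>_pos
    by (intro norm_quotient_diff_le ratio_den_bound adm p ratio_num_bound) auto
  also have "\<dots> \<le> 34 * perturb * \<rho> / (\<alpha> / 40) + 21 * perturb * ((13 * b + 1) * \<rho>) / (\<alpha> / 40)\<^sup>2"
    using num den perturb_nonneg \<alpha>_pos by (intro add_mono divide_right_mono mult_left_mono) auto
  also have "\<dots> = lip_const * perturb * \<rho>"
    by (simp add: lip_const_def power2_eq_square algebra_simps add_divide_distrib)
  finally have ratio: "cmod (ratio d a p - ratio d' a' p) \<le> lip_const * perturb * \<rho>" .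
  let ?q = "ratio d a p / of_nat N" and ?q' = "ratio d' a' p / of_nat N"
  have "residual_update L N x m d a p - residual_update L N x m d' a' p
      = real N / (2 * pi) * Im (Ln (1 + ?q') - Ln (1 + ?q))"
    by (simp add: residual_update_eq[OF adm(1) p] residual_update_eq[OF adm(2) p] algebra_simps)
  then have "\<bar>residual_update L N x m d a p - residual_update L N x m d' a' p\<bar>
      = real N / (2 * pi) * \<bar>Im (Ln (1 + ?q') - Ln (1 + ?q))\<bar>"
    by (simp add: abs_mult)
  also have "\<dots> \<le> real N / (2 * pi) * (2 * cmod (?q' - ?q))"
  proof (intro mult_left_mono order_trans[OF abs_Im_le_cmod] Ln_one_plus_lipschitz)
    show "cmod ?q' \<le> 1/2" "cmod ?q \<le> 1/2"
      using ratio_small(1)[OF adm(1) p] ratio_small(1)[OF adm(2) p] by linarith+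
  qed auto
  also have "\<dots> = cmod (ratio d a p - ratio d' a' p) / pi"
    using N_pos by (simp add: norm_divide norm_minus_commute flip: diff_divide_distrib)
  also have "\<dots> \<le> cmod (ratio d a p - ratio d' a' p)"
    using pi divide_left_mono[of 1 pi "cmod (ratio d a p - ratio d' a' p)"] by simp
  finally show ?thesis using ratio by linarith
qed


text \<open>The first-order value of the update error. At the true residual the two rotations are
  near \<open>-\<i> * pi\<close> and \<open>\<i> * pi\<close> and the gain is near
  \<open>-4 * \<i> / pi\<close>, so the ratio is about \<open>pi\<^sup>2 / 4\<close> times the noise
  quotient; the factor \<open>1 / (2 * pi)\<close> turns this into \<open>pi / 8\<close>.\<close>

definition linear_error :: "nat \<Rightarrow> real" where
  "linear_error p = - (pi / 8) * Im ((noise_coeff N v (f p) (1/2) + noise_coeff N v (f p) (-1/2)) / A p)"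

text \<open>The distance \<eta> of the current residual is kept separate: it occurs only multiplied
  by \<open>perturb\<close>, hence is of second order once a previous sweep has made \<eta> itself
  of the order of \<open>perturb\<close>.\<close>

lemma residual_update_linear:
  assumes adm: "admissible d a" and p: "p < L" and \<eta>: "\<bar>d p - \<delta> p\<bar> \<le> \<eta>"
  shows "\<bar>residual_update L N x m d a p - \<delta> p - linear_error p\<bar>
    \<le> lin_const * (leak_level + 1 / real N + perturb * \<eta> + perturb\<^sup>2)"
proof -
  have pi: "3.14 \<le> pi" "pi \<le> 3.15" using pi_approx by auto
  have \<eta>0: "0 \<le> \<eta>" using \<eta> by linarith
  note Np = N_pos
  define u where "u = \<delta> p - d p"
  define E1 where "E1 = interference (1/2) d a p"
  define E2 where "E2 = interference (-1/2) d a p"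
  define V1 where "V1 = noise_coeff N v (f p) (1/2)"
  define V2 where "V2 = noise_coeff N v (f p) (-1/2)"
  define r1 where "r1 = rot N (u - 1/2)"
  define r2 where "r2 = rot N (u + 1/2)"
  define lk where "lk = leak_level + perturb * \<eta>"
  have Vb: "cmod (noise_coeff N v (f p) s) \<le> 14 * T" if "\<bar>s\<bar> \<le> 1/2" for s
    using noise_coeff_bound[OF N_pos noise[OF p], of s] that by simp
  have T14: "14 * T \<le> perturb" using leak_level_nonneg T_nonneg by (simp add: perturb_def)
  have V: "cmod V1 \<le> perturb" "cmod V2 \<le> perturb"
    using Vb[of "1/2"] Vb[of "-1/2"] T14 by (auto simp: V1_def V2_def)
  \<comment> \<open>Two replacements: the leakage is dropped at the cost \<open>leak_level\<close>,
    and the noise is moved from the current offset to the true one at a cost proportional to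
    \<eta>.\<close>
  have EV: "cmod (interference s d a p - noise_coeff N v (f p) s) \<le> lk" if s: "\<bar>s\<bar> \<le> 1/2" for s
  proof -
    have "cmod (noise_coeff N v (f p) (d p - \<delta> p + s) - noise_coeff N v (f p) s) \<le> 95 * T * \<bar>(d p - \<delta> p + s) - s\<bar>"
      using adm p s by (intro noise_coeff_lipschitz[OF N_pos noise[OF p]] noise_offset) (auto simp: admissible_def)
    also have "\<dots> \<le> perturb * \<eta>"
      using \<eta> T_nonneg leak_level_nonneg by (intro mult_mono) (auto simp: perturb_def)
    finally show ?thesis
      using interference_noise_diff[OF adm p s]
        norm_triangle_ineq[of "interference s d a p - noise_coeff N v (f p) (d p - \<delta> p + s)"
          "noise_coeff N v (f p) (d p - \<delta> p + s) - noise_coeff N v (f p) s"]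
      unfolding lk_def by simp
  qed
  have EV12: "cmod (E1 - V1) \<le> lk" "cmod (E2 - V2) \<le> lk"
    using EV[of "1/2"] EV[of "-1/2"] by (auto simp: E1_def E2_def V1_def V2_def)
  have u: "\<bar>u\<bar> \<le> \<eta>" "\<bar>u\<bar> \<le> 11/10" using \<eta> offset_bound[OF adm p] by (auto simp: u_def)
  have r: "cmod r1 \<le> 21/2" "cmod r2 \<le> 21/2"
    unfolding r1_def r2_def using u by (intro norm_rot_le_11; linarith)+
  have rot: "cmod (rot N (u + s) - 2 * pi * \<i> * s) \<le> 51 / real N + 7 * \<eta>" if "\<bar>s\<bar> \<le> 1/2" for s :: real
  proof -
    have us: "\<bar>u + s\<bar> \<le> 8/5" using u that by linarith
    have "(2 * pi * (u + s))\<^sup>2 = (2 * pi * \<bar>u + s\<bar>)\<^sup>2" by (simp add: power_mult_distrib)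
    also have "\<dots> \<le> (2 * 3.15 * (8/5))\<^sup>2"
      using pi us by (intro power_mono mult_mono) auto
    also have "\<dots> \<le> 102" by (simp add: power2_eq_square)
    finally have "(2 * pi * (u + s))\<^sup>2 / (2 * real N) \<le> 102 / (2 * real N)"
      using Np by (intro divide_right_mono) auto
    then have 1: "cmod (rot N (u + s) - 2 * pi * \<i> * (u + s)) \<le> 51 / real N"
      using rot_approx[OF Np, of "u + s"] by simp
    have 2: "cmod (2 * pi * \<i> * (u + s) - 2 * pi * \<i> * s) \<le> 7 * \<eta>"
    proof -
      have "2 * pi * \<i> * (u + s) - 2 * pi * \<i> * s = 2 * pi * \<i> * u"
        by (simp add: algebra_simps)
      moreover have "pi * \<bar>u\<bar> \<le> 3.15 * \<eta>" using pi u by (intro mult_mono) auto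
      ultimately show ?thesis using \<eta>0 by (simp add: norm_mult)
    qed
    show ?thesis
      using norm_triangle_ineq[of "rot N (u + s) - 2 * pi * \<i> * (u + s)" "2 * pi * \<i> * (u + s) - 2 * pi * \<i> * s"] 1 2
      by simp
  qed
  have rr: "cmod (r1 - - (\<i> * pi)) \<le> 51 / real N + 7 * \<eta>" "cmod (r2 - \<i> * pi) \<le> 51 / real N + 7 * \<eta>"
    using rot[of "-1/2"] rot[of "1/2"] by (simp_all add: r1_def r2_def mult.commute)
  have "ratio_num d a p - - (\<i> * pi) * (V1 + V2)
      = ((E1 - V1) * r1 + V1 * (r1 - - (\<i> * pi))) - ((E2 - V2) * r2 + V2 * (r2 - \<i> * pi))"
    by (simp add: ratio_num_def E1_def E2_def r1_def r2_def u_def algebra_simps)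
  also have "cmod \<dots> \<le> (cmod (E1 - V1) * cmod r1 + cmod V1 * cmod (r1 - - (\<i> * pi)))
      + (cmod (E2 - V2) * cmod r2 + cmod V2 * cmod (r2 - \<i> * pi))"
    unfolding norm_mult[symmetric] by (intro norm_triangle_ineq4[THEN order_trans] add_mono norm_triangle_ineq)
  also have "\<dots> \<le> (lk * (21/2) + perturb * (51 / real N + 7 * \<eta>)) + (lk * (21/2) + perturb * (51 / real N + 7 * \<eta>))"
    using perturb_nonneg by (intro add_mono mult_mono EV12 V r rr) (auto intro: order_trans[OF _ EV12(1)])
  also have "\<dots> = 21 * leak_level + 102 * (perturb * (1 / real N)) + 35 * (perturb * \<eta>)"
    by (simp add: lk_def algebra_simps)
  also have "\<dots> \<le> 21 * leak_level + 102 * (1 / real N) + 35 * (perturb * \<eta>)"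
  proof -
    have "perturb * (1 / real N) \<le> 1 * (1 / real N)"
      using perturb_small(2) by (intro mult_right_mono) auto
    then show ?thesis by linarith
  qed
  finally have num: "cmod (ratio_num d a p - - (\<i> * pi) * (V1 + V2))
      \<le> 102 * (leak_level + 1 / real N + perturb * \<eta>)"
    using leak_level_nonneg mult_nonneg_nonneg[OF perturb_nonneg \<eta>0] by (simp add: algebra_simps)
  have gain: "cmod (half_bin_gain N u + 4 * \<i> / pi) \<le> 20 / real N + 13 * \<eta>"
  proof -
    have "4 * pi * \<bar>u - 0\<bar> \<le> 13 * \<eta>"
      using mult_mono[of pi "3.15" "\<bar>u\<bar>" \<eta>] pi u \<eta>0 by simp
    then have "cmod (half_bin_gain N u - half_bin_gain N 0) \<le> 13 * \<eta>"
      using half_bin_gain_lipschitz[of N u 0] by linarith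
    then show ?thesis
      using norm_triangle_ineq[of "half_bin_gain N u - half_bin_gain N 0" "half_bin_gain N 0 + 4 * \<i> / pi"]
        half_bin_gain_0[OF N_ge] by simp
  qed
  have "ratio_den d a p - - (4 * \<i> / pi) * A p = A p * (half_bin_gain N u + 4 * \<i> / pi) + (E1 - E2)"
    by (simp add: ratio_den_def E1_def E2_def u_def algebra_simps)
  also have "cmod \<dots> \<le> cmod (A p) * cmod (half_bin_gain N u + 4 * \<i> / pi) + (cmod E1 + cmod E2)"
    unfolding norm_mult[symmetric]
    by (intro norm_triangle_ineq[THEN order_trans] add_mono order_refl norm_triangle_ineq4)
  also have "\<dots> \<le> b * (20 / real N + 13 * \<eta>) + (perturb + perturb)"
    using interference_half_bounds[OF adm p] amp_upper[OF p] gain b_pos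
    by (intro add_mono mult_mono) (auto simp: E1_def E2_def)
  finally have den: "cmod (ratio_den d a p - - (4 * \<i> / pi) * A p) \<le> b * (20 / real N + 13 * \<eta>) + 2 * perturb"
    by simp
  define R0 where "R0 = (- (\<i> * pi) * (V1 + V2)) / (- (4 * \<i> / pi) * A p)"
  have Ap: "A p \<noteq> 0" using amp_lower[OF p] \<alpha>_pos by auto
  \<comment> \<open>The numerator of \<open>R0\<close> is at most \<open>perturb\<close>, so the
    error of the denominator, which contains the gain error of order \<open>\<eta> + 1/N\<close>,
    enters only with that factor.\<close>
  have "cmod (ratio d a p - R0)
      \<le> cmod (ratio_num d a p - - (\<i> * pi) * (V1 + V2)) / (\<alpha> / 40)
        + perturb * cmod (ratio_den d a p - - (4 * \<i> / pi) * A p) / (\<alpha> / 40)\<^sup>2"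
    unfolding ratio_def R0_def
  proof (intro norm_quotient_diff_le ratio_den_bound adm p)
    show "\<alpha> / 40 \<le> cmod (- (4 * \<i> / pi) * A p)"
    proof -
      have "1/40 * \<alpha> \<le> 4 / pi * cmod (A p)"
        using pi amp_lower[OF p] \<alpha>_pos by (intro mult_mono) (auto simp: field_simps)
      then show ?thesis by (simp add: norm_mult norm_divide)
    qed
    have "cmod (- (\<i> * pi) * (V1 + V2)) = pi * cmod (V1 + V2)" by (simp add: norm_mult)
    also have "\<dots> \<le> 3.15 * (14 * T + 14 * T)"
      using pi Vb[of "1/2"] Vb[of "-1/2"] T_nonneg
      by (intro mult_mono norm_triangle_mono) (auto simp: V1_def V2_def)
    also have "\<dots> \<le> perturb" using leak_level_nonneg T_nonneg by (simp add: perturb_def)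
    finally show "cmod (- (\<i> * pi) * (V1 + V2)) \<le> perturb" .
  qed (use \<alpha>_pos in auto)
  also have "\<dots> \<le> 102 * (leak_level + 1 / real N + perturb * \<eta>) / (\<alpha> / 40)
        + perturb * (b * (20 / real N + 13 * \<eta>) + 2 * perturb) / (\<alpha> / 40)\<^sup>2"
    using num den perturb_nonneg \<alpha>_pos by (intro add_mono divide_right_mono mult_left_mono) auto
  also have "\<dots> = 4080 / \<alpha> * (leak_level + 1 / real N + perturb * \<eta>)
        + 1600 / \<alpha>\<^sup>2 * (20 * b * (perturb * (1 / real N)) + 13 * b * (perturb * \<eta>) + 2 * perturb\<^sup>2)"
    by (simp add: power2_eq_square algebra_simps add_divide_distrib)
  also have "\<dots> \<le> 4080 / \<alpha> * (leak_level + 1 / real N + perturb * \<eta> + perturb\<^sup>2)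
        + 1600 / \<alpha>\<^sup>2 * ((20 * b + 2) * (leak_level + 1 / real N + perturb * \<eta> + perturb\<^sup>2))"
  proof (rule add_mono; rule mult_left_mono)
    have pN: "perturb * (1 / real N) \<le> 1 / real N"
      using mult_right_mono[of perturb 1 "1 / real N"] perturb_small(2) by simp
    have "20 * b * (perturb * (1 / real N)) + 13 * b * (perturb * \<eta>) + 2 * perturb\<^sup>2
        \<le> (20 * b + 2) * (1 / real N) + (20 * b + 2) * (perturb * \<eta>) + (20 * b + 2) * perturb\<^sup>2"
      using b_pos perturb_nonneg \<eta>0 pN
      by (intro add_mono mult_mono mult_right_mono) auto
    also have "\<dots> \<le> (20 * b + 2) * (leak_level + 1 / real N + perturb * \<eta> + perturb\<^sup>2)"
      using mult_nonneg_nonneg[of "20 * b + 2" leak_level] b_pos leak_level_nonneg by (simp only: distrib_left) simp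
    finally show "20 * b * (perturb * (1 / real N)) + 13 * b * (perturb * \<eta>) + 2 * perturb\<^sup>2
        \<le> (20 * b + 2) * (leak_level + 1 / real N + perturb * \<eta> + perturb\<^sup>2)" .
  qed (use \<alpha>_pos in auto)
  finally have main: "cmod (ratio d a p - R0)
      \<le> (4080 / \<alpha> + 1600 * (20 * b + 2) / \<alpha>\<^sup>2) * (leak_level + 1 / real N + perturb * \<eta> + perturb\<^sup>2)"
    by (simp only: distrib_right[of "4080 / \<alpha>"] times_divide_eq_left times_divide_eq_right mult.assoc)
  define q where "q = ratio d a p / of_nat N"
  have q: "cmod q \<le> 1/12" using ratio_small(1)[OF adm p] by (simp add: q_def)
  \<comment> \<open>Replacing the logarithm by its argument costs a multiple of
    \<open>N * q\<^sup>2\<close>, that is of \<open>ratio\<^sup>2 / N\<close>, which is bounded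
    below by a multiple of the square of \<open>perturb\<close>.\<close>
  have "cmod (Ln (1 + q) - q) \<le> (cmod q)\<^sup>2 / (1 - cmod q)"
    using q by (intro Ln_approx_linear) auto
  also have "\<dots> \<le> (cmod q)\<^sup>2 / (1/2)"
    using q by (intro divide_left_mono) auto
  finally have ln: "cmod (Ln (1 + q) - q) \<le> 2 * (cmod q)\<^sup>2" by simp
  have "real N / (2 * pi) * cmod (Ln (1 + q) - q) \<le> real N / (2 * pi) * (2 * (cmod q)\<^sup>2)"
    using ln by (intro mult_left_mono) auto
  also have "\<dots> = (cmod (ratio d a p))\<^sup>2 / (pi * real N)"
    using Np by (simp add: q_def norm_divide power2_eq_square field_simps)
  also have "\<dots> \<le> (cmod (ratio d a p))\<^sup>2 / 1"
  proof (intro divide_left_mono)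
    show "1 \<le> pi * real N" using mult_mono[of 1 pi 1 "real N"] pi N_ge by simp
  qed (use Np in auto)
  also have "\<dots> \<le> (840 / \<alpha> * perturb)\<^sup>2"
    using ratio_bound[OF adm p] by (simp add: power_mono)
  finally have quad: "real N / (2 * pi) * cmod (Ln (1 + q) - q) \<le> (840 / \<alpha>)\<^sup>2 * perturb\<^sup>2"
    by (simp add: power_mult_distrib power_divide)
  have lin: "linear_error p = - (1 / (2 * pi)) * Im R0"
  proof -
    have "R0 = of_real (pi\<^sup>2 / 4) * ((V1 + V2) / A p)"
      using Ap by (simp add: R0_def power2_eq_square field_simps)
    then have "Im R0 = pi\<^sup>2 / 4 * Im ((V1 + V2) / A p)" unfolding scaleR_conv_of_real[symmetric] by simp
    then show ?thesis
      unfolding linear_error_def V1_def[symmetric] V2_def[symmetric]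
      by (simp only:) (simp add: power2_eq_square)
  qed
  have "residual_update L N x m d a p - \<delta> p - linear_error p
      = - (real N / (2 * pi)) * Im (Ln (1 + q) - q) - 1 / (2 * pi) * Im (ratio d a p - R0)"
    using Np by (simp add: residual_update_eq[OF adm p] lin q_def algebra_simps)
  also have "\<bar>\<dots>\<bar> \<le> real N / (2 * pi) * \<bar>Im (Ln (1 + q) - q)\<bar> + 1 / (2 * pi) * \<bar>Im (ratio d a p - R0)\<bar>"
    by (rule abs_triangle_ineq4[THEN order_trans]) (simp add: abs_mult)
  also have "\<dots> \<le> real N / (2 * pi) * cmod (Ln (1 + q) - q) + 1 * cmod (ratio d a p - R0)"
    using pi by (intro add_mono mult_mono abs_Im_le_cmod) (auto simp: field_simps)
  also have "\<dots> \<le> (840 / \<alpha>)\<^sup>2 * (leak_level + 1 / real N + perturb * \<eta> + perturb\<^sup>2)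
      + (4080 / \<alpha> + 1600 * (20 * b + 2) / \<alpha>\<^sup>2) * (leak_level + 1 / real N + perturb * \<eta> + perturb\<^sup>2)"
  proof (rule add_mono)
    have "(840 / \<alpha>)\<^sup>2 * perturb\<^sup>2 \<le> (840 / \<alpha>)\<^sup>2 * (leak_level + 1 / real N + perturb * \<eta> + perturb\<^sup>2)"
      using leak_level_nonneg perturb_nonneg \<eta>0 by (intro mult_left_mono) auto
    then show "real N / (2 * pi) * cmod (Ln (1 + q) - q) \<le> (840 / \<alpha>)\<^sup>2 * (leak_level + 1 / real N + perturb * \<eta> + perturb\<^sup>2)"
      using quad by linarith
  qed (use main in simp)
  finally show ?thesis by (simp only: lin_const_def distrib_right add_ac)
qed

end

subsection \<open>Contraction and fixed points\<close>

text \<open>With \<open>r\<close> the maximum of \<open>g\<close> the hypothesis gives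
  \<open>r \<le> c + r / 2\<close>. This takes the place of an argument in the maximum norm.\<close>

lemma bound_of_half_contraction:
  fixes g :: "nat \<Rightarrow> real"
  assumes "\<And>r l. (\<And>k. k < L \<Longrightarrow> g k \<le> r) \<Longrightarrow> l < L \<Longrightarrow> g l \<le> c + r / 2"
    and "l < L"
  shows "g l \<le> 2 * c"
proof -
  define r where "r = Max (g ` {..<L})"
  have r: "g k \<le> r" if "k < L" for k using that by (simp add: r_def)
  have "r \<in> g ` {..<L}" unfolding r_def using assms(2) by (intro Max_in) auto
  then obtain k where "k < L" "r = g k" by auto
  then have "r \<le> c + r / 2" using assms(1)[OF r] by auto
  then show ?thesis using r[OF assms(2)] by linarith
qed

text \<open>Banach's theorem for the maximum norm on a box of closed sets. Since only the first
  \<open>L\<close> entries of a function on \<open>nat\<close> matter, the Picard iteration and its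
  limit are treated coordinate by coordinate.\<close>

lemma box_contraction_fixpoint:
  fixes F :: "(nat \<Rightarrow> 'v::banach) \<Rightarrow> nat \<Rightarrow> 'v"
  assumes closed: "\<And>l. l < L \<Longrightarrow> closed (K l)"
    and s0: "\<And>l. l < L \<Longrightarrow> s0 l \<in> K l"
    and inv: "\<And>s l. (\<And>k. k < L \<Longrightarrow> s k \<in> K k) \<Longrightarrow> l < L \<Longrightarrow> F s l \<in> K l"
    and contr: "\<And>s t r l. \<lbrakk>\<And>k. k < L \<Longrightarrow> s k \<in> K k; \<And>k. k < L \<Longrightarrow> t k \<in> K k;
        \<And>k. k < L \<Longrightarrow> norm (s k - t k) \<le> r; l < L\<rbrakk> \<Longrightarrow> norm (F s l - F t l) \<le> r / 2"
  obtains s where "\<And>l. l < L \<Longrightarrow> s l \<in> K l" "\<And>l. l < L \<Longrightarrow> F s l = s l" "\<And>l. L \<le> l \<Longrightarrow> s l = 0"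
proof -
  define S where "S n = (F ^^ n) s0" for n
  have S_Suc: "S (Suc n) = F (S n)" for n by (simp add: S_def)
  have S_box: "S n l \<in> K l" if "l < L" for n l
    using that by (induction n arbitrary: l) (auto simp: S_def s0 inv)
  define r0 where "r0 = (\<Sum>l<L. norm (S 1 l - S 0 l))"
  have step: "norm (S (Suc n) l - S n l) \<le> r0 / 2 ^ n" if "l < L" for n l
    using that
  proof (induction n arbitrary: l)
    case 0
    then show ?case
      unfolding r0_def by (simp, intro member_le_sum[of l "{..<L}" "\<lambda>l. norm (S (Suc 0) l - S 0 l)"]) auto
  next
    case (Suc n)
    have "norm (F (S (Suc n)) l - F (S n) l) \<le> r0 / 2 ^ n / 2"
      using Suc by (intro contr S_box) auto
    then show ?case by (simp add: S_Suc field_simps)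
  qed
  have conv: "convergent (\<lambda>n. S n l)" if "l < L" for l
  proof -
    have "summable (\<lambda>n. S (Suc n) l - S n l)"
    proof (rule summable_comparison_test')
      show "summable (\<lambda>n. r0 * (1/2) ^ n)" by (intro summable_mult summable_geometric) auto
      show "norm (S (Suc n) l - S n l) \<le> r0 * (1/2) ^ n" if "n \<ge> 0" for n
        using step[OF \<open>l < L\<close>, of n] by (simp add: power_divide)
    qed
    then have "convergent (\<lambda>n. \<Sum>k<n. S (Suc k) l - S k l)"
      by (simp add: summable_iff_convergent)
    then have "convergent (\<lambda>n. S n l - S 0 l)"
      unfolding sum_lessThan_telescope[where f = "\<lambda>n. S n l"] .
    then show ?thesis unfolding convergent_diff_const_right_iff .
  qed
  define s where "s l = (if l < L then lim (\<lambda>n. S n l) else 0)" for l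
  have lim: "(\<lambda>n. S n l) \<longlonglongrightarrow> s l" if "l < L" for l
    using conv[OF that] that by (simp add: s_def convergent_LIMSEQ_iff)
  have s_box: "s l \<in> K l" if "l < L" for l
    using closed_sequentially[OF closed[OF that] _ lim[OF that]] S_box[OF that] by blast
  have "F s l = s l" if l: "l < L" for l
  proof -
    \<comment> \<open>Continuity of \<open>F\<close> in disguise: finitely many coordinates converge
      uniformly, so the contraction applies to the limit and a late iterate.\<close>
    have "norm (F s l - s l) \<le> 0 + \<epsilon>" if \<epsilon>: "\<epsilon> > 0" for \<epsilon>
    proof -
      have "\<forall>\<^sub>F n in sequentially. \<forall>k\<in>{..<L}. norm (S n k - s k) \<le> \<epsilon> / 2"
      proof (intro eventually_ball_finite ballI)
        fix k assume "k \<in> {..<L}"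
        then have "(\<lambda>n. S n k) \<longlonglongrightarrow> s k" using lim by simp
        then have "\<forall>\<^sub>F n in sequentially. dist (S n k) (s k) < \<epsilon> / 2"
          using \<epsilon> by (intro tendstoD) auto
        then show "\<forall>\<^sub>F n in sequentially. norm (S n k - s k) \<le> \<epsilon> / 2"
          by eventually_elim (simp add: dist_norm)
      qed simp
      then obtain n where n: "\<And>j k. j \<ge> n \<Longrightarrow> k < L \<Longrightarrow> norm (S j k - s k) \<le> \<epsilon> / 2"
        unfolding eventually_sequentially by (metis lessThan_iff)
      have "norm (F s l - F (S n) l) \<le> \<epsilon> / 2 / 2"
        using n[of n] by (intro contr s_box S_box l) (auto simp: norm_minus_commute)
      moreover have "norm (F (S n) l - s l) \<le> \<epsilon> / 2"
        using n[of "Suc n" l] l by (simp add: S_Suc)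
      ultimately show ?thesis
        using norm_triangle_ineq[of "F s l - F (S n) l" "F (S n) l - s l"] \<epsilon> by simp
    qed
    then have "norm (F s l - s l) \<le> 0" by (rule field_le_epsilon)
    then show ?thesis by simp
  qed
  then show ?thesis using that[of s] s_box by (simp add: s_def)
qed

section \<open>Component steps and partial sweeps\<close>

lemma component_step_eq:
  "component_step L N x m p (d, a) =
    (d(p := residual_update L N x m d a p),
     a(p := amplitude_update L N x m (d(p := residual_update L N x m d a p)) a p))"
  by (simp add: component_step_def Let_def)

lemma component_step_other: "l \<noteq> p \<Longrightarrow> fst (component_step L N x m p s) l = fst s l \<and> snd (component_step L N x m p s) l = snd s l"
  by (cases s) (simp add: component_step_eq)

text \<open>The state in the middle of a sweep: component \<open>k\<close> is updated from new
  values below \<open>k\<close> and old values from \<open>k\<close> on, as in a Gauss-Seidel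
  scheme.\<close>

definition partial_sweep ::
  "nat \<Rightarrow> nat \<Rightarrow> (nat \<Rightarrow> complex) \<Rightarrow> (nat \<Rightarrow> int) \<Rightarrow> nat \<Rightarrow>
   (nat \<Rightarrow> real) \<times> (nat \<Rightarrow> complex) \<Rightarrow> (nat \<Rightarrow> real) \<times> (nat \<Rightarrow> complex)" where
  "partial_sweep L N x m k = fold (component_step L N x m) [0..<k]"

lemma partial_sweep_Suc: "partial_sweep L N x m (Suc k) s = component_step L N x m k (partial_sweep L N x m k s)"
  by (simp add: partial_sweep_def)

lemma partial_sweep_0 [simp]: "partial_sweep L N x m 0 s = s"
  by (simp add: partial_sweep_def)

lemma partial_sweep_unchanged: "k \<le> l \<Longrightarrow> fst (partial_sweep L N x m k s) l = fst s l \<and> snd (partial_sweep L N x m k s) l = snd s l"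
  by (induction k) (auto simp: partial_sweep_Suc component_step_other)

lemma partial_sweep_done:
  "l < j \<Longrightarrow> j \<le> k \<Longrightarrow> fst (partial_sweep L N x m k s) l = fst (partial_sweep L N x m j s) l"
proof (induction k)
  case (Suc k)
  then show ?case by (cases "j = Suc k") (auto simp: partial_sweep_Suc component_step_other)
qed simp

lemma sweep_eq: "sweep L N x m = partial_sweep L N x m L"
  by (simp add: sweep_def partial_sweep_def)

lemma sweep_component:
  assumes "p < L"
  shows "fst (sweep L N x m s) p = residual_update L N x m (fst (partial_sweep L N x m p s)) (snd (partial_sweep L N x m p s)) p"
proof -
  have "fst (sweep L N x m s) p = fst (partial_sweep L N x m (Suc p) s) p"
    unfolding sweep_eq using assms by (intro partial_sweep_done) auto
  also have "\<dots> = residual_update L N x m (fst (partial_sweep L N x m p s)) (snd (partial_sweep L N x m p s)) p"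
    unfolding partial_sweep_Suc by (cases "partial_sweep L N x m p s") (simp add: component_step_eq)
  finally show ?thesis .
qed

section \<open>Contraction of one component update, stationary states\<close>

context multitone
begin

text \<open>The coefficient \<open>7 * b\<close> of the component's own residual, from the slope of
  the main lobe, is not small; only the dependence through the interference is.\<close>

lemma cleaned_0_lipschitz:
  assumes adm: "admissible d a" "admissible d' a'" and p: "p < L"
    and close: "\<And>l. l < L \<Longrightarrow> \<bar>d l - d' l\<bar> \<le> \<rho>" "\<And>l. l < L \<Longrightarrow> cmod (a l - a' l) \<le> \<rho>"
  shows "cmod (cleaned 0 d a p - cleaned 0 d' a' p) \<le> 7 * b * \<bar>d p - d' p\<bar> + perturb * \<rho>"
proof -
  have pi: "pi \<le> 3.15" using pi_approx by auto
  have "cleaned 0 d a p - cleaned 0 d' a' p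
      = A p * (dirichlet N (\<delta> p - d p - 0) - dirichlet N (\<delta> p - d' p - 0))
        + (interference 0 d a p - interference 0 d' a' p)"
    by (simp add: cleaned_def algebra_simps)
  also have "cmod \<dots> \<le> cmod (A p) * cmod (dirichlet N (\<delta> p - d p - 0) - dirichlet N (\<delta> p - d' p - 0))
        + cmod (interference 0 d a p - interference 0 d' a' p)"
    unfolding norm_mult[symmetric] by (rule norm_triangle_ineq)
  also have "\<dots> \<le> b * (7 * \<bar>d p - d' p\<bar>) + perturb * \<rho>"
  proof (intro add_mono mult_mono)
    have "2 * pi * \<bar>d p - d' p\<bar> \<le> 7 * \<bar>d p - d' p\<bar>" using pi by (intro mult_right_mono) auto
    then show "cmod (dirichlet N (\<delta> p - d p - 0) - dirichlet N (\<delta> p - d' p - 0)) \<le> 7 * \<bar>d p - d' p\<bar>"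
      using dirichlet_lipschitz[of N "\<delta> p - d p - 0" "\<delta> p - d' p - 0"] by (simp add: abs_minus_commute)
    show "cmod (interference 0 d a p - interference 0 d' a' p) \<le> perturb * \<rho>"
      by (rule interference_lipschitz[OF adm p _ close]) auto
  qed (use amp_upper[OF p] b_pos in auto)
  finally show ?thesis by (simp add: algebra_simps)
qed

lemma cleaned_0_bound:
  assumes "admissible d a" "p < L"
  shows "cmod (cleaned 0 d a p) \<le> b + perturb"
proof -
  have "cmod (A p * dirichlet N (\<delta> p - d p - 0)) \<le> b * 1"
    unfolding norm_mult using amp_upper[OF assms(2)] norm_dirichlet_le b_pos by (intro mult_mono) auto
  moreover have "cmod (interference 0 d a p) \<le> perturb"
    using interference_bound[OF assms, of 0] by simp
  ultimately show ?thesis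
    unfolding cleaned_def using norm_triangle_ineq[of "A p * dirichlet N (\<delta> p - d p - 0)" "interference 0 d a p"] by linarith
qed

end

context multitone_small
begin

lemma admissible_offset: "admissible d a \<Longrightarrow> \<forall>l<L. \<bar>d l - \<delta> l\<bar> \<le> 11/10"
  by (simp add: admissible_def)

lemma admissible_upd:
  assumes "admissible d a" "p < L"
  shows "admissible (d(p := residual_update L N x m d a p)) a"
  using assms residual_update_admissible[OF assms] by (auto simp: admissible_def)

lemma amplitude_update_bound:
  assumes "admissible d a" "p < L"
  shows "cmod (amplitude_update L N x m d a p) \<le> amp_bound"
  using cleaned_0_bound[OF assms] amplitude_update_eq[OF admissible_offset[OF assms(1)] assms(2)] perturb_small(2) b_pos
  by (simp add: amp_bound_def)

text \<open>The differences of residual and amplitude add up to at most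
  \<open>(lip_const * (1 + 7 * b) + 1) * perturb * \<rho>\<close>, the quantity controlled by the
  third smallness condition.\<close>

lemma component_update_contraction:
  assumes adm: "admissible d a" "admissible d' a'" and p: "p < L"
    and close: "\<And>l. l < L \<Longrightarrow> \<bar>d l - d' l\<bar> \<le> \<rho>" "\<And>l. l < L \<Longrightarrow> cmod (a l - a' l) \<le> \<rho>"
  defines "r \<equiv> residual_update L N x m d a p" and "r' \<equiv> residual_update L N x m d' a' p"
  shows "\<bar>r - r'\<bar> + cmod (amplitude_update L N x m (d(p := r)) a p - amplitude_update L N x m (d'(p := r')) a' p) \<le> \<rho> / 2"
proof -
  have \<rho>: "0 \<le> \<rho>" using close(1)[OF p] by linarith
  have adm': "admissible (d(p := r)) a" "admissible (d'(p := r')) a'"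
    unfolding r_def r'_def by (intro admissible_upd adm p)+
  have r: "\<bar>r - r'\<bar> \<le> lip_const * perturb * \<rho>"
    unfolding r_def r'_def by (rule residual_update_lipschitz[OF adm p close])
  \<comment> \<open>Ensures that inserting the updated residuals keeps the two states within \<rho>
    of each other, as the amplitude bound requires.\<close>
  have "lip_const * perturb \<le> 1"
  proof -
    have "lip_const * 1 * perturb + 0 * perturb \<le> lip_const * (1 + 7 * b) * perturb + 1 * perturb"
      using lip_const_pos b_pos perturb_nonneg by (intro add_mono mult_right_mono mult_left_mono) auto
    then show ?thesis using perturb_small(3) by (simp add: algebra_simps)
  qed
  then have "lip_const * perturb * \<rho> \<le> 1 * \<rho>" using \<rho> by (intro mult_right_mono)
  then have close': "\<bar>(d(p := r)) l - (d'(p := r')) l\<bar> \<le> \<rho>" if "l < L" for l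
    using r close(1)[OF that] by auto
  have "cmod (amplitude_update L N x m (d(p := r)) a p - amplitude_update L N x m (d'(p := r')) a' p)
      \<le> 7 * b * \<bar>r - r'\<bar> + perturb * \<rho>"
    unfolding amplitude_update_eq[OF admissible_offset[OF adm'(1)] p] amplitude_update_eq[OF admissible_offset[OF adm'(2)] p]
    using cleaned_0_lipschitz[OF adm' p close' close(2)] by (simp only: fun_upd_same)
  moreover have "7 * b * \<bar>r - r'\<bar> \<le> 7 * b * (lip_const * perturb * \<rho>)"
    using r b_pos by (intro mult_left_mono) auto
  moreover have "(lip_const * (1 + 7 * b) + 1) * perturb * \<rho> \<le> 1/2 * \<rho>"
    using perturb_small(3) \<rho> by (rule mult_right_mono)
  ultimately show ?thesis using r by (simp add: algebra_simps)
qed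

text \<open>Admissible states left unchanged by every component step, with residuals and amplitudes
  as separate unknowns; the amplitudes are eliminated only in the comparison with
  \<open>is_fixed_point\<close>.\<close>

definition is_stationary :: "(nat \<Rightarrow> real) \<Rightarrow> (nat \<Rightarrow> complex) \<Rightarrow> bool" where
  "is_stationary d a \<longleftrightarrow> admissible d a \<and>
     (\<forall>p<L. residual_update L N x m d a p = d p \<and> amplitude_update L N x m d a p = a p)"

text \<open>All components are updated at once from the same state. This simultaneous map has the
  same stationary states as the sequential sweep and fits the box contraction directly.\<close>

lemma stationary_exists:
  obtains d a where "is_stationary d a" "\<And>l. L \<le> l \<Longrightarrow> a l = 0"
proof -
  define RU where "RU s p = residual_update L N x m (fst \<circ> s) (snd \<circ> s) p" for s :: "nat \<Rightarrow> real \<times> complex" and p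
  define F where "F s p = (RU s p, amplitude_update L N x m ((fst \<circ> s)(p := RU s p)) (snd \<circ> s) p)" for s p
  define K where "K l = {y :: real \<times> complex. \<bar>fst y - \<delta> l\<bar> \<le> 11/10 \<and> cmod (snd y) \<le> amp_bound}" for l
  have K_adm: "admissible (fst \<circ> s) (snd \<circ> s)" if "\<And>k. k < L \<Longrightarrow> s k \<in> K k" for s
    using that by (auto simp: K_def admissible_def)
  obtain s where s: "\<And>l. l < L \<Longrightarrow> s l \<in> K l" "\<And>l. l < L \<Longrightarrow> F s l = s l" "\<And>l. L \<le> l \<Longrightarrow> s l = 0"
  proof (rule box_contraction_fixpoint[where L = L and K = K and F = F and ?s0.0 = "\<lambda>l. (\<delta> l, 0)"])
    show "closed (K l)" if "l < L" for l
      unfolding K_def by (intro closed_Collect_conj closed_Collect_le continuous_intros)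
    show "(\<delta> l, 0) \<in> K l" if "l < L" for l
      using amp_bound_pos by (simp add: K_def)
    show "F s l \<in> K l" if "\<And>k. k < L \<Longrightarrow> s k \<in> K k" "l < L" for s l
      using residual_update_admissible[OF K_adm[OF that(1)] that(2)]
        amplitude_update_bound[OF admissible_upd[OF K_adm[OF that(1)] that(2)] that(2)]
      by (simp add: F_def K_def RU_def)
    show "norm (F s l - F t l) \<le> r / 2"
      if st: "\<And>k. k < L \<Longrightarrow> s k \<in> K k" "\<And>k. k < L \<Longrightarrow> t k \<in> K k"
        "\<And>k. k < L \<Longrightarrow> norm (s k - t k) \<le> r" and l: "l < L" for s t r l
    proof -
      have "norm (F s l - F t l) \<le> norm (fst (F s l - F t l)) + norm (snd (F s l - F t l))"
        by (metis norm_Pair_le prod.collapse)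
      also have "\<dots> \<le> r / 2"
      proof -
        have "\<bar>(fst \<circ> s) k - (fst \<circ> t) k\<bar> \<le> r" if "k < L" for k
          using st(3)[OF that] norm_fst_le[of "fst (s k - t k)" "snd (s k - t k)"] by (simp only: prod.collapse) simp
        moreover have "cmod ((snd \<circ> s) k - (snd \<circ> t) k) \<le> r" if "k < L" for k
          using st(3)[OF that] norm_snd_le[of "snd (s k - t k)" "fst (s k - t k)"] by (simp only: prod.collapse) simp
        ultimately show ?thesis
          using component_update_contraction[OF K_adm[OF st(1)] K_adm[OF st(2)] l, of r] by (simp add: F_def RU_def)
      qed
      finally show ?thesis .
    qed
  qed blast
  have "is_stationary (fst \<circ> s) (snd \<circ> s)"
    unfolding is_stationary_def
  proof (intro conjI allI impI K_adm s)
    fix p assume p: "p < L"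
    have 1: "RU s p = fst (s p)"
      using s(2)[OF p, THEN arg_cong, of fst] by (simp only: F_def fst_conv)
    have 2: "amplitude_update L N x m ((fst \<circ> s)(p := RU s p)) (snd \<circ> s) p = snd (s p)"
      using s(2)[OF p, THEN arg_cong, of snd] by (simp only: F_def snd_conv)
    have "(fst \<circ> s)(p := RU s p) = fst \<circ> s"
      unfolding 1 using fun_upd_triv[of "fst \<circ> s" p] by (simp only: comp_apply)
    with 2 show "amplitude_update L N x m (fst \<circ> s) (snd \<circ> s) p = (snd \<circ> s) p"
      by (simp only: comp_apply)
    show "residual_update L N x m (fst \<circ> s) (snd \<circ> s) p = (fst \<circ> s) p"
      using 1 by (simp only: RU_def comp_apply)
  qed
  then show ?thesis using that[of "fst \<circ> s" "snd \<circ> s"] s(3) by simp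
qed

lemma stationary_unique:
  assumes st: "is_stationary d a" "is_stationary d' a'" and p: "p < L"
  shows "d p = d' p" "a p = a' p"
proof -
  have "\<bar>d p - d' p\<bar> + cmod (a p - a' p) \<le> 2 * 0"
  proof (rule bound_of_half_contraction[where g = "\<lambda>p. \<bar>d p - d' p\<bar> + cmod (a p - a' p)", OF _ p])
    fix r l assume r: "\<And>k. k < L \<Longrightarrow> \<bar>d k - d' k\<bar> + cmod (a k - a' k) \<le> r" and l: "l < L"
    have 1: "\<bar>d k - d' k\<bar> \<le> r" "cmod (a k - a' k) \<le> r" if "k < L" for k
      using r[OF that] norm_ge_zero[of "a k - a' k"] by linarith+
    have adm: "admissible d a" "admissible d' a'" using st by (auto simp: is_stationary_def)
    have eq: "residual_update L N x m d a l = d l" "residual_update L N x m d' a' l = d' l"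
      "amplitude_update L N x m d a l = a l" "amplitude_update L N x m d' a' l = a' l"
      using st l by (auto simp: is_stationary_def)
    from component_update_contraction[OF adm l 1] show "\<bar>d l - d' l\<bar> + cmod (a l - a' l) \<le> 0 + r / 2"
      by (simp add: eq)
  qed
  then have "\<bar>d p - d' p\<bar> = 0" "cmod (a p - a' p) = 0"
    using norm_ge_zero[of "a p - a' p"] by linarith+
  then show "d p = d' p" "a p = a' p" by simp_all
qed

lemma stationary_error:
  assumes "is_stationary d a" "p < L"
  shows "\<bar>d p - \<delta> p\<bar> \<le> 840 / \<alpha> * perturb"
  using residual_update_error[of d a p] assms by (auto simp: is_stationary_def)

section \<open>The amplitude equation and the iteration map\<close>

text \<open>The difference of two solutions satisfies a homogeneous system with off-diagonal entries
  of order \<open>1/N\<close>, so no bound on the amplitudes is involved. This matters for the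
  solution picked by \<open>SOME\<close>, whose size is not known beforehand.\<close>

lemma amplitude_equation_unique:
  assumes d: "\<forall>l<L. \<bar>d l - \<delta> l\<bar> \<le> 11/10"
    and a: "\<And>p. p < L \<Longrightarrow> a p = amplitude_update L N x m d a p"
    and a': "\<And>p. p < L \<Longrightarrow> a' p = amplitude_update L N x m d a' p" and p: "p < L"
  shows "a p = a' p"
proof -
  have "cmod (a p - a' p) \<le> 2 * 0"
  proof (rule bound_of_half_contraction[OF _ p])
    fix r l assume r: "\<And>k. k < L \<Longrightarrow> cmod (a k - a' k) \<le> r" and l: "l < L"
    have r0: "0 \<le> r" using r[OF l] norm_ge_zero order_trans by blast
    let ?D = "\<lambda>k. dirichlet N (real N * (f k - f l) + (d k - \<delta> k) - (d l - \<delta> l) - 0)"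
    have "a l - a' l = - (\<Sum>k\<in>{..<L} - {l}. (a k - a' k) * ?D k)"
      unfolding a[OF l] a'[OF l] amplitude_update_eq[OF d l] cleaned_eq[OF l]
      by (simp add: left_diff_distrib sum_subtractf)
    then have "cmod (a l - a' l) = cmod (\<Sum>k\<in>{..<L} - {l}. (a k - a' k) * ?D k)"
      by (simp only: norm_minus_cancel)
    also have "\<dots> \<le> leak_level * r"
    proof (rule leak_coeff_sum[OF _ r0])
      fix k assume k: "k \<in> {..<L} - {l}"
      have "cmod ((a k - a' k) * ?D k) \<le> r * (leakage_const \<gamma> / real N)"
      proof (unfold norm_mult, intro mult_mono)
        show "cmod (?D k) \<le> leakage_const \<gamma> / real N"
          using leakage_bound[of l k "(d k - \<delta> k) - (d l - \<delta> l) - 0"] offset_le_3[OF d l, of k 0] k l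
          by (simp add: add_diff_eq)
      qed (use r k r0 in auto)
      also have "\<dots> \<le> (b + 2 * amp_bound + 1) * (r * (leakage_const \<gamma> / real N))"
      proof -
        have "1 * (r * (leakage_const \<gamma> / real N)) \<le> (b + 2 * amp_bound + 1) * (r * (leakage_const \<gamma> / real N))"
          using b_pos amp_bound_pos mult_nonneg_nonneg[OF r0 leakage_const_nonneg] by (intro mult_right_mono) auto
        then show ?thesis by simp
      qed
      finally show "cmod ((a k - a' k) * ?D k) \<le> (b + 2 * amp_bound + 1) * (leakage_const \<gamma> / real N) * r"
        by (simp only: mult_ac)
    qed
    also have "\<dots> \<le> 1/2 * r"
      using perturb_small(2) T_nonneg r0 by (intro mult_right_mono) (auto simp: perturb_def)
    finally show "cmod (a l - a' l) \<le> 0 + r / 2" by simp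
  qed
  then show ?thesis by simp
qed

text \<open>A contraction on a ball gives one bounded solution; uniqueness identifies it with the
  chosen one, which thereby inherits the bound.\<close>

lemma amplitudes_of_spec:
  assumes d: "\<forall>l<L. \<bar>d l - \<delta> l\<bar> \<le> 11/10"
  shows "\<And>p. p < L \<Longrightarrow> amplitudes_of L N x m d p = amplitude_update L N x m d (amplitudes_of L N x m d) p"
    and "admissible d (amplitudes_of L N x m d)"
proof -
  obtain a where a: "\<And>l. l < L \<Longrightarrow> a l \<in> cball 0 amp_bound"
    "\<And>l. l < L \<Longrightarrow> amplitude_update L N x m d a l = a l" "\<And>l. L \<le> l \<Longrightarrow> a l = 0"
  proof (rule box_contraction_fixpoint[where L = L and K = "\<lambda>_. cball 0 amp_bound"
        and F = "\<lambda>a. amplitude_update L N x m d a" and ?s0.0 = "\<lambda>_. 0"])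
    have adm: "admissible d a" if "\<And>k. k < L \<Longrightarrow> a k \<in> cball 0 amp_bound" for a
      using d that by (auto simp: admissible_def)
    show "amplitude_update L N x m d a l \<in> cball 0 amp_bound"
      if "\<And>k. k < L \<Longrightarrow> a k \<in> cball 0 amp_bound" "l < L" for a l
      using amplitude_update_bound[OF adm that(2)] that(1) by simp
    show "cmod (amplitude_update L N x m d a l - amplitude_update L N x m d a' l) \<le> r / 2"
      if aa: "\<And>k. k < L \<Longrightarrow> a k \<in> cball 0 amp_bound" "\<And>k. k < L \<Longrightarrow> a' k \<in> cball 0 amp_bound"
        "\<And>k. k < L \<Longrightarrow> cmod (a k - a' k) \<le> r" and l: "l < L" for a a' r l
    proof -
      have r: "0 \<le> r" using aa(3)[OF l] norm_ge_zero order_trans by blast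
      have "cmod (cleaned 0 d a l - cleaned 0 d a' l) \<le> 7 * b * \<bar>d l - d l\<bar> + perturb * r"
        using r by (intro cleaned_0_lipschitz adm aa l) auto
      also have "\<dots> \<le> 1/2 * r" using mult_right_mono[OF perturb_small(2) r] by simp
      finally show ?thesis by (simp add: amplitude_update_eq[OF d l])
    qed
  qed (use amp_bound_pos in auto)
  let ?P = "\<lambda>a. (\<forall>p<L. a p = amplitude_update L N x m d a p) \<and> (\<forall>p\<ge>L. a p = 0)"
  have "?P (amplitudes_of L N x m d)"
    unfolding amplitudes_of_def by (rule someI[of ?P a]) (use a in auto)
  then show *: "\<And>p. p < L \<Longrightarrow> amplitudes_of L N x m d p = amplitude_update L N x m d (amplitudes_of L N x m d) p"
    by blast
  have "amplitudes_of L N x m d l = a l" if "l < L" for l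
    using amplitude_equation_unique[OF d * _ that, of a] a(2) by metis
  then show "admissible d (amplitudes_of L N x m d)"
    using a(1) d by (auto simp: admissible_def)
qed

lemma residual_cube_offset:
  assumes "\<nu> \<in> residual_cube L"
  shows "\<forall>l<L. \<bar>\<nu> l - \<delta> l\<bar> \<le> 11/10"
proof (intro allI impI)
  fix l assume l: "l < L"
  then have "\<nu> l \<in> {-1/2..1/2}" using assms by (simp add: residual_cube_def)
  then show "\<bar>\<nu> l - \<delta> l\<bar> \<le> 11/10" using resid[OF l] by (simp only: atLeastAtMost_iff) linarith
qed

lemma fixed_point_iff_stationary:
  assumes d: "\<forall>l<L. \<bar>d l - \<delta> l\<bar> \<le> 11/10"
  shows "is_fixed_point L N x m d \<longleftrightarrow> is_stationary d (amplitudes_of L N x m d)"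
  unfolding is_fixed_point_def is_stationary_def iteration_map_def
  using amplitudes_of_spec[OF d] by metis

lemma stationary_imp_fixed_point:
  assumes "is_stationary d a"
  shows "is_fixed_point L N x m d"
proof -
  have adm: "admissible d a" using assms by (simp add: is_stationary_def)
  note d = admissible_offset[OF adm]
  have fixed: "residual_update L N x m d a p = d p" and amp: "a p = amplitude_update L N x m d a p" if "p < L" for p
    using assms that unfolding is_stationary_def by metis+
  have eq: "amplitudes_of L N x m d l = a l" if "l < L" for l
    using amplitude_equation_unique[where a = "amplitudes_of L N x m d" and a' = a, OF d _ amp that]
      amplitudes_of_spec(1)[OF d] by blast
  have "iteration_map L N x m d p = d p" if p: "p < L" for p
  proof -
    \<comment> \<open>Distance 0 in the Lipschitz estimate expresses that the update reads only the
      components below \<open>L\<close>, where the two amplitude vectors are known to agree.\<close>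
    have "\<bar>residual_update L N x m d (amplitudes_of L N x m d) p - residual_update L N x m d a p\<bar> \<le> lip_const * perturb * 0"
      by (rule residual_update_lipschitz[OF amplitudes_of_spec(2)[OF d] adm p]) (simp_all only: eq, simp_all)
    then show ?thesis unfolding iteration_map_def fixed[OF p] by simp
  qed
  then show ?thesis by (simp add: is_fixed_point_def)
qed

text \<open>The amplitudes are given implicitly, so their difference \<open>r\<close> occurs on both
  sides: \<open>r \<le> 7 * b * R + (R + r) / 2\<close>, whence the constant
  \<open>14 * b + 1\<close>.\<close>

lemma amplitudes_of_lipschitz:
  assumes d: "\<forall>l<L. \<bar>d l - \<delta> l\<bar> \<le> 11/10" and d': "\<forall>l<L. \<bar>d' l - \<delta> l\<bar> \<le> 11/10"
    and close: "\<And>l. l < L \<Longrightarrow> \<bar>d l - d' l\<bar> \<le> R" and p: "p < L"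
  shows "cmod (amplitudes_of L N x m d p - amplitudes_of L N x m d' p) \<le> (14 * b + 1) * R"
proof -
  let ?a = "amplitudes_of L N x m d" and ?a' = "amplitudes_of L N x m d'"
  have R: "0 \<le> R" using close[OF p] by linarith
  have "cmod (?a p - ?a' p) \<le> 2 * ((7 * b + 1/2) * R)"
  proof (rule bound_of_half_contraction[OF _ p])
    fix r l assume r: "\<And>k. k < L \<Longrightarrow> cmod (?a k - ?a' k) \<le> r" and l: "l < L"
    have r0: "0 \<le> r" using r[OF l] norm_ge_zero order_trans by blast
    have 1: "?a l = cleaned 0 d ?a l"
      by (rule trans[OF amplitudes_of_spec(1)[OF d l] amplitude_update_eq[OF d l]])
    have 2: "?a' l = cleaned 0 d' ?a' l"
      by (rule trans[OF amplitudes_of_spec(1)[OF d' l] amplitude_update_eq[OF d' l]])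
    have "cmod (cleaned 0 d ?a l - cleaned 0 d' ?a' l) \<le> 7 * b * \<bar>d l - d' l\<bar> + perturb * (R + r)"
      by (rule cleaned_0_lipschitz[OF amplitudes_of_spec(2)[OF d] amplitudes_of_spec(2)[OF d'] l])
        (use close r R r0 in \<open>auto intro: add_increasing add_increasing2\<close>)
    also have "\<dots> \<le> 7 * b * R + 1/2 * (R + r)"
      using close[OF l] b_pos R r0 perturb_small(2) by (intro add_mono mult_left_mono mult_right_mono) auto
    finally show "cmod (?a l - ?a' l) \<le> (7 * b + 1/2) * R + r / 2"
      unfolding 1[symmetric] 2[symmetric] by (simp add: algebra_simps add_divide_distrib)
  qed
  then show ?thesis by (simp add: algebra_simps)
qed

lemma iteration_map_lipschitz:
  assumes d: "\<forall>l<L. \<bar>d l - \<delta> l\<bar> \<le> 11/10" and d': "\<forall>l<L. \<bar>d' l - \<delta> l\<bar> \<le> 11/10"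
    and close: "\<And>l. l < L \<Longrightarrow> \<bar>d l - d' l\<bar> \<le> R" and p: "p < L"
  shows "\<bar>iteration_map L N x m d p - iteration_map L N x m d' p\<bar> \<le> lip_const * (14 * b + 1) * perturb * R"
proof -
  have R: "0 \<le> R" using close[OF p] by linarith
  then have "R \<le> (14 * b + 1) * R" using b_pos mult_right_mono[of 1 "14 * b + 1" R] by simp
  then have "\<bar>residual_update L N x m d (amplitudes_of L N x m d) p - residual_update L N x m d' (amplitudes_of L N x m d') p\<bar>
      \<le> lip_const * perturb * ((14 * b + 1) * R)"
    using close amplitudes_of_lipschitz[OF d d' close]
    by (intro residual_update_lipschitz amplitudes_of_spec d d' p) (auto intro: order_trans)
  then show ?thesis by (simp add: iteration_map_def mult_ac)
qed

text \<open>Every coordinate moves by at most \<open>c\<close> times the Euclidean distance; adding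
  \<open>L\<close> squares costs the factor \<open>sqrt (real L)\<close>.\<close>

lemma convergence_rate_le:
  "convergence_rate L N x m \<le> ereal (sqrt (real L) * (lip_const * (14 * b + 1) * perturb))"
proof -
  define c where "c = lip_const * (14 * b + 1) * perturb"
  have c: "0 \<le> c" using lip_const_pos b_pos perturb_nonneg by (simp add: c_def)
  have "(\<Sum>l<L. \<bar>iteration_map L N x m \<nu>2 l - iteration_map L N x m \<nu>1 l\<bar>\<^sup>2)
      \<le> (sqrt (real L) * c)\<^sup>2 * (\<Sum>l<L. \<bar>\<nu>2 l - \<nu>1 l\<bar>\<^sup>2)"
    if \<nu>: "\<nu>1 \<in> residual_cube L" "\<nu>2 \<in> residual_cube L" for \<nu>1 \<nu>2
  proof -
    define R where "R = sqrt (\<Sum>l<L. \<bar>\<nu>2 l - \<nu>1 l\<bar>\<^sup>2)"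
    have R2: "R\<^sup>2 = (\<Sum>l<L. \<bar>\<nu>2 l - \<nu>1 l\<bar>\<^sup>2)" unfolding R_def by (intro real_sqrt_pow2 sum_nonneg) auto
    have close: "\<bar>\<nu>2 l - \<nu>1 l\<bar> \<le> R" if "l < L" for l
      unfolding R_def using that
      by (intro real_le_rsqrt member_le_sum[of l "{..<L}" "\<lambda>l. \<bar>\<nu>2 l - \<nu>1 l\<bar>\<^sup>2"]) auto
    have "(\<Sum>l<L. \<bar>iteration_map L N x m \<nu>2 l - iteration_map L N x m \<nu>1 l\<bar>\<^sup>2) \<le> (\<Sum>l<L. (c * R)\<^sup>2)"
      using iteration_map_lipschitz[OF residual_cube_offset[OF \<nu>(2)] residual_cube_offset[OF \<nu>(1)] close]
      by (intro sum_mono power_mono) (auto simp: c_def)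
    also have "\<dots> = (sqrt (real L) * c)\<^sup>2 * R\<^sup>2" by (simp add: power_mult_distrib)
    finally show ?thesis by (simp only: R2)
  qed
  then show ?thesis
    unfolding convergence_rate_def c_def[symmetric] using c by (intro Inf_lower) auto
qed

section \<open>Convergence and linearisation of the sweeps\<close>

lemma component_step_admissible:
  assumes "admissible d a" "p < L" "component_step L N x m p (d, a) = (d', a')"
  shows "admissible d' a'"
  using assms residual_update_admissible[OF assms(1,2)]
    amplitude_update_bound[OF admissible_upd[OF assms(1,2)] assms(2)]
  by (auto simp: admissible_def component_step_eq)

lemma partial_sweep_admissible:
  assumes "admissible (fst s) (snd s)" "k \<le> L"
  shows "admissible (fst (partial_sweep L N x m k s)) (snd (partial_sweep L N x m k s))"
  using assms(2)
proof (induction k)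
  case (Suc k)
  then show ?case
    using component_step_admissible[of "fst (partial_sweep L N x m k s)" "snd (partial_sweep L N x m k s)" k]
    by (simp add: partial_sweep_Suc)
qed (use assms in simp)

text \<open>A stationary state is fixed by every component step, so each step is compared with it.
  The bound handed to the next component is still \<rho>, as the later components are not yet
  halved.\<close>

lemma partial_sweep_contraction:
  assumes st: "is_stationary d a" and adm: "admissible (fst s) (snd s)"
    and close: "\<And>l. l < L \<Longrightarrow> \<bar>fst s l - d l\<bar> \<le> \<rho>" "\<And>l. l < L \<Longrightarrow> cmod (snd s l - a l) \<le> \<rho>"
    and "k \<le> L" "l < L"
  shows "\<bar>fst (partial_sweep L N x m k s) l - d l\<bar> \<le> (if l < k then \<rho> / 2 else \<rho>)
    \<and> cmod (snd (partial_sweep L N x m k s) l - a l) \<le> (if l < k then \<rho> / 2 else \<rho>)"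
  using assms(5,6)
proof (induction k arbitrary: l)
  case 0
  then show ?case using close by simp
next
  case (Suc k)
  have \<rho>: "0 \<le> \<rho>" using close(1)[OF Suc.prems(2)] by linarith
  let ?t = "partial_sweep L N x m k s"
  have k: "k < L" using Suc.prems by simp
  have t: "\<bar>fst ?t j - d j\<bar> \<le> \<rho>" "cmod (snd ?t j - a j) \<le> \<rho>" if "j < L" for j
    using Suc.IH[OF _ that] Suc.prems \<rho> by (auto split: if_splits)
  show ?case
  proof (cases "l = k")
    case True
    have adm_t: "admissible (fst ?t) (snd ?t)" using adm k by (intro partial_sweep_admissible) auto
    have adm_d: "admissible d a" using st by (simp add: is_stationary_def)
    have eq: "residual_update L N x m d a k = d k" "amplitude_update L N x m d a k = a k"
      using st k by (auto simp: is_stationary_def)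
    have split: "component_step L N x m k ?t = component_step L N x m k (fst ?t, snd ?t)" by simp
    from component_update_contraction[OF adm_t adm_d k t]
    have "\<bar>fst (component_step L N x m k ?t) k - d k\<bar> + cmod (snd (component_step L N x m k ?t) k - a k) \<le> \<rho> / 2"
      unfolding split component_step_eq by (simp add: eq)
    then show ?thesis
      using norm_ge_zero[of "snd (component_step L N x m k ?t) k - a k"]
        abs_ge_zero[of "fst (component_step L N x m k ?t) k - d k"]
      unfolding True partial_sweep_Suc by (simp del: norm_ge_zero abs_ge_zero)
  next
    case False
    then show ?thesis
      using Suc.IH[of l] Suc.prems by (auto simp: partial_sweep_Suc component_step_other less_Suc_eq)
  qed
qed

lemma sweeps_admissible: "admissible (fst ((sweep L N x m ^^ Q) (\<lambda>_. 0, \<lambda>_. 0))) (snd ((sweep L N x m ^^ Q) (\<lambda>_. 0, \<lambda>_. 0)))"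
proof (induction Q)
  case 0
  have "\<bar>0 - \<delta> l\<bar> \<le> 11/10" if "l < L" for l using resid[OF that] by linarith
  then show ?case using amp_bound_pos by (auto simp: admissible_def)
next
  case (Suc Q)
  then show ?case by (simp add: sweep_eq partial_sweep_admissible)
qed

lemma residual_est_convergence:
  assumes st: "is_stationary d a" and l: "l < L"
  shows "(\<lambda>Q. residual_est L N x m Q l) \<longlonglongrightarrow> d l"
proof -
  let ?s = "\<lambda>Q. (sweep L N x m ^^ Q) (\<lambda>_. 0, \<lambda>_. 0)"
  define \<rho> where "\<rho> = 2 + 2 * amp_bound"
  have adm: "admissible d a" using st by (simp add: is_stationary_def)
  have "\<forall>l<L. \<bar>fst (?s Q) l - d l\<bar> \<le> \<rho> / 2 ^ Q \<and> cmod (snd (?s Q) l - a l) \<le> \<rho> / 2 ^ Q" for Q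
  proof (induction Q)
    case 0
    have "\<bar>d l\<bar> \<le> \<rho> \<and> cmod (a l) \<le> \<rho>" if "l < L" for l
    proof -
      have "\<bar>d l - \<delta> l\<bar> \<le> 11/10" "cmod (a l) \<le> amp_bound" using adm that by (auto simp: admissible_def)
      then show ?thesis using resid[OF that] amp_bound_pos unfolding \<rho>_def by linarith
    qed
    then show ?case by simp
  next
    case (Suc Q)
    have "\<bar>fst (partial_sweep L N x m L (?s Q)) l - d l\<bar> \<le> (if l < L then \<rho> / 2 ^ Q / 2 else \<rho> / 2 ^ Q)
      \<and> cmod (snd (partial_sweep L N x m L (?s Q)) l - a l) \<le> (if l < L then \<rho> / 2 ^ Q / 2 else \<rho> / 2 ^ Q)"
      if "l < L" for l
      using Suc by (intro partial_sweep_contraction st sweeps_admissible that) auto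
    then show ?case by (simp add: sweep_eq mult.commute)
  qed
  then have "norm (residual_est L N x m Q l - d l) \<le> \<rho> * (1/2) ^ Q" for Q
    using l by (simp add: residual_est_def power_divide)
  moreover have "(\<lambda>Q. \<rho> * (1/2) ^ Q) \<longlonglongrightarrow> \<rho> * 0"
    by (intro tendsto_mult tendsto_const LIMSEQ_power_zero) auto
  ultimately have "(\<lambda>Q. residual_est L N x m Q l - d l) \<longlonglongrightarrow> 0"
    using Lim_null_comparison[of "\<lambda>Q. residual_est L N x m Q l - d l" "\<lambda>Q. \<rho> * (1/2) ^ Q" sequentially] by simp
  then show ?thesis by (simp add: LIM_zero_iff)
qed

lemma sweep_error:
  assumes "admissible (fst s) (snd s)" "p < L"
  shows "\<bar>fst (sweep L N x m s) p - \<delta> p\<bar> \<le> 840 / \<alpha> * perturb"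
  unfolding sweep_component[OF assms(2)]
  using assms by (intro residual_update_error partial_sweep_admissible) auto

text \<open>The last sweep but one brings the residuals within
  \<open>840 / \<alpha> * perturb\<close>, so the last one is linearised with a second-order
  remainder. The bound does not depend on \<open>Q\<close>.\<close>

lemma residual_est_linear:
  assumes "2 \<le> Q" "p < L"
  shows "\<bar>residual_est L N x m Q p - \<delta> p - linear_error p\<bar>
    \<le> lin_const * (leak_level + 1 / real N + (840 / \<alpha> + 1) * perturb\<^sup>2)"
proof -
  obtain q where q: "Q = Suc (Suc q)" using assms(1) by (metis add_2_eq_Suc le_Suc_ex)
  let ?s = "(sweep L N x m ^^ Suc q) (\<lambda>_. 0, \<lambda>_. 0)"
  have "\<bar>fst ?s p - \<delta> p\<bar> \<le> 840 / \<alpha> * perturb"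
    using sweep_error[OF sweeps_admissible assms(2)] by simp
  then have "\<bar>fst (partial_sweep L N x m p ?s) p - \<delta> p\<bar> \<le> 840 / \<alpha> * perturb"
    using partial_sweep_unchanged[of p p L N x m ?s] by simp
  then have "\<bar>fst (sweep L N x m ?s) p - \<delta> p - linear_error p\<bar>
      \<le> lin_const * (leak_level + 1 / real N + perturb * (840 / \<alpha> * perturb) + perturb\<^sup>2)"
    unfolding sweep_component[OF assms(2)] using assms(2)
    by (intro residual_update_linear partial_sweep_admissible sweeps_admissible) auto
  also have "\<dots> = lin_const * (leak_level + 1 / real N + (840 / \<alpha> + 1) * perturb\<^sup>2)"
    by (simp add: power2_eq_square algebra_simps)
  finally show ?thesis by (simp add: residual_est_def q)
qed

end

subsection \<open>Gaussian noise\<close>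

text \<open>Completing the square: the weighted density is a multiple of a shifted normal
  density.\<close>

lemma normal_mgf:
  assumes "0 < s"
  shows "integrable lborel (\<lambda>x. normal_density 0 s x * exp (t * x))"
    and "(\<integral>x. normal_density 0 s x * exp (t * x) \<partial>lborel) = exp (t\<^sup>2 * s\<^sup>2 / 2)"
proof -
  have eq: "normal_density 0 s x * exp (t * x) = exp (t\<^sup>2 * s\<^sup>2 / 2) * normal_density (t * s\<^sup>2) s x" for x
  proof -
    have "- (x - 0)\<^sup>2 / (2 * s\<^sup>2) + t * x = t\<^sup>2 * s\<^sup>2 / 2 + - (x - t * s\<^sup>2)\<^sup>2 / (2 * s\<^sup>2)"
      using assms by (simp add: power2_eq_square field_simps)
    then have "exp (- (x - 0)\<^sup>2 / (2 * s\<^sup>2)) * exp (t * x) = exp (t\<^sup>2 * s\<^sup>2 / 2) * exp (- (x - t * s\<^sup>2)\<^sup>2 / (2 * s\<^sup>2))"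
      by (simp only: exp_add[symmetric])
    then show ?thesis by (simp add: normal_density_def)
  qed
  show "integrable lborel (\<lambda>x. normal_density 0 s x * exp (t * x))"
    unfolding eq using assms by (intro integrable_mult_right integrable_normal_density)
  show "(\<integral>x. normal_density 0 s x * exp (t * x) \<partial>lborel) = exp (t\<^sup>2 * s\<^sup>2 / 2)"
    unfolding eq using assms by simp
qed

lemma power4_le_exp: "(x::real) ^ 4 \<le> 64 * (exp x + exp (- x))"
proof -
  have main: "x ^ 4 \<le> 64 * exp x" if "0 \<le> x" for x :: real
  proof -
    have "(x / 2)\<^sup>2 / 2 \<le> exp (x / 2)"
      using exp_lower_Taylor_quadratic[of "x / 2"] that by simp
    then have "((x / 2)\<^sup>2 / 2)\<^sup>2 \<le> (exp (x / 2))\<^sup>2"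
      by (intro power_mono) auto
    moreover have "((x / 2)\<^sup>2 / 2)\<^sup>2 = x ^ 4 / 64" by (simp add: power_divide flip: power_mult)
    moreover have "(exp (x / 2))\<^sup>2 = exp x" by (simp flip: exp_of_nat_mult)
    ultimately show ?thesis by simp
  qed
  show ?thesis
  proof (cases "0 \<le> x")
    case True
    then show ?thesis using main[of x] exp_ge_zero[of "- x"] unfolding distrib_left by linarith
  next
    case False
    then show ?thesis using main[of "- x"] exp_ge_zero[of x] unfolding distrib_left power_minus_even[OF even_numeral] minus_minus by linarith
  qed
qed

locale gaussian_noise = prob_space M for M :: "'a measure" +
  fixes w :: "nat \<Rightarrow> 'a \<Rightarrow> complex" and \<sigma> :: real
  assumes \<sigma>_pos: "0 < \<sigma>" and white: "white_circular_gaussian M w \<sigma>"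
begin

definition part :: "nat \<times> bool \<Rightarrow> 'a \<Rightarrow> real" where
  "part = (\<lambda>(n, b) \<omega>. if b then Re (w n \<omega>) else Im (w n \<omega>))"

lemma part_indep: "indep_vars (\<lambda>_. borel) part UNIV"
  using white by (simp add: white_circular_gaussian_def part_def)

lemma part_distributed: "distributed M lborel (part i) (normal_density 0 (\<sigma> / sqrt 2))"
proof -
  obtain n c where "i = (n, c)" by (cases i)
  then show ?thesis using white by (cases c) (auto simp: white_circular_gaussian_def part_def)
qed

lemma part_measurable [measurable]: "part i \<in> borel_measurable M"
  using distributed_measurable[OF part_distributed[of i]] by simp

lemma w_measurable [measurable]: "w n \<in> borel_measurable M"
proof -
  have "(\<lambda>\<omega>. Re (w n \<omega>)) \<in> borel_measurable M" "(\<lambda>\<omega>. Im (w n \<omega>)) \<in> borel_measurable M"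
    using part_measurable[of "(n, True)"] part_measurable[of "(n, False)"] by (simp_all add: part_def)
  then show ?thesis unfolding borel_measurable_complex_iff by simp
qed

lemma part_mgf:
  "integrable M (\<lambda>\<omega>. exp (t * part i \<omega>))" "expectation (\<lambda>\<omega>. exp (t * part i \<omega>)) = exp (t\<^sup>2 * \<sigma>\<^sup>2 / 4)"
proof -
  have s: "0 < \<sigma> / sqrt 2" using \<sigma>_pos by simp
  show "integrable M (\<lambda>\<omega>. exp (t * part i \<omega>))"
    using distributed_integrable[OF part_distributed, of "\<lambda>x. exp (t * x)" i] normal_mgf(1)[OF s] by simp
  have "expectation (\<lambda>\<omega>. exp (t * part i \<omega>)) = exp (t\<^sup>2 * (\<sigma> / sqrt 2)\<^sup>2 / 2)"
    using distributed_integral[OF part_distributed, of "\<lambda>x. exp (t * x)" i] normal_mgf(2)[OF s] by simp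
  then show "expectation (\<lambda>\<omega>. exp (t * part i \<omega>)) = exp (t\<^sup>2 * \<sigma>\<^sup>2 / 4)"
    by (simp add: power_divide)
qed

lemma part_moments:
  "integrable M (part i)" "expectation (part i) = 0"
  "integrable M (\<lambda>\<omega>. (part i \<omega>)\<^sup>2)" "expectation (\<lambda>\<omega>. (part i \<omega>)\<^sup>2) = \<sigma>\<^sup>2 / 2"
proof -
  have s: "0 < \<sigma> / sqrt 2" using \<sigma>_pos by simp
  show "integrable M (part i)"
    using distributed_integrable[OF part_distributed, of "\<lambda>x. x" i] integrable_normal_moment[OF s, of 0 1] by simp
  show E: "expectation (part i) = 0"
    by (rule normal_distributed_expectation[OF s part_distributed])
  show "integrable M (\<lambda>\<omega>. (part i \<omega>)\<^sup>2)"
    using distributed_integrable[OF part_distributed, of "\<lambda>x. x\<^sup>2" i] integrable_normal_moment[OF s, of 0 2] by simp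
  have "variance (part i) = (\<sigma> / sqrt 2)\<^sup>2"
    by (rule normal_distributed_variance[OF s part_distributed])
  then show "expectation (\<lambda>\<omega>. (part i \<omega>)\<^sup>2) = \<sigma>\<^sup>2 / 2"
    by (simp add: E power_divide)
qed

lemma part_product:
  assumes "i \<noteq> j"
  shows "integrable M (\<lambda>\<omega>. part i \<omega> * part j \<omega>)" "expectation (\<lambda>\<omega>. part i \<omega> * part j \<omega>) = 0"
proof -
  have ind: "indep_vars (\<lambda>_. borel) part {i, j}"
    by (rule indep_vars_subset[OF part_indep]) simp
  show "integrable M (\<lambda>\<omega>. part i \<omega> * part j \<omega>)"
    using indep_vars_integrable[OF _ ind] part_moments(1) assms by simp
  show "expectation (\<lambda>\<omega>. part i \<omega> * part j \<omega>) = 0"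
    using indep_vars_lebesgue_integral[OF _ ind] part_moments(1,2) assms by simp
qed

text \<open>The noise functionals that occur are real linear. Real parts with complex weights cover
  them all, imaginary parts by multiplying the weights with \<open>-\<i>\<close>.\<close>

definition lin :: "nat \<Rightarrow> (nat \<Rightarrow> complex) \<Rightarrow> 'a \<Rightarrow> real" where
  "lin n z \<omega> = Re (\<Sum>k<n. z k * w k \<omega>)"

definition energy :: "nat \<Rightarrow> (nat \<Rightarrow> complex) \<Rightarrow> real" where
  "energy n z = (\<Sum>k<n. (cmod (z k))\<^sup>2)"

abbreviation idx :: "nat \<Rightarrow> (nat \<times> bool) set" where
  "idx n \<equiv> {..<n} \<times> UNIV"

definition lin_coeff :: "(nat \<Rightarrow> complex) \<Rightarrow> nat \<times> bool \<Rightarrow> real" where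
  "lin_coeff z = (\<lambda>(k, b). if b then Re (z k) else - Im (z k))"

lemma sum_idx: "(\<Sum>i\<in>idx n. g i) = (\<Sum>k<n. g (k, True) + (g (k, False) :: real))"
proof -
  have "(\<Sum>i\<in>idx n. g i) = (\<Sum>k<n. \<Sum>c\<in>UNIV. g (k, c))"
    unfolding sum.cartesian_product by (intro sum.cong) auto
  then show ?thesis by (simp add: UNIV_bool add.commute)
qed

lemma lin_eq: "lin n z \<omega> = (\<Sum>i\<in>idx n. lin_coeff z i * part i \<omega>)"
  unfolding sum_idx by (simp add: lin_def lin_coeff_def part_def)

lemma energy_eq: "energy n z = (\<Sum>i\<in>idx n. (lin_coeff z i)\<^sup>2)"
  unfolding sum_idx by (simp add: energy_def lin_coeff_def cmod_power2)

lemma lin_measurable [measurable]: "lin n z \<in> borel_measurable M"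
  unfolding lin_def[abs_def] by measurable

lemma lin_mgf:
  "integrable M (\<lambda>\<omega>. exp (t * lin n z \<omega>))"
  "expectation (\<lambda>\<omega>. exp (t * lin n z \<omega>)) = exp (t\<^sup>2 * \<sigma>\<^sup>2 / 4 * energy n z)"
proof -
  have eq: "exp (t * lin n z \<omega>) = (\<Prod>i\<in>idx n. exp (t * lin_coeff z i * part i \<omega>))" for \<omega>
    by (simp add: lin_eq sum_distrib_left exp_sum mult.assoc)
  have ind: "indep_vars (\<lambda>_. borel) (\<lambda>i \<omega>. exp (t * lin_coeff z i * part i \<omega>)) (idx n)"
    by (rule indep_vars_compose2[OF indep_vars_subset[OF part_indep], where Y = "\<lambda>i x. exp (t * lin_coeff z i * x)"]) auto
  show "integrable M (\<lambda>\<omega>. exp (t * lin n z \<omega>))"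
    unfolding eq by (rule indep_vars_integrable[OF _ ind]) (auto intro: part_mgf)
  have "expectation (\<lambda>\<omega>. exp (t * lin n z \<omega>)) = (\<Prod>i\<in>idx n. exp ((t * lin_coeff z i)\<^sup>2 * \<sigma>\<^sup>2 / 4))"
    unfolding eq by (subst indep_vars_lebesgue_integral[OF _ ind]) (auto simp: part_mgf)
  also have "\<dots> = exp (t\<^sup>2 * \<sigma>\<^sup>2 / 4 * energy n z)"
    by (simp add: energy_eq sum_distrib_left exp_sum[symmetric] power_mult_distrib algebra_simps)
  finally show "expectation (\<lambda>\<omega>. exp (t * lin n z \<omega>)) = exp (t\<^sup>2 * \<sigma>\<^sup>2 / 4 * energy n z)" .
qed

lemma lin_uminus: "lin n (\<lambda>k. - z k) \<omega> = - lin n z \<omega>" "energy n (\<lambda>k. - z k) = energy n z"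
  by (simp_all add: lin_def energy_def sum_negf)

lemma lin_upper_tail:
  assumes "energy n z \<le> V" "0 < V" "0 \<le> r"
  shows "prob {\<omega> \<in> space M. r \<le> lin n z \<omega>} \<le> exp (- (r\<^sup>2 / (\<sigma>\<^sup>2 * V)))"
proof (cases "r = 0")
  \<comment> \<open>For \<open>r = 0\<close> the exponent chosen below would be 0, and Markov's
    inequality could not be translated back; the claimed bound is then 1.\<close>
  case True
  then show ?thesis by simp
next
  case False
  \<comment> \<open>The minimiser of the Chernoff exponent
    \<open>t\<^sup>2 * \<sigma>\<^sup>2 / 4 * V - t * r\<close>.\<close>
  define t where "t = 2 * r / (\<sigma>\<^sup>2 * V)"
  have t: "0 < t" using assms False \<sigma>_pos by (simp add: t_def)
  have "prob {\<omega> \<in> space M. exp (t * r) \<le> exp (t * lin n z \<omega>)} \<le> expectation (\<lambda>\<omega>. exp (t * lin n z \<omega>)) / exp (t * r)"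
    by (rule integral_Markov_inequality_measure[where A = "{}"]) (auto intro: lin_mgf)
  also have "{\<omega> \<in> space M. exp (t * r) \<le> exp (t * lin n z \<omega>)} = {\<omega> \<in> space M. r \<le> lin n z \<omega>}"
    using t by auto
  also have "expectation (\<lambda>\<omega>. exp (t * lin n z \<omega>)) / exp (t * r) = exp (t\<^sup>2 * \<sigma>\<^sup>2 / 4 * energy n z - t * r)"
    by (simp add: lin_mgf exp_diff)
  also have "\<dots> \<le> exp (t\<^sup>2 * \<sigma>\<^sup>2 / 4 * V - t * r)"
    using assms by (simp add: mult_left_mono)
  also have "t\<^sup>2 * \<sigma>\<^sup>2 / 4 * V - t * r = - (r\<^sup>2 / (\<sigma>\<^sup>2 * V))"
    using assms \<sigma>_pos by (simp add: t_def power2_eq_square field_simps)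
  finally show ?thesis .
qed

lemma lin_tail:
  assumes "energy n z \<le> V" "0 < V" "0 \<le> r"
  shows "prob {\<omega> \<in> space M. r \<le> \<bar>lin n z \<omega>\<bar>} \<le> 2 * exp (- (r\<^sup>2 / (\<sigma>\<^sup>2 * V)))"
proof -
  have "{\<omega> \<in> space M. r \<le> \<bar>lin n z \<omega>\<bar>}
      = {\<omega> \<in> space M. r \<le> lin n z \<omega>} \<union> {\<omega> \<in> space M. r \<le> lin n (\<lambda>k. - z k) \<omega>}"
    by (auto simp: lin_uminus)
  also have "prob \<dots> \<le> prob {\<omega> \<in> space M. r \<le> lin n z \<omega>} + prob {\<omega> \<in> space M. r \<le> lin n (\<lambda>k. - z k) \<omega>}"
    by (intro measure_Un_le) auto
  also have "\<dots> \<le> 2 * exp (- (r\<^sup>2 / (\<sigma>\<^sup>2 * V)))"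
    using lin_upper_tail[OF assms] lin_upper_tail[of n "\<lambda>k. - z k", OF _ assms(2,3)] assms(1) by (simp add: lin_uminus)
  finally show ?thesis .
qed

lemma lin_moments:
  "integrable M (lin n z)" "expectation (lin n z) = 0"
  "integrable M (\<lambda>\<omega>. (lin n z \<omega>)\<^sup>2)" "expectation (\<lambda>\<omega>. (lin n z \<omega>)\<^sup>2) = \<sigma>\<^sup>2 / 2 * energy n z"
proof -
  have lin: "lin n z = (\<lambda>\<omega>. \<Sum>i\<in>idx n. lin_coeff z i * part i \<omega>)" by (rule ext) (rule lin_eq)
  show "integrable M (lin n z)" unfolding lin by (intro Bochner_Integration.integrable_sum integrable_mult_right part_moments)
  show "expectation (lin n z) = 0"
    unfolding lin by (subst Bochner_Integration.integral_sum) (auto simp: part_moments)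
  have sq: "(lin n z \<omega>)\<^sup>2 = (\<Sum>i\<in>idx n. \<Sum>j\<in>idx n. lin_coeff z i * lin_coeff z j * (part i \<omega> * part j \<omega>))" for \<omega>
    unfolding lin_eq power2_eq_square sum_product by (simp only: mult_ac)
  have int: "integrable M (\<lambda>\<omega>. part i \<omega> * part j \<omega>)" for i j
    using part_product(1)[of i j] part_moments(3)[of i] by (cases "i = j") (simp_all add: power2_eq_square)
  have E: "expectation (\<lambda>\<omega>. part i \<omega> * part j \<omega>) = (if i = j then \<sigma>\<^sup>2 / 2 else 0)" for i j
    using part_product(2)[of i j] part_moments(4)[of i] by (cases "i = j") (simp_all add: power2_eq_square)
  show "integrable M (\<lambda>\<omega>. (lin n z \<omega>)\<^sup>2)"
    unfolding sq by (intro Bochner_Integration.integrable_sum integrable_mult_right int)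
  have "expectation (\<lambda>\<omega>. (lin n z \<omega>)\<^sup>2)
      = (\<Sum>i\<in>idx n. \<Sum>j\<in>idx n. lin_coeff z i * lin_coeff z j * (if i = j then \<sigma>\<^sup>2 / 2 else 0))"
    unfolding sq by (simp add: Bochner_Integration.integral_sum int E)
  also have "\<dots> = (\<Sum>i\<in>idx n. (lin_coeff z i)\<^sup>2 * (\<sigma>\<^sup>2 / 2))"
    by (intro sum.cong refl) (simp add: if_distrib[of "(*) _"] power2_eq_square cong: if_cong)
  finally show "expectation (\<lambda>\<omega>. (lin n z \<omega>)\<^sup>2) = \<sigma>\<^sup>2 / 2 * energy n z"
    by (simp add: energy_eq sum_distrib_left mult.commute)
qed

text \<open>Exponential moments dominate the fourth power. What counts is the order
  \<open>V\<^sup>2\<close>, which is smaller than that of the variance when \<open>V\<close> tends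
  to 0.\<close>

lemma lin_fourth_moment:
  assumes "energy n z \<le> V" "0 < V"
  shows "integrable M (\<lambda>\<omega>. (lin n z \<omega>) ^ 4)" "expectation (\<lambda>\<omega>. (lin n z \<omega>) ^ 4) \<le> 24 * (\<sigma>\<^sup>2 * V)\<^sup>2"
proof -
  \<comment> \<open>Chosen so that the exponent \<open>t\<^sup>2 * \<sigma>\<^sup>2 / 4 * V\<close>
    is 1.\<close>
  define t where "t = 2 / (\<sigma> * sqrt V)"
  have t: "0 < t" using assms \<sigma>_pos by (simp add: t_def)
  define g where "g \<omega> = 64 / t ^ 4 * (exp (t * lin n z \<omega>) + exp (- t * lin n z \<omega>))" for \<omega>
  have g: "integrable M g" unfolding g_def[abs_def] by (intro integrable_mult_right Bochner_Integration.integrable_add lin_mgf)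
  have le: "(lin n z \<omega>) ^ 4 \<le> g \<omega>" for \<omega>
    using power4_le_exp[of "t * lin n z \<omega>"] t by (simp add: g_def power_mult_distrib field_simps)
  show int: "integrable M (\<lambda>\<omega>. (lin n z \<omega>) ^ 4)"
    by (rule Bochner_Integration.integrable_bound[OF g]) (use le in \<open>auto intro: order_trans[OF _ abs_ge_self]\<close>)
  have "expectation (\<lambda>\<omega>. (lin n z \<omega>) ^ 4) \<le> expectation g"
    by (intro integral_mono int g le)
  also have "\<dots> = 64 / t ^ 4 * (exp (t\<^sup>2 * \<sigma>\<^sup>2 / 4 * energy n z) + exp ((- t)\<^sup>2 * \<sigma>\<^sup>2 / 4 * energy n z))"
    unfolding g_def[abs_def] by (simp only: integral_mult_right_zero Bochner_Integration.integral_add lin_mgf)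
  also have "\<dots> \<le> 64 / t ^ 4 * (exp (t\<^sup>2 * \<sigma>\<^sup>2 / 4 * V) + exp (t\<^sup>2 * \<sigma>\<^sup>2 / 4 * V))"
    using assms t by (intro mult_left_mono add_mono) (auto simp: mult_left_mono)
  also have "t\<^sup>2 * \<sigma>\<^sup>2 / 4 * V = 1"
    using assms \<sigma>_pos by (simp add: t_def power_divide power_mult_distrib)
  also have "64 / t ^ 4 = 4 * (\<sigma>\<^sup>2 * V)\<^sup>2"
  proof -
    have "t ^ 4 = (t\<^sup>2)\<^sup>2" by (simp flip: power_mult)
    also have "t\<^sup>2 = 4 / (\<sigma>\<^sup>2 * V)" using assms by (simp add: t_def power_divide power_mult_distrib)
    finally show ?thesis by (simp add: power_divide)
  qed
  also have "4 * (\<sigma>\<^sup>2 * V)\<^sup>2 * (exp 1 + exp 1) \<le> 4 * (\<sigma>\<^sup>2 * V)\<^sup>2 * (3 + 3)"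
    using exp_le by (intro mult_left_mono) auto
  finally show "expectation (\<lambda>\<omega>. (lin n z \<omega>) ^ 4) \<le> 24 * (\<sigma>\<^sup>2 * V)\<^sup>2" by simp
qed

lemma partial_noise_tail:
  assumes "n \<le> N" "0 < N" "0 \<le> T"
  shows "prob {\<omega> \<in> space M. real N * T < cmod (\<Sum>k<n. w k \<omega> * cis (\<theta> k))}
    \<le> 4 * exp (- (real N * T\<^sup>2 / (2 * \<sigma>\<^sup>2)))"
proof -
  \<comment> \<open>A complex number of modulus above \<open>N * T\<close> has a real or imaginary
    part of modulus at least \<open>N * T / sqrt 2\<close>.\<close>
  define r where "r = real N * T / sqrt 2"
  define z1 where "z1 k = cis (\<theta> k)" for k
  define z2 where "z2 k = - \<i> * cis (\<theta> k)" for k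
  have en: "energy n z1 \<le> real N" "energy n z2 \<le> real N"
    using assms by (simp_all add: energy_def z1_def z2_def norm_mult)
  have re: "lin n z1 \<omega> = Re (\<Sum>k<n. w k \<omega> * cis (\<theta> k))" for \<omega>
    by (simp add: lin_def z1_def mult.commute)
  have im: "lin n z2 \<omega> = Im (\<Sum>k<n. w k \<omega> * cis (\<theta> k))" for \<omega>
  proof -
    have "(\<Sum>k<n. z2 k * w k \<omega>) = - \<i> * (\<Sum>k<n. w k \<omega> * cis (\<theta> k))"
      by (simp add: z2_def sum_distrib_left mult_ac)
    then show ?thesis unfolding lin_def by simp
  qed
  have r0: "0 \<le> r" using assms by (simp add: r_def)
  have "r \<le> \<bar>Re c\<bar> \<or> r \<le> \<bar>Im c\<bar>" if "real N * T < cmod c" for c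
  proof (rule ccontr)
    assume "\<not> (r \<le> \<bar>Re c\<bar> \<or> r \<le> \<bar>Im c\<bar>)"
    then have "\<bar>Re c\<bar>\<^sup>2 \<le> r\<^sup>2" "\<bar>Im c\<bar>\<^sup>2 \<le> r\<^sup>2" by (intro power_mono; simp)+
    then have "(cmod c)\<^sup>2 \<le> r\<^sup>2 + r\<^sup>2" by (simp add: cmod_power2)
    also have "\<dots> = (real N * T)\<^sup>2" by (simp add: r_def power_divide)
    finally have "cmod c \<le> real N * T" by (rule power2_le_imp_le) (use assms in simp)
    then show False using that by simp
  qed
  then have "{\<omega> \<in> space M. real N * T < cmod (\<Sum>k<n. w k \<omega> * cis (\<theta> k))}
      \<subseteq> {\<omega> \<in> space M. r \<le> \<bar>lin n z1 \<omega>\<bar>} \<union> {\<omega> \<in> space M. r \<le> \<bar>lin n z2 \<omega>\<bar>}"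
    unfolding re im by blast
  then have "prob {\<omega> \<in> space M. real N * T < cmod (\<Sum>k<n. w k \<omega> * cis (\<theta> k))}
      \<le> prob ({\<omega> \<in> space M. r \<le> \<bar>lin n z1 \<omega>\<bar>} \<union> {\<omega> \<in> space M. r \<le> \<bar>lin n z2 \<omega>\<bar>})"
    by (intro finite_measure_mono) auto
  also have "\<dots> \<le> prob {\<omega> \<in> space M. r \<le> \<bar>lin n z1 \<omega>\<bar>} + prob {\<omega> \<in> space M. r \<le> \<bar>lin n z2 \<omega>\<bar>}"
    by (intro measure_Un_le) auto
  also have "\<dots> \<le> 2 * exp (- (r\<^sup>2 / (\<sigma>\<^sup>2 * real N))) + 2 * exp (- (r\<^sup>2 / (\<sigma>\<^sup>2 * real N)))"
    using en assms r0 by (intro add_mono lin_tail) auto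
  also have "r\<^sup>2 / (\<sigma>\<^sup>2 * real N) = real N * T\<^sup>2 / (2 * \<sigma>\<^sup>2)"
    using assms(2) \<sigma>_pos by (simp add: r_def power2_eq_square field_simps)
  finally show ?thesis by simp
qed

section \<open>The exceptional event\<close>

text \<open>Chosen so that a single partial sum exceeds the level with probability of order
  \<open>1 / N^(k+2)\<close>; the union over the \<open>N + 1\<close> partial sums loses one power.
  The almost sure statements use \<open>k = 1\<close>, the moments a larger
  \<open>k\<close>.\<close>

definition noise_level :: "nat \<Rightarrow> nat \<Rightarrow> real" where
  "noise_level k N = \<sigma> * sqrt (2 * (real k + 2)) * sqrt (ln (real N) / real N)"

definition noisy :: "nat \<Rightarrow> nat \<Rightarrow> (nat \<Rightarrow> real) \<Rightarrow> nat \<Rightarrow> 'a set" where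
  "noisy k L \<phi> N = {\<omega> \<in> space M. \<exists>l<L. \<not> partial_noise_bounded N (\<lambda>n. w n \<omega>) (\<phi> l) (noise_level k N)}"

lemma noise_level_nonneg: "0 < N \<Longrightarrow> 0 \<le> noise_level k N"
  using \<sigma>_pos by (simp add: noise_level_def)

lemma noisy_sets [measurable]: "noisy k L \<phi> N \<in> sets M"
  unfolding noisy_def partial_noise_bounded_def by measurable

lemma noisy_prob:
  assumes "0 < N"
  shows "prob (noisy k L \<phi> N) \<le> 8 * real L / real N ^ (k + 1)"
proof -
  define T where "T = noise_level k N"
  let ?B = "\<lambda>l n. {\<omega> \<in> space M. real N * T < cmod (\<Sum>j<n. w j \<omega> * cis (- (2 * pi * \<phi> l * real j)))}"
  have T: "0 \<le> T" using noise_level_nonneg[OF assms] by (simp add: T_def)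
  have "T\<^sup>2 = \<sigma>\<^sup>2 * (2 * (real k + 2)) * (ln (real N) / real N)"
    using assms by (simp add: T_def noise_level_def power_mult_distrib)
  then have "real N * T\<^sup>2 / (2 * \<sigma>\<^sup>2) = real (k + 2) * ln (real N)"
    using assms \<sigma>_pos by (simp add: field_simps)
  then have "exp (- (real N * T\<^sup>2 / (2 * \<sigma>\<^sup>2))) = inverse (exp (real (k + 2) * ln (real N)))"
    by (simp add: exp_minus)
  also have "exp (real (k + 2) * ln (real N)) = real N ^ (k + 2)"
    using assms by (subst exp_of_nat_mult) simp
  finally have exp: "exp (- (real N * T\<^sup>2 / (2 * \<sigma>\<^sup>2))) = 1 / real N ^ (k + 2)"
    by (simp add: inverse_eq_divide)
  have "noisy k L \<phi> N = (\<Union>l\<in>{..<L}. \<Union>n\<in>{..N}. ?B l n)"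
    by (auto simp: noisy_def partial_noise_bounded_def T_def not_le)
  also have "prob \<dots> \<le> (\<Sum>l<L. prob (\<Union>n\<in>{..N}. ?B l n))"
    by (intro finite_measure_subadditive_finite) auto
  also have "\<dots> \<le> (\<Sum>l<L. \<Sum>n\<le>N. prob (?B l n))"
    by (intro sum_mono finite_measure_subadditive_finite) auto
  also have "\<dots> \<le> (\<Sum>l<L. \<Sum>n\<le>N. 4 * exp (- (real N * T\<^sup>2 / (2 * \<sigma>\<^sup>2))))"
    by (intro sum_mono partial_noise_tail T assms) auto
  also have "\<dots> = 4 * real L * (real N + 1) / real N ^ (k + 2)"
    by (simp add: exp)
  also have "\<dots> \<le> 4 * real L * (2 * real N) / real N ^ (k + 2)"
    using assms by (intro divide_right_mono mult_left_mono) auto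
  also have "\<dots> = 8 * real L / real N ^ (k + 1)"
    using assms by (simp add: field_simps)
  finally show ?thesis .
qed

lemma eventually_quiet: "AE \<omega> in M. \<forall>\<^sub>F N in sequentially. \<omega> \<in> space M - noisy 1 L (\<phi> N) N"
proof (rule borel_cantelli_AE1)
  have "summable (\<lambda>N. 8 * real L * inverse (real N ^ 2))"
    by (intro summable_mult inverse_power_summable) auto
  then show "summable (\<lambda>N. prob (noisy 1 L (\<phi> N) N))"
  proof (rule summable_comparison_test_ev[rotated])
    show "\<forall>\<^sub>F N in sequentially. norm (prob (noisy 1 L (\<phi> N) N)) \<le> 8 * real L * inverse (real N ^ 2)"
      using eventually_gt_at_top[of 0]
    proof eventually_elim
      case (elim N)
      then show ?case using noisy_prob[OF elim, of 1 L "\<phi> N"] by (simp add: divide_inverse numeral_2_eq_2)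
    qed
  qed
qed (auto simp: emeasure_eq_measure)

end

subsection \<open>Boundedness and measurability of the estimates\<close>

text \<open>\<open>Ln 0\<close> is an unspecified value.\<close>

definition angle_bound :: real where
  "angle_bound = max pi \<bar>Im (Ln 0)\<bar>"

lemma abs_Im_Ln_le: "\<bar>Im (Ln z)\<bar> \<le> angle_bound"
  using mpi_less_Im_Ln[of z] Im_Ln_le_pi[of z] by (cases "z = 0") (auto simp: angle_bound_def)

text \<open>Valid for all data, even with a vanishing denominator: the step is limited by the angle
  of the logarithm alone.\<close>

lemma residual_update_step: "\<bar>residual_update L N x m d a p - d p\<bar> \<le> real N * angle_bound"
proof -
  have "real N / (2 * pi) * \<bar>Im (Ln z)\<bar> \<le> real N * angle_bound" for z
  proof (rule mult_mono[OF _ abs_Im_Ln_le])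
    show "real N / (2 * pi) \<le> real N" using pi_ge_two divide_left_mono[of 1 "2 * pi" "real N"] by simp
  qed auto
  then show ?thesis by (simp add: residual_update_def Let_def abs_mult)
qed

lemma residual_est_bound:
  assumes "p < L"
  shows "\<bar>residual_est L N x m Q p\<bar> \<le> real Q * (real N * angle_bound)"
proof -
  have "\<bar>fst (sweep L N x m s) p - fst s p\<bar> \<le> real N * angle_bound" for s
    unfolding sweep_component[OF assms]
    using residual_update_step[of L N x m "fst (partial_sweep L N x m p s)" "snd (partial_sweep L N x m p s)" p]
      partial_sweep_unchanged[of p p L N x m s] by simp
  note step = this
  have "\<bar>fst ((sweep L N x m ^^ Q) (\<lambda>_. 0, \<lambda>_. 0)) p\<bar> \<le> real Q * (real N * angle_bound)"
  proof (induction Q)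
    case (Suc Q)
    then show ?case
      using step[of "(sweep L N x m ^^ Q) (\<lambda>_. 0, \<lambda>_. 0)"] by (simp add: algebra_simps)
  qed simp
  then show ?thesis by (simp add: residual_est_def)
qed

section \<open>Measurability with random bins\<close>

lemma cis_measurable [measurable]: "cis \<in> borel_measurable borel"
  by (intro borel_measurable_continuous_onI continuous_intros)

context
  fixes M :: "'a measure" and L N :: nat and x :: "'a \<Rightarrow> nat \<Rightarrow> complex" and m :: "'a \<Rightarrow> nat \<Rightarrow> int"
  assumes x [measurable]: "\<And>n. (\<lambda>\<omega>. x \<omega> n) \<in> borel_measurable M"
    and m: "\<And>l. l < L \<Longrightarrow> (\<lambda>\<omega>. m \<omega> l) \<in> measurable M (count_space UNIV)"
begin

lemma bin_measurable: "l < L \<Longrightarrow> (\<lambda>\<omega>. real_of_int (m \<omega> l)) \<in> borel_measurable M"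
  by (rule measurable_compose[OF m]) auto

context
  fixes d :: "'a \<Rightarrow> nat \<Rightarrow> real" and a :: "'a \<Rightarrow> nat \<Rightarrow> complex" and p :: nat
  assumes d [measurable]: "\<And>l. (\<lambda>\<omega>. d \<omega> l) \<in> borel_measurable M"
    and a [measurable]: "\<And>l. (\<lambda>\<omega>. a \<omega> l) \<in> borel_measurable M" and p: "p < L"
begin

lemma leak_subtracted_measurable:
  "(\<lambda>\<omega>. leak_subtracted L N (x \<omega>) (m \<omega>) (d \<omega>) (a \<omega>) p s) \<in> borel_measurable M"
proof -
  note [measurable] = bin_measurable[OF p]
  have "(\<lambda>\<omega>. \<Sum>l\<in>{..<L} - {p}. a \<omega> l / of_nat N *
        ((1 + cis (2 * pi * (d \<omega> l - d \<omega> p))) /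
         (1 - cis (2 * pi / real N * (real_of_int (m \<omega> l - m \<omega> p) + d \<omega> l - d \<omega> p - s))))) \<in> borel_measurable M"
  proof (rule borel_measurable_sum)
    fix l assume "l \<in> {..<L} - {p}"
    then have [measurable]: "(\<lambda>\<omega>. real_of_int (m \<omega> l)) \<in> borel_measurable M" by (intro bin_measurable) auto
    show "(\<lambda>\<omega>. a \<omega> l / of_nat N *
        ((1 + cis (2 * pi * (d \<omega> l - d \<omega> p))) /
         (1 - cis (2 * pi / real N * (real_of_int (m \<omega> l - m \<omega> p) + d \<omega> l - d \<omega> p - s))))) \<in> borel_measurable M"
      unfolding of_int_diff by measurable
  qed
  moreover have "(\<lambda>\<omega>. dft_coeff N (x \<omega>) (m \<omega>) (d \<omega>) p s) \<in> borel_measurable M"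
    unfolding dft_coeff_def by measurable
  ultimately show ?thesis
    unfolding leak_subtracted_def by (rule borel_measurable_diff[rotated])
qed

lemma residual_update_measurable:
  "(\<lambda>\<omega>. residual_update L N (x \<omega>) (m \<omega>) (d \<omega>) (a \<omega>) p) \<in> borel_measurable M"
proof -
  note [measurable] = leak_subtracted_measurable
  show ?thesis unfolding residual_update_def Let_def by measurable
qed

lemma amplitude_update_measurable:
  "(\<lambda>\<omega>. amplitude_update L N (x \<omega>) (m \<omega>) (d \<omega>) (a \<omega>) p) \<in> borel_measurable M"
proof -
  note [measurable] = bin_measurable[OF p]
  have "(\<lambda>\<omega>. \<Sum>l\<in>{..<L} - {p}. a \<omega> l / of_nat N *
        ((1 - cis (2 * pi * real N * (freq_est N (m \<omega>) (d \<omega>) l - freq_est N (m \<omega>) (d \<omega>) p))) /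
         (1 - cis (2 * pi * (freq_est N (m \<omega>) (d \<omega>) l - freq_est N (m \<omega>) (d \<omega>) p))))) \<in> borel_measurable M"
  proof (rule borel_measurable_sum)
    fix l assume "l \<in> {..<L} - {p}"
    then have [measurable]: "(\<lambda>\<omega>. real_of_int (m \<omega> l)) \<in> borel_measurable M" by (intro bin_measurable) auto
    show "(\<lambda>\<omega>. a \<omega> l / of_nat N *
        ((1 - cis (2 * pi * real N * (freq_est N (m \<omega>) (d \<omega>) l - freq_est N (m \<omega>) (d \<omega>) p))) /
         (1 - cis (2 * pi * (freq_est N (m \<omega>) (d \<omega>) l - freq_est N (m \<omega>) (d \<omega>) p))))) \<in> borel_measurable M"
      unfolding freq_est_def by measurable
  qed
  moreover have "(\<lambda>\<omega>. 1 / of_nat N * (\<Sum>n<N. x \<omega> n * cis (- (2 * pi * freq_est N (m \<omega>) (d \<omega>) p * real n)))) \<in> borel_measurable M"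
    unfolding freq_est_def by measurable
  ultimately show ?thesis
    unfolding amplitude_update_def by (rule borel_measurable_diff[rotated])
qed

end

lemma partial_sweep_measurable:
  assumes "\<And>l. (\<lambda>\<omega>. fst (s \<omega>) l) \<in> borel_measurable M" "\<And>l. (\<lambda>\<omega>. snd (s \<omega>) l) \<in> borel_measurable M" "k \<le> L"
  shows "(\<lambda>\<omega>. fst (partial_sweep L N (x \<omega>) (m \<omega>) k (s \<omega>)) l) \<in> borel_measurable M
    \<and> (\<lambda>\<omega>. snd (partial_sweep L N (x \<omega>) (m \<omega>) k (s \<omega>)) l) \<in> borel_measurable M"
  using assms(3)
proof (induction k arbitrary: l)
  case 0
  then show ?case using assms by simp
next
  case (Suc k)
  then have k: "k < L" by simp
  define d where "d \<omega> = fst (partial_sweep L N (x \<omega>) (m \<omega>) k (s \<omega>))" for \<omega>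
  define a where "a \<omega> = snd (partial_sweep L N (x \<omega>) (m \<omega>) k (s \<omega>))" for \<omega>
  define d' where "d' \<omega> = (d \<omega>)(k := residual_update L N (x \<omega>) (m \<omega>) (d \<omega>) (a \<omega>) k)" for \<omega>
  have d: "(\<lambda>\<omega>. d \<omega> l) \<in> borel_measurable M" and a: "(\<lambda>\<omega>. a \<omega> l) \<in> borel_measurable M" for l
    using Suc.IH[of l] k by (auto simp: d_def a_def)
  have d': "(\<lambda>\<omega>. d' \<omega> l) \<in> borel_measurable M" for l
    using d residual_update_measurable[OF d a k] by (cases "l = k") (simp_all add: d'_def)
  have "(\<lambda>\<omega>. ((a \<omega>)(k := amplitude_update L N (x \<omega>) (m \<omega>) (d' \<omega>) (a \<omega>) k)) l) \<in> borel_measurable M"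
    using a amplitude_update_measurable[OF d' a k] by (cases "l = k") simp_all
  moreover have "partial_sweep L N (x \<omega>) (m \<omega>) (Suc k) (s \<omega>)
      = (d' \<omega>, (a \<omega>)(k := amplitude_update L N (x \<omega>) (m \<omega>) (d' \<omega>) (a \<omega>) k))" for \<omega>
    using component_step_eq[of L N "x \<omega>" "m \<omega>" k "d \<omega>" "a \<omega>"]
    by (simp add: partial_sweep_Suc d_def a_def d'_def)
  ultimately show ?case using d' by simp
qed

lemma residual_est_measurable: "(\<lambda>\<omega>. residual_est L N (x \<omega>) (m \<omega>) Q p) \<in> borel_measurable M"
proof -
  have "(\<lambda>\<omega>. fst ((sweep L N (x \<omega>) (m \<omega>) ^^ Q) (\<lambda>_. 0, \<lambda>_. 0)) l) \<in> borel_measurable M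
    \<and> (\<lambda>\<omega>. snd ((sweep L N (x \<omega>) (m \<omega>) ^^ Q) (\<lambda>_. 0, \<lambda>_. 0)) l) \<in> borel_measurable M" for l
  proof (induction Q arbitrary: l)
    case (Suc Q)
    then show ?case
      using partial_sweep_measurable[of "\<lambda>\<omega>. (sweep L N (x \<omega>) (m \<omega>) ^^ Q) (\<lambda>_. 0, \<lambda>_. 0)" L]
      by (simp add: sweep_eq)
  qed simp
  then show ?thesis by (simp add: residual_est_def)
qed

end

subsection \<open>Asymptotic mean and variance\<close>

lemma (in prob_space) square_integrable_imp_integrable_sq:
  fixes X :: "'a \<Rightarrow> real"
  assumes "X \<in> borel_measurable M" "integrable M (\<lambda>\<omega>. (X \<omega>)\<^sup>2)"
  shows "integrable M X" "(expectation X)\<^sup>2 \<le> expectation (\<lambda>\<omega>. (X \<omega>)\<^sup>2)"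
proof -
  show 1: "integrable M X" by (rule square_integrable_imp_integrable[OF assms])
  have "0 \<le> variance X" by (rule variance_positive)
  then show "(expectation X)\<^sup>2 \<le> expectation (\<lambda>\<omega>. (X \<omega>)\<^sup>2)"
    using variance_eq[OF 1 assms(2)] by simp
qed

text \<open>As the mean square distance to \<open>Z\<close> is \<open>o(1/N)\<close>, both moments
  carry over from \<open>Z\<close>: the mean because a squared mean is at most the mean square, the
  second moment by a weighted Young inequality.\<close>

lemma (in prob_space) asymptotic_variance:
  fixes Y Z :: "nat \<Rightarrow> 'a \<Rightarrow> real"
  assumes Y: "\<And>N. N > 0 \<Longrightarrow> Y N \<in> borel_measurable M" "\<And>N. N > 0 \<Longrightarrow> integrable M (\<lambda>\<omega>. (Y N \<omega>)\<^sup>2)"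
    and Z: "\<And>N. Z N \<in> borel_measurable M" "\<And>N. integrable M (\<lambda>\<omega>. (Z N \<omega>)\<^sup>2)" "\<And>N. expectation (Z N) = 0"
    and Z2: "\<forall>\<^sub>F N in sequentially. real N * expectation (\<lambda>\<omega>. (Z N \<omega>)\<^sup>2) = v"
    and R: "(\<lambda>N. real N * expectation (\<lambda>\<omega>. (Y N \<omega> - Z N \<omega>)\<^sup>2)) \<longlonglongrightarrow> 0"
  shows "(\<lambda>N. sqrt (real N) * expectation (Y N)) \<longlonglongrightarrow> 0"
    and "(\<lambda>N. real N * variance (Y N)) \<longlonglongrightarrow> v"
proof -
  define r where "r N = real N * expectation (\<lambda>\<omega>. (Y N \<omega> - Z N \<omega>)\<^sup>2)" for N
  have r: "r \<longlonglongrightarrow> 0" using R by (simp add: r_def[abs_def])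
  have r0: "0 \<le> r N" for N by (simp add: r_def)
  have sqrt_r: "(\<lambda>N. sqrt (r N)) \<longlonglongrightarrow> 0" using tendsto_real_sqrt[OF r] by simp
  have int_sq_diff: "integrable M (\<lambda>\<omega>. (Y N \<omega> - Z N \<omega>)\<^sup>2)" if "N > 0" for N
  proof (rule Bochner_Integration.integrable_bound)
    show "integrable M (\<lambda>\<omega>. 2 * (Y N \<omega>)\<^sup>2 + 2 * (Z N \<omega>)\<^sup>2)" using Y(2)[OF that] Z(2) by simp
    have "(y - z)\<^sup>2 \<le> 2 * y\<^sup>2 + 2 * z\<^sup>2" for y z :: real
      using zero_le_power2[of "y + z"] by (simp add: power2_eq_square algebra_simps)
    then show "AE \<omega> in M. norm ((Y N \<omega> - Z N \<omega>)\<^sup>2) \<le> norm (2 * (Y N \<omega>)\<^sup>2 + 2 * (Z N \<omega>)\<^sup>2)" by simp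
  qed (use Y(1)[OF that] Z(1)[of N] in measurable)
  have meas: "(\<lambda>\<omega>. Y N \<omega> - Z N \<omega>) \<in> borel_measurable M" if "N > 0" for N
    using Y(1)[OF that] Z(1)[of N] by measurable
  have EY: "expectation (Y N) = expectation (\<lambda>\<omega>. Y N \<omega> - Z N \<omega>)" if "N > 0" for N
    using square_integrable_imp_integrable_sq(1)[OF Y[OF that]]
      square_integrable_imp_integrable_sq(1)[OF Z(1,2)] Z(3)[of N] by (simp add: Bochner_Integration.integral_diff)
  have mean: "\<bar>sqrt (real N) * expectation (Y N)\<bar> \<le> sqrt (r N)" if "N > 0" for N
  proof -
    have "(expectation (Y N))\<^sup>2 \<le> expectation (\<lambda>\<omega>. (Y N \<omega> - Z N \<omega>)\<^sup>2)"
      unfolding EY[OF that] by (rule square_integrable_imp_integrable_sq(2)[OF meas[OF that] int_sq_diff[OF that]])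
    then have "(sqrt (real N) * expectation (Y N))\<^sup>2 \<le> r N"
      by (simp add: r_def power_mult_distrib mult_left_mono)
    then show ?thesis by (metis real_sqrt_abs real_sqrt_le_iff)
  qed
  show mean_lim: "(\<lambda>N. sqrt (real N) * expectation (Y N)) \<longlonglongrightarrow> 0"
    by (rule Lim_null_comparison[OF _ sqrt_r])
      (use mean in \<open>auto intro: eventually_mono[OF eventually_gt_at_top[of 0]]\<close>)
  \<comment> \<open>The weight in \<open>2 * z * q \<le> s * z\<^sup>2 + q\<^sup>2 / s\<close>. With
    the square root of the scaled remainder both terms vanish in the limit;
    \<open>1 / real N\<close> keeps the weight positive.\<close>
  define s where "s N = sqrt (r N) + 1 / real N" for N
  have s_lim: "s \<longlonglongrightarrow> 0"
    unfolding s_def[abs_def] using tendsto_add[OF sqrt_r lim_1_over_n] by simp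
  have second: "\<bar>real N * expectation (\<lambda>\<omega>. (Y N \<omega>)\<^sup>2) - real N * expectation (\<lambda>\<omega>. (Z N \<omega>)\<^sup>2)\<bar>
      \<le> s N * (real N * expectation (\<lambda>\<omega>. (Z N \<omega>)\<^sup>2)) + s N + r N" if N: "N > 0" for N
  proof -
    have s: "0 < s N" using N r0[of N] by (simp add: s_def add_nonneg_pos)
    have "\<bar>(Y N \<omega>)\<^sup>2 - (Z N \<omega>)\<^sup>2\<bar> \<le> s N * (Z N \<omega>)\<^sup>2 + (Y N \<omega> - Z N \<omega>)\<^sup>2 / s N + (Y N \<omega> - Z N \<omega>)\<^sup>2" for \<omega>
    proof -
      define z where "z = \<bar>Z N \<omega>\<bar>"
      define q where "q = \<bar>Y N \<omega> - Z N \<omega>\<bar>"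
      have "(Y N \<omega>)\<^sup>2 - (Z N \<omega>)\<^sup>2 = 2 * (Z N \<omega> * (Y N \<omega> - Z N \<omega>)) + (Y N \<omega> - Z N \<omega>)\<^sup>2"
        by (simp add: power2_eq_square algebra_simps)
      then have "\<bar>(Y N \<omega>)\<^sup>2 - (Z N \<omega>)\<^sup>2\<bar> \<le> 2 * (z * q) + q\<^sup>2"
        using abs_triangle_ineq[of "2 * (Z N \<omega> * (Y N \<omega> - Z N \<omega>))" "(Y N \<omega> - Z N \<omega>)\<^sup>2"]
        by (simp add: abs_mult z_def q_def)
      moreover have "2 * (z * q) \<le> s N * z\<^sup>2 + q\<^sup>2 / s N"
      proof -
        have "0 \<le> (s N * z - q)\<^sup>2 / s N" using s by simp
        also have "\<dots> = s N * z\<^sup>2 + q\<^sup>2 / s N - 2 * (z * q)"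
          using s by (simp add: power2_eq_square field_simps)
        finally show ?thesis by simp
      qed
      ultimately show ?thesis by (simp add: z_def q_def)
    qed
    then have "expectation (\<lambda>\<omega>. \<bar>(Y N \<omega>)\<^sup>2 - (Z N \<omega>)\<^sup>2\<bar>)
        \<le> expectation (\<lambda>\<omega>. s N * (Z N \<omega>)\<^sup>2 + (Y N \<omega> - Z N \<omega>)\<^sup>2 / s N + (Y N \<omega> - Z N \<omega>)\<^sup>2)"
      using Y(2)[OF N] Z(2)[of N] int_sq_diff[OF N] by (intro integral_mono) auto
    also have "\<dots> = s N * expectation (\<lambda>\<omega>. (Z N \<omega>)\<^sup>2) + expectation (\<lambda>\<omega>. (Y N \<omega> - Z N \<omega>)\<^sup>2) / s N
        + expectation (\<lambda>\<omega>. (Y N \<omega> - Z N \<omega>)\<^sup>2)"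
      using Z(2)[of N] int_sq_diff[OF N] by simp
    finally have "real N * expectation (\<lambda>\<omega>. \<bar>(Y N \<omega>)\<^sup>2 - (Z N \<omega>)\<^sup>2\<bar>)
        \<le> real N * (s N * expectation (\<lambda>\<omega>. (Z N \<omega>)\<^sup>2) + expectation (\<lambda>\<omega>. (Y N \<omega> - Z N \<omega>)\<^sup>2) / s N
        + expectation (\<lambda>\<omega>. (Y N \<omega> - Z N \<omega>)\<^sup>2))"
      by (intro mult_left_mono) auto
    also have "\<dots> = s N * (real N * expectation (\<lambda>\<omega>. (Z N \<omega>)\<^sup>2)) + r N / s N + r N"
      by (simp add: r_def algebra_simps)
    also have "r N / s N \<le> s N"
    proof -
      have "r N = (sqrt (r N))\<^sup>2" using r0 by simp
      also have "\<dots> \<le> (s N)\<^sup>2" using r0 N by (intro power_mono) (auto simp: s_def)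
      finally show ?thesis using s by (simp add: divide_le_eq power2_eq_square)
    qed
    finally have "real N * expectation (\<lambda>\<omega>. \<bar>(Y N \<omega>)\<^sup>2 - (Z N \<omega>)\<^sup>2\<bar>)
        \<le> s N * (real N * expectation (\<lambda>\<omega>. (Z N \<omega>)\<^sup>2)) + s N + r N" by simp
    moreover have "\<bar>real N * expectation (\<lambda>\<omega>. (Y N \<omega>)\<^sup>2) - real N * expectation (\<lambda>\<omega>. (Z N \<omega>)\<^sup>2)\<bar>
        \<le> real N * expectation (\<lambda>\<omega>. \<bar>(Y N \<omega>)\<^sup>2 - (Z N \<omega>)\<^sup>2\<bar>)"
    proof -
      have "real N * expectation (\<lambda>\<omega>. (Y N \<omega>)\<^sup>2) - real N * expectation (\<lambda>\<omega>. (Z N \<omega>)\<^sup>2)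
          = real N * expectation (\<lambda>\<omega>. (Y N \<omega>)\<^sup>2 - (Z N \<omega>)\<^sup>2)"
        using Y(2)[OF N] Z(2)[of N] by (simp add: Bochner_Integration.integral_diff right_diff_distrib)
      then show ?thesis by (simp add: abs_mult mult_left_mono integral_abs_bound)
    qed
    ultimately show ?thesis by linarith
  qed
  have "(\<lambda>N. real N * expectation (\<lambda>\<omega>. (Y N \<omega>)\<^sup>2) - v) \<longlonglongrightarrow> 0"
  proof (rule Lim_null_comparison)
    show "\<forall>\<^sub>F N in sequentially. norm (real N * expectation (\<lambda>\<omega>. (Y N \<omega>)\<^sup>2) - v) \<le> s N * v + s N + r N"
      using Z2 eventually_gt_at_top[of 0] by eventually_elim (use second in auto)
    have "(\<lambda>N. s N * v + s N + r N) \<longlonglongrightarrow> 0 * v + 0 + 0"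
      by (intro tendsto_intros s_lim r)
    then show "(\<lambda>N. s N * v + s N + r N) \<longlonglongrightarrow> 0" by simp
  qed
  then have lim2: "(\<lambda>N. real N * expectation (\<lambda>\<omega>. (Y N \<omega>)\<^sup>2)) \<longlonglongrightarrow> v" by (simp add: LIM_zero_iff)
  have "(\<lambda>N. real N * expectation (\<lambda>\<omega>. (Y N \<omega>)\<^sup>2) - (sqrt (real N) * expectation (Y N))\<^sup>2) \<longlonglongrightarrow> v - 0\<^sup>2"
    by (intro tendsto_intros lim2 mean_lim)
  moreover have "\<forall>\<^sub>F N in sequentially. real N * expectation (\<lambda>\<omega>. (Y N \<omega>)\<^sup>2) - (sqrt (real N) * expectation (Y N))\<^sup>2
      = real N * variance (Y N)"
    using eventually_gt_at_top[of 0]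
  proof eventually_elim
    case (elim N)
    then show ?case
      using variance_eq[OF square_integrable_imp_integrable_sq(1)[OF Y[OF elim]] Y(2)[OF elim]]
      by (simp add: power_mult_distrib right_diff_distrib)
  qed
  ultimately show "(\<lambda>N. real N * variance (Y N)) \<longlonglongrightarrow> v"
    by (simp add: filterlim_cong)
qed

subsection \<open>Asymptotics of the fixed point\<close>

definition log_rate :: "nat \<Rightarrow> real" where
  "log_rate N = sqrt (ln (real N) / real N)"

lemma log_rate_nonneg: "0 < N \<Longrightarrow> 0 \<le> log_rate N"
  by (simp add: log_rate_def)

lemma log_rate_sq: "0 < N \<Longrightarrow> (log_rate N)\<^sup>2 = ln (real N) / real N"
  by (simp add: log_rate_def)

lemma log_rate_tendsto_0: "log_rate \<longlonglongrightarrow> 0"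
proof -
  have "(\<lambda>N::nat. sqrt (ln (real N) / real N)) \<longlonglongrightarrow> 0" by real_asymp
  then show ?thesis by (simp add: log_rate_def[abs_def])
qed

lemma inverse_le_log_rate_sq:
  assumes "3 \<le> N"
  shows "1 / real N \<le> (log_rate N)\<^sup>2"
proof -
  have "exp 1 \<le> real N" using exp_le assms by linarith
  then have "1 \<le> ln (real N)" using assms by (simp add: ln_ge_iff)
  then show ?thesis using assms by (simp add: log_rate_sq divide_right_mono)
qed

lemma inverse_le_log_rate:
  assumes "3 \<le> N"
  shows "1 / real N \<le> log_rate N"
proof (rule power2_le_imp_le)
  have "(1 / real N)\<^sup>2 \<le> 1 / real N"
    using assms by (simp add: power2_eq_square divide_simps)
  then show "(1 / real N)\<^sup>2 \<le> (log_rate N)\<^sup>2" using inverse_le_log_rate_sq[OF assms] by linarith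
qed (use assms in \<open>simp add: log_rate_nonneg\<close>)

text \<open>By the double angle formula the oscillating sum is the kernel one bin away, which
  vanishes.\<close>

lemma sum_cos_squared:
  assumes "2 \<le> N"
  shows "(\<Sum>n<N. 4 * (cos (pi * real n / real N))\<^sup>2) = 2 * real N"
proof -
  have "sin (pi / real N) > 0" using assms by (intro sin_gt_zero) (auto simp: field_simps)
  then have "cis (2 * pi * 1 / real N) \<noteq> 1"
    using cis_minus_one_norm[of "2 * pi / real N"] by auto
  then have "dirichlet N 1 = 0" using assms by (subst dirichlet_eq) auto
  then have "(\<Sum>n<N. cis (2 * pi * real n / real N)) = 0" using assms by (simp add: dirichlet_def)
  then have "(\<Sum>n<N. cos (2 * pi * real n / real N)) = 0"
    by (metis (mono_tags, lifting) Re_sum cis.simps(1) sum.cong zero_complex.simps(1))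
  moreover have "4 * (cos (pi * real n / real N))\<^sup>2 = 2 + 2 * cos (2 * pi * real n / real N)" for n
    using cos_double_cos[of "pi * real n / real N"] by (simp add: mult.assoc)
  ultimately show ?thesis by (simp add: sum.distrib flip: sum_distrib_left)
qed

text \<open>Frequencies, bins and residuals vary with \<open>N\<close>; the amplitudes, \<sigma> and
  \<gamma> do not, so the constants below are uniform in \<open>N\<close> and in the
  outcome.\<close>

locale estimation = gaussian_noise M w \<sigma> for M :: "'a measure" and w \<sigma> +
  fixes L :: nat and A :: "nat \<Rightarrow> complex" and f :: "nat \<Rightarrow> nat \<Rightarrow> real"
    and m :: "nat \<Rightarrow> 'a \<Rightarrow> nat \<Rightarrow> int" and \<delta> :: "nat \<Rightarrow> 'a \<Rightarrow> nat \<Rightarrow> real"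
    and x :: "nat \<Rightarrow> 'a \<Rightarrow> nat \<Rightarrow> complex" and \<gamma> :: real
  assumes L_ge_2: "2 \<le> L"
    and A_nonzero: "\<And>l. l < L \<Longrightarrow> A l \<noteq> 0"
    and \<gamma>_pos: "0 < \<gamma>"
    and separated: "\<And>N p l. \<lbrakk>p < L; l < L; p \<noteq> l\<rbrakk> \<Longrightarrow> \<gamma> \<le> \<bar>f N l - f N p\<bar> \<and> \<bar>f N l - f N p\<bar> \<le> 1 - \<gamma>"
    and observed: "\<And>N \<omega> n. x N \<omega> n = observation L A (f N) w \<omega> n"
    and m_measurable: "\<And>N l. l < L \<Longrightarrow> (\<lambda>\<omega>. m N \<omega> l) \<in> measurable M (count_space UNIV)"
    and bins_correct: "\<And>N \<omega> l. \<lbrakk>N > 0; \<omega> \<in> space M; l < L\<rbrakk> \<Longrightarrow>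
      f N l = (real_of_int (m N \<omega> l) + \<delta> N \<omega> l) / real N \<and> \<delta> N \<omega> l \<in> {-1/2..1/2}"
begin

definition A_min :: real where "A_min = Min ((\<lambda>l. cmod (A l)) ` {..<L})"
definition A_max :: real where "A_max = Max ((\<lambda>l. cmod (A l)) ` {..<L})"

lemma A_min_pos: "0 < A_min"
proof -
  have "0 \<in> {..<L}" using L_ge_2 by simp
  then show ?thesis unfolding A_min_def using A_nonzero by (subst Min_gr_iff) (blast, blast, auto)
qed

lemma A_bounds: "l < L \<Longrightarrow> A_min \<le> cmod (A l)" "l < L \<Longrightarrow> cmod (A l) \<le> A_max"
  unfolding A_min_def A_max_def by auto

lemma A_max_pos: "0 < A_max"
  using A_bounds[of 0] A_min_pos L_ge_2 by linarith

lemma \<gamma>_le_half: "\<gamma> \<le> 1/2"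
  using separated[of 0 1 0] L_ge_2 by auto

text \<open>The numerator of \<open>leak_level\<close> with \<open>amp_bound\<close> unfolded, plus
  the noise factor. One constant serves for both because \<open>1/N\<close> is at most
  \<open>log_rate N\<close> from \<open>N = 3\<close> on.\<close>

definition perturb_const :: "nat \<Rightarrow> real" where
  "perturb_const k = real L * (A_max + 2 * (2 * A_max + 2) + 1) * leakage_const \<gamma>
     + 100 * (\<sigma> * sqrt (2 * (real k + 2)))"

abbreviation lipc :: real where "lipc \<equiv> 1360 / A_min + 33600 * (13 * A_max + 1) / A_min\<^sup>2"

lemma perturb_const_pos: "0 < perturb_const k"
  unfolding perturb_const_def using \<sigma>_pos A_max_pos leakage_const_pos[OF \<gamma>_pos]
  by (intro add_nonneg_pos) auto

lemma lipc_pos: "0 < lipc"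
  using A_min_pos A_max_pos by (simp add: add_pos_pos)

definition quiet :: "nat \<Rightarrow> nat \<Rightarrow> 'a set" where
  "quiet k N = space M - noisy k L (f N) N"

abbreviation (input) tones :: "nat \<Rightarrow> nat \<Rightarrow> 'a \<Rightarrow> bool" where
  "tones k N \<omega> \<equiv> multitone_small L N A (f N) (\<lambda>n. w n \<omega>) (x N \<omega>) (m N \<omega>) (\<delta> N \<omega>) A_min A_max \<gamma> (noise_level k N)"

abbreviation (input) pert :: "nat \<Rightarrow> nat \<Rightarrow> real" where
  "pert k N \<equiv> multitone.perturb L N A_max \<gamma> (noise_level k N)"

abbreviation (input) leak :: "nat \<Rightarrow> real" where
  "leak N \<equiv> multitone.leak_level L N A_max \<gamma>"

lemma bins_eq:
  assumes "N > 0" "\<omega> \<in> space M" "l < L"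
  shows "real N * f N l = real_of_int (m N \<omega> l) + \<delta> N \<omega> l" "\<bar>\<delta> N \<omega> l\<bar> \<le> 1/2"
  using bins_correct[OF assms] assms(1) by (auto simp: abs_le_iff)

lemma quiet_multitone:
  assumes "6 \<le> \<gamma> * real N" "\<omega> \<in> quiet k N"
  shows "multitone L N A (f N) (\<lambda>n. w n \<omega>) (x N \<omega>) (m N \<omega>) (\<delta> N \<omega>) A_min A_max \<gamma> (noise_level k N)"
proof -
  have N: "N > 0" using assms(1) by (cases N) auto
  have \<omega>: "\<omega> \<in> space M" using assms(2) by (simp add: quiet_def)
  show ?thesis
  proof
    show "x N \<omega> n = (\<Sum>l<L. A l * cis (2 * pi * f N l * real n)) + w n \<omega>" for n
      by (simp add: observed observation_def)
    show "partial_noise_bounded N (\<lambda>n. w n \<omega>) (f N l) (noise_level k N)" if "l < L" for l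
      using assms(2) that by (auto simp: quiet_def noisy_def)
  qed (use A_min_pos A_max_pos A_bounds \<gamma>_pos \<gamma>_le_half assms(1) separated bins_eq[OF N \<omega>] noise_level_nonneg[OF N] in auto)
qed

text \<open>The threshold on \<open>N\<close> does not depend on the outcome: the quantifier over
  quiet outcomes stands inside, as the moment estimates require.\<close>

lemma eventually_tones:
  "\<forall>\<^sub>F N in sequentially. \<forall>\<omega>\<in>quiet k N. tones k N \<omega> \<and>
     pert k N \<le> perturb_const k * log_rate N \<and> 0 \<le> pert k N \<and>
     leak N \<le> perturb_const k * (1 / real N) \<and>
     multitone.lip_const A_min A_max = lipc"
proof -
  have lim: "(\<lambda>N. perturb_const k * log_rate N) \<longlonglongrightarrow> 0"
    using tendsto_mult_right_zero[OF log_rate_tendsto_0] by simp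
  define X where "X = lipc * (1 + 7 * A_max) + 1"
  \<comment> \<open>The least of the three smallness thresholds of
    \<open>multitone_small\<close>.\<close>
  define c where "c = Min {A_min / 10000, 1/2, (1/2) / X}"
  have d: "0 < X"
    unfolding X_def using A_max_pos by (intro add_pos_pos mult_pos_pos[OF lipc_pos]) auto
  have c: "0 < c" using A_min_pos d by (simp add: c_def)
  have "\<forall>\<^sub>F N in sequentially. perturb_const k * log_rate N < c"
    using order_tendstoD(2)[OF lim c] .
  moreover have "\<forall>\<^sub>F N in sequentially. 6 / \<gamma> \<le> real N"
    by (rule eventually_compose_filterlim[OF eventually_ge_at_top filterlim_real_sequentially])
  ultimately show ?thesis
    using eventually_ge_at_top[of 3]
  proof eventually_elim
    case (elim N)
    show ?case
    proof
      fix \<omega> assume \<omega>: "\<omega> \<in> quiet k N"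
      have N6: "6 \<le> \<gamma> * real N" using elim(2) \<gamma>_pos by (simp add: field_simps)
      interpret mt: multitone L N A "f N" "\<lambda>n. w n \<omega>" "x N \<omega>" "m N \<omega>" "\<delta> N \<omega>" A_min A_max \<gamma> "noise_level k N"
        by (rule quiet_multitone[OF N6 \<omega>])
      define K where "K = real L * (A_max + 2 * (2 * A_max + 2) + 1) * leakage_const \<gamma>"
      have K: "0 \<le> K" using A_max_pos leakage_const_pos[OF \<gamma>_pos] by (simp add: K_def)
      have leak: "leak N = K * (1 / real N)"
        by (simp add: mt.leak_level_def mt.amp_bound_def K_def)
      have pc: "perturb_const k = K + 100 * (\<sigma> * sqrt (2 * (real k + 2)))"
        by (simp add: perturb_const_def K_def)
      have "pert k N = K * (1 / real N) + 100 * (\<sigma> * sqrt (2 * (real k + 2)) * log_rate N)"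
        unfolding mt.perturb_def leak by (simp add: noise_level_def log_rate_def)
      also have "\<dots> \<le> K * log_rate N + 100 * (\<sigma> * sqrt (2 * (real k + 2)) * log_rate N)"
        using inverse_le_log_rate[OF elim(3)] K by (intro add_right_mono mult_left_mono) auto
      also have "\<dots> = perturb_const k * log_rate N" by (simp add: pc algebra_simps)
      finally have pert: "pert k N \<le> perturb_const k * log_rate N" .
      have leak_le: "leak N \<le> perturb_const k * (1 / real N)"
        unfolding leak pc using \<sigma>_pos by (intro mult_right_mono) auto
      have lip: "mt.lip_const = lipc" by (simp add: mt.lip_const_def)
      have pc: "pert k N \<le> c" using pert elim(1) by linarith
      have "tones k N \<omega>"
      proof
        show "mt.perturb \<le> A_min / 10000" "mt.perturb \<le> 1/2" using pc by (auto simp: c_def)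
        have "X * mt.perturb \<le> X * ((1/2) / X)"
          using pc d by (intro mult_left_mono) (auto simp: c_def)
        also have "X * ((1/2) / X) = 1/2" using d by simp
        finally show "(mt.lip_const * (1 + 7 * A_max) + 1) * mt.perturb \<le> 1/2"
          unfolding lip X_def .
      qed
      then show "tones k N \<omega> \<and> pert k N \<le> perturb_const k * log_rate N \<and> 0 \<le> pert k N \<and>
          leak N \<le> perturb_const k * (1 / real N) \<and> multitone.lip_const A_min A_max = lipc"
        using pert leak_le mt.perturb_nonneg lip by blast
    qed
  qed
qed

lemma AE_eventually_tones:
  "AE \<omega> in M. \<forall>\<^sub>F N in sequentially. tones 1 N \<omega> \<and> pert 1 N \<le> perturb_const 1 * log_rate N \<and> 0 \<le> pert 1 N \<and>
     multitone.lip_const A_min A_max = lipc"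
  using eventually_quiet[of L f]
proof eventually_elim
  case (elim \<omega>)
  then show ?case
    using eventually_tones[of 1] by eventually_elim (auto simp: quiet_def)
qed

text \<open>The fixed point is found near \<delta>, which may lie on the boundary of the cube, so
  membership in the cube is not claimed for it; uniqueness speaks of the fixed points inside the
  cube.\<close>

lemma fixed_point_limit:
  "AE \<omega> in M. \<exists>\<nu> :: nat \<Rightarrow> nat \<Rightarrow> real.
        (\<forall>\<^sub>F N in sequentially.
           is_fixed_point L N (x N \<omega>) (m N \<omega>) (\<nu> N) \<and>
           (\<forall>\<mu>\<in>residual_cube L. is_fixed_point L N (x N \<omega>) (m N \<omega>) \<mu> \<longrightarrow>
              (\<forall>l<L. \<mu> l = \<nu> N l)) \<and>
           (\<forall>l<L. (\<lambda>Q. residual_est L N (x N \<omega>) (m N \<omega>) Q l) \<longlonglongrightarrow> \<nu> N l)) \<and>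
        (\<forall>l<L. (\<lambda>N. \<nu> N l - \<delta> N \<omega> l) \<longlonglongrightarrow> 0)"
  using AE_eventually_tones
proof eventually_elim
  case (elim \<omega>)
  note ev = elim
  define c where "c = 840 / A_min * perturb_const 1"
  define P where "P N d \<longleftrightarrow> is_fixed_point L N (x N \<omega>) (m N \<omega>) d \<and>
           (\<forall>\<mu>\<in>residual_cube L. is_fixed_point L N (x N \<omega>) (m N \<omega>) \<mu> \<longrightarrow> (\<forall>l<L. \<mu> l = d l)) \<and>
           (\<forall>l<L. (\<lambda>Q. residual_est L N (x N \<omega>) (m N \<omega>) Q l) \<longlonglongrightarrow> d l) \<and>
           (\<forall>l<L. \<bar>d l - \<delta> N \<omega> l\<bar> \<le> c * log_rate N)" for N d
  have "\<forall>\<^sub>F N in sequentially. \<exists>d. P N d"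
    using ev
  proof eventually_elim
    case (elim N)
    then interpret mt: multitone_small L N A "f N" "\<lambda>n. w n \<omega>" "x N \<omega>" "m N \<omega>" "\<delta> N \<omega>" A_min A_max \<gamma> "noise_level 1 N"
      by blast
    obtain d a where st: "mt.is_stationary d a" using mt.stationary_exists by blast
    have "\<mu> l = d l" if "\<mu> \<in> residual_cube L" "is_fixed_point L N (x N \<omega>) (m N \<omega>) \<mu>" "l < L" for \<mu> l
      using mt.stationary_unique(1)[OF _ st that(3)] mt.fixed_point_iff_stationary[OF mt.residual_cube_offset[OF that(1)]] that(2)
      by blast
    moreover have "\<bar>d l - \<delta> N \<omega> l\<bar> \<le> c * log_rate N" if "l < L" for l
    proof -
      have "\<bar>d l - \<delta> N \<omega> l\<bar> \<le> 840 / A_min * mt.perturb" by (rule mt.stationary_error[OF st that])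
      also have "\<dots> \<le> 840 / A_min * (perturb_const 1 * log_rate N)"
        using elim A_min_pos by (intro mult_left_mono) auto
      finally show ?thesis by (simp add: c_def)
    qed
    ultimately have "P N d"
      unfolding P_def using mt.stationary_imp_fixed_point[OF st] mt.residual_est_convergence[OF st] by blast
    then show ?case by blast
  qed
  \<comment> \<open>One fixed point is selected for each \<open>N\<close> to obtain a sequence; for
    small \<open>N\<close> the value is arbitrary.\<close>
  then have ev': "\<forall>\<^sub>F N in sequentially. P N (SOME d. P N d)"
    by (rule eventually_mono) (metis someI_ex)
  define \<nu> where "\<nu> N = (SOME d. P N d)" for N
  have P: "\<forall>\<^sub>F N in sequentially. P N (\<nu> N)" using ev' by (simp add: \<nu>_def)
  have "(\<lambda>N. \<nu> N l - \<delta> N \<omega> l) \<longlonglongrightarrow> 0" if "l < L" for l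
  proof (rule Lim_null_comparison)
    show "\<forall>\<^sub>F N in sequentially. norm (\<nu> N l - \<delta> N \<omega> l) \<le> c * log_rate N"
      using P by eventually_elim (use that in \<open>simp add: P_def\<close>)
    show "(\<lambda>N. c * log_rate N) \<longlonglongrightarrow> 0" by (rule tendsto_mult_right_zero[OF log_rate_tendsto_0])
  qed
  moreover have "\<forall>\<^sub>F N in sequentially.
           is_fixed_point L N (x N \<omega>) (m N \<omega>) (\<nu> N) \<and>
           (\<forall>\<mu>\<in>residual_cube L. is_fixed_point L N (x N \<omega>) (m N \<omega>) \<mu> \<longrightarrow> (\<forall>l<L. \<mu> l = \<nu> N l)) \<and>
           (\<forall>l<L. (\<lambda>Q. residual_est L N (x N \<omega>) (m N \<omega>) Q l) \<longlonglongrightarrow> \<nu> N l)"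
    using P by eventually_elim (simp add: P_def)
  ultimately show ?case
    by blast
qed

text \<open>Each entry of the maximum dominates \<open>log_rate N\<close>, and two components
  provide an entry. Since leakage of order \<open>1/N\<close> is itself below a multiple of
  \<open>log_rate N\<close>, comparison with this term suffices.\<close>

lemma log_rate_le_rate_bound: "log_rate N \<le> rate_bound L A (f N) N"
proof -
  let ?S = "{max (sqrt (leakage_Gamma A (f N) N l p)) (sqrt (ln (real N) / real N)) | l p.
          l < L \<and> p < L \<and> l \<noteq> p}"
  have "?S \<subseteq> (\<lambda>(l, p). max (sqrt (leakage_Gamma A (f N) N l p)) (sqrt (ln (real N) / real N))) ` ({..<L} \<times> {..<L})"
    by auto
  then have fin: "finite ?S" by (rule finite_subset) auto
  have "max (sqrt (leakage_Gamma A (f N) N 0 1)) (sqrt (ln (real N) / real N)) \<in> ?S"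
    using L_ge_2 by force
  from Max_ge[OF fin this] show ?thesis
    by (simp add: rate_bound_def log_rate_def)
qed

lemma convergence_rate_bound:
  "\<exists>C>0. AE \<omega> in M. \<forall>\<^sub>F N in sequentially.
     convergence_rate L N (x N \<omega>) (m N \<omega>) \<le> ereal (sqrt (real L) * (C * rate_bound L A (f N) N))"
proof (intro exI conjI)
  define C where "C = lipc * (14 * A_max + 1) * perturb_const 1"
  show "0 < C"
    unfolding C_def using lipc_pos A_max_pos perturb_const_pos by (intro mult_pos_pos) auto
  show "AE \<omega> in M. \<forall>\<^sub>F N in sequentially.
     convergence_rate L N (x N \<omega>) (m N \<omega>) \<le> ereal (sqrt (real L) * (C * rate_bound L A (f N) N))"
    using AE_eventually_tones
  proof eventually_elim
    case (elim \<omega>)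
    then show ?case
    proof eventually_elim
      case (elim N)
      then interpret mt: multitone_small L N A "f N" "\<lambda>n. w n \<omega>" "x N \<omega>" "m N \<omega>" "\<delta> N \<omega>" A_min A_max \<gamma> "noise_level 1 N"
        by blast
      have "lipc * (14 * A_max + 1) * mt.perturb \<le> lipc * (14 * A_max + 1) * (perturb_const 1 * rate_bound L A (f N) N)"
      proof (intro mult_left_mono)
        have "mt.perturb \<le> perturb_const 1 * log_rate N" using elim by blast
        also have "\<dots> \<le> perturb_const 1 * rate_bound L A (f N) N"
          using log_rate_le_rate_bound perturb_const_pos[of 1] by (intro mult_left_mono) auto
        finally show "mt.perturb \<le> perturb_const 1 * rate_bound L A (f N) N" .
        show "0 \<le> lipc * (14 * A_max + 1)" using lipc_pos A_max_pos by (intro mult_nonneg_nonneg) auto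
      qed
      then have "sqrt (real L) * (lipc * (14 * A_max + 1) * mt.perturb) \<le> sqrt (real L) * (C * rate_bound L A (f N) N)"
        unfolding C_def by (intro mult_left_mono) (auto simp: mult.assoc)
      moreover have "mt.lip_const = lipc" using elim by blast
      ultimately show ?case
        using mt.convergence_rate_le by (metis (no_types, lifting) ereal_less_eq(3) order_trans)
    qed
  qed
qed

text \<open>Rounding costs at most 1/2, so once \<open>1 \<le> \<gamma> * real N\<close> the nearest
  integer has modulus at least \<open>\<gamma> * real N / 2\<close>.\<close>

lemma leakage_Gamma_bigo:
  assumes "l < L" "p < L" "l \<noteq> p"
  shows "(\<lambda>N. leakage_Gamma A (f N) N l p) \<in> O(\<lambda>N. (cmod (A l))\<^sup>2 * (1 / (real N)\<^sup>2))"
proof (rule bigoI)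
  have "\<forall>\<^sub>F N in sequentially. 1 / \<gamma> \<le> real N"
    by (rule eventually_compose_filterlim[OF eventually_ge_at_top filterlim_real_sequentially])
  then show "\<forall>\<^sub>F N in sequentially. norm (leakage_Gamma A (f N) N l p)
      \<le> (4 / \<gamma>\<^sup>2) * norm ((cmod (A l))\<^sup>2 * (1 / (real N)\<^sup>2))"
    using eventually_gt_at_top[of 0]
  proof eventually_elim
    case (elim N)
    define r where "r = real_of_int (round (real N * (f N l - f N p)))"
    have N1: "1 \<le> \<gamma> * real N" using elim(1) \<gamma>_pos by (simp add: field_simps)
    have "\<bar>r - real N * (f N l - f N p)\<bar> \<le> 1/2"
      unfolding r_def using of_int_round_abs_le by blast
    moreover have "\<gamma> * real N \<le> \<bar>real N * (f N l - f N p)\<bar>"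
      using mult_left_mono[of \<gamma> "\<bar>f N l - f N p\<bar>" "real N"] separated[of p l N] assms
      by (simp add: abs_mult mult.commute)
    ultimately have "\<gamma> * real N / 2 \<le> \<bar>r\<bar>" using N1 by linarith
    then have "(\<gamma> * real N / 2)\<^sup>2 \<le> \<bar>r\<bar>\<^sup>2" using N1 by (intro power_mono) auto
    then have "(cmod (A l))\<^sup>2 / r\<^sup>2 \<le> (cmod (A l))\<^sup>2 / (\<gamma> * real N / 2)\<^sup>2"
      using \<gamma>_pos elim(2) by (intro divide_left_mono mult_pos_pos) (auto intro: less_le_trans[rotated])
    also have "\<dots> = (4 / \<gamma>\<^sup>2) * ((cmod (A l))\<^sup>2 * (1 / (real N)\<^sup>2))"
      by (simp add: power_mult_distrib power_divide)
    finally show ?case by (simp add: leakage_Gamma_def r_def)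
  qed
qed

end

subsection \<open>Distribution of the estimates\<close>

context estimation
begin

text \<open>The weights with which the noise samples enter the first-order estimation error.\<close>

definition error_weight :: "nat \<Rightarrow> nat \<Rightarrow> nat \<Rightarrow> complex" where
  "error_weight p N n = \<i> * of_real (pi / 8) / (A p * of_nat N) * (cis (- (2 * pi * f N p * real n))
     * (cis (- (2 * pi * (1/2) * real n / real N)) + cis (- (2 * pi * (-1/2) * real n / real N))))"

text \<open>The two half-bin phases add up to \<open>2 * cos (pi * n / N)\<close>, whose squares sum
  to \<open>2 * N\<close>. Multiplied by \<open>\<sigma>\<^sup>2 / 2\<close>, the variance of a real
  or imaginary noise sample, the energy gives the variance
  \<open>pi\<^sup>2 / (64 * \<rho> * N)\<close>, with \<rho> the SNR.\<close>

lemma error_weight_energy: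
  assumes "2 \<le> N"
  shows "energy N (error_weight p N) = pi\<^sup>2 / (32 * (cmod (A p))\<^sup>2 * real N)"
proof -
  have "(cmod (error_weight p N n))\<^sup>2 = pi\<^sup>2 / (64 * (cmod (A p))\<^sup>2 * (real N)\<^sup>2) * (4 * (cos (pi * real n / real N))\<^sup>2)" for n
  proof -
    have "cis (- (2 * pi * (1/2) * real n / real N)) + cis (- (2 * pi * (-1/2) * real n / real N))
        = of_real (2 * cos (pi * real n / real N))"
      by (simp add: complex_eq_iff)
    then have "cmod (error_weight p N n) = pi / 8 / (cmod (A p) * real N) * \<bar>2 * cos (pi * real n / real N)\<bar>"
      unfolding error_weight_def by (simp only: norm_mult norm_divide norm_cis norm_of_real norm_ii norm_of_nat) simp
    then show ?thesis by (simp add: power_mult_distrib power_divide)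
  qed
  then have "energy N (error_weight p N)
      = pi\<^sup>2 / (64 * (cmod (A p))\<^sup>2 * (real N)\<^sup>2) * (\<Sum>n<N. 4 * (cos (pi * real n / real N))\<^sup>2)"
    unfolding energy_def sum_distrib_left by simp
  also have "\<dots> = pi\<^sup>2 / (64 * (cmod (A p))\<^sup>2 * (real N)\<^sup>2) * (2 * real N)"
    by (simp only: sum_cos_squared[OF assms])
  also have "\<dots> = pi\<^sup>2 / (32 * (cmod (A p))\<^sup>2 * real N)"
    using assms by (simp add: power2_eq_square)
  finally show ?thesis .
qed

text \<open>The factor \<i> in the weights is there because
  \<open>Re (\<i> * S) = - Im S\<close>.\<close>

lemma lin_error_weight:
  "lin N (error_weight p N) \<omega> = - (pi / 8) * Im ((noise_coeff N (\<lambda>n. w n \<omega>) (f N p) (1/2)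
     + noise_coeff N (\<lambda>n. w n \<omega>) (f N p) (-1/2)) / A p)"
proof -
  define S where "S = (noise_coeff N (\<lambda>n. w n \<omega>) (f N p) (1/2) + noise_coeff N (\<lambda>n. w n \<omega>) (f N p) (-1/2)) / A p"
  have "S = 1 / (A p * of_nat N) * (\<Sum>n<N. w n \<omega> * cis (- (2 * pi * f N p * real n))
      * (cis (- (2 * pi * (1/2) * real n / real N)) + cis (- (2 * pi * (-1/2) * real n / real N))))"
    by (simp add: S_def noise_coeff_def ring_distribs sum.distrib add_divide_distrib mult.assoc mult.commute[of "A p"])
  then have "(\<Sum>n<N. error_weight p N n * w n \<omega>) = \<i> * of_real (pi / 8) * S"
    unfolding error_weight_def by (simp add: sum_distrib_left sum_divide_distrib mult_ac)
  then show ?thesis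
    unfolding lin_def S_def[symmetric] by (simp only:) simp
qed

lemma x_measurable: "(\<lambda>\<omega>. x N \<omega> n) \<in> borel_measurable M"
  unfolding observed observation_def by measurable

text \<open>The frequency error in bins, written with the bin and the frequency instead of \<delta>,
  so that its measurability follows from that of the bins.\<close>

definition offset_error :: "(nat \<Rightarrow> nat) \<Rightarrow> nat \<Rightarrow> nat \<Rightarrow> 'a \<Rightarrow> real" where
  "offset_error Q p N \<omega> = residual_est L N (x N \<omega>) (m N \<omega>) (Q N) p + real_of_int (m N \<omega> p) - real N * f N p"

lemma offset_error_eq:
  assumes "N > 0" "\<omega> \<in> space M" "p < L"
  shows "offset_error Q p N \<omega> = residual_est L N (x N \<omega>) (m N \<omega>) (Q N) p - \<delta> N \<omega> p"
  using bins_eq(1)[OF assms] by (simp add: offset_error_def)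

lemma offset_error_measurable:
  assumes "p < L"
  shows "offset_error Q p N \<in> borel_measurable M"
proof -
  note [measurable] = residual_est_measurable[of "x N" M L "m N" N "Q N" p, OF x_measurable m_measurable]
    bin_measurable[of "x N" M L "m N" p, OF x_measurable m_measurable assms]
  show ?thesis unfolding offset_error_def[abs_def] by measurable
qed

definition error_bound :: "(nat \<Rightarrow> nat) \<Rightarrow> nat \<Rightarrow> real" where
  "error_bound Q N = real (Q N) * (real N * angle_bound) + 1/2"

lemma offset_error_bound:
  assumes "N > 0" "\<omega> \<in> space M" "p < L"
  shows "\<bar>offset_error Q p N \<omega>\<bar> \<le> error_bound Q N"
  using residual_est_bound[OF assms(3), of N "x N \<omega>" "m N \<omega>" "Q N"] bins_eq(2)[OF assms]
  unfolding offset_error_eq[OF assms] error_bound_def by linarith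

lemma offset_error_integrable:
  assumes "N > 0" "p < L"
  shows "integrable M (offset_error Q p N)" "integrable M (\<lambda>\<omega>. (offset_error Q p N \<omega>)\<^sup>2)"
proof -
  note [measurable] = offset_error_measurable[OF assms(2), of Q N]
  show "integrable M (offset_error Q p N)"
    by (rule integrable_const_bound[where B = "error_bound Q N"])
      (use offset_error_bound[OF assms(1) _ assms(2)] in auto)
  have "(offset_error Q p N \<omega>)\<^sup>2 \<le> (error_bound Q N)\<^sup>2" if "\<omega> \<in> space M" for \<omega>
    using power_mono[OF offset_error_bound[OF assms(1) that assms(2), of Q], of 2] by simp
  then show "integrable M (\<lambda>\<omega>. (offset_error Q p N \<omega>)\<^sup>2)"
    by (intro integrable_const_bound[where B = "(error_bound Q N)\<^sup>2"]) auto
qed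

lemma final_freq_est_eq:
  "N > 0 \<Longrightarrow> final_freq_est L N (x N \<omega>) (m N \<omega>) (Q N) p = f N p + offset_error Q p N \<omega> / real N"
  by (simp add: final_freq_est_def freq_est_def offset_error_def field_simps)

text \<open>Leakage, \<open>1/N\<close> and the square of \<open>perturb\<close> are all of order
  \<open>ln N / N\<close>, smaller than the standard deviation of the linear term, which is of order
  \<open>1 / sqrt N\<close>.\<close>

lemma quiet_error:
  assumes p: "p < L" and Q: "\<And>N. 2 \<le> Q N"
  shows "\<exists>K. \<forall>\<^sub>F N in sequentially. \<forall>\<omega>\<in>quiet k N.
    \<bar>offset_error Q p N \<omega> - lin N (error_weight p N) \<omega>\<bar> \<le> K * (log_rate N)\<^sup>2"
proof -
  define c where "c = 4080 / A_min + 1600 * (20 * A_max + 2) / A_min\<^sup>2 + (840 / A_min)\<^sup>2"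
  define g where "g = 840 / A_min + 1"
  have c: "0 \<le> c" and g: "0 \<le> g" using A_min_pos A_max_pos by (simp_all add: c_def g_def)
  define K where "K = c * (perturb_const k + 1 + g * (perturb_const k)\<^sup>2)"
  show ?thesis
  proof (rule exI[of _ K])
    show "\<forall>\<^sub>F N in sequentially. \<forall>\<omega>\<in>quiet k N. \<bar>offset_error Q p N \<omega> - lin N (error_weight p N) \<omega>\<bar> \<le> K * (log_rate N)\<^sup>2"
      using eventually_tones[of k] eventually_ge_at_top[of 3]
    proof eventually_elim
      case (elim N)
      show ?case
      proof
        fix \<omega> assume \<omega>: "\<omega> \<in> quiet k N"
        then have space: "\<omega> \<in> space M" by (simp add: quiet_def)
        interpret mt: multitone_small L N A "f N" "\<lambda>n. w n \<omega>" "x N \<omega>" "m N \<omega>" "\<delta> N \<omega>" A_min A_max \<gamma> "noise_level k N"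
          using elim(1) \<omega> by blast
        have le: "mt.perturb \<le> perturb_const k * log_rate N" "mt.leak_level \<le> perturb_const k * (1 / real N)"
          using elim(1) \<omega> by blast+
        have "\<bar>offset_error Q p N \<omega> - lin N (error_weight p N) \<omega>\<bar>
            \<le> mt.lin_const * (mt.leak_level + 1 / real N + g * mt.perturb\<^sup>2)"
          using mt.residual_est_linear[of "Q N" p] Q p elim(2)
          unfolding offset_error_eq[OF _ space p] lin_error_weight mt.linear_error_def g_def
          by (subst offset_error_eq[OF _ space p]) auto
        also have "mt.lin_const = c" by (simp add: mt.lin_const_def c_def)
        also have "c * (mt.leak_level + 1 / real N + g * mt.perturb\<^sup>2)
            \<le> c * (perturb_const k * (log_rate N)\<^sup>2 + (log_rate N)\<^sup>2 + g * (perturb_const k * log_rate N)\<^sup>2)"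
        proof (intro mult_left_mono add_mono c)
          have "perturb_const k * (1 / real N) \<le> perturb_const k * (log_rate N)\<^sup>2"
            using inverse_le_log_rate_sq[OF elim(2)] perturb_const_pos[of k] by (intro mult_left_mono) auto
          then show "mt.leak_level \<le> perturb_const k * (log_rate N)\<^sup>2" using le(2) by linarith
          show "1 / real N \<le> (log_rate N)\<^sup>2" by (rule inverse_le_log_rate_sq[OF elim(2)])
          show "mt.perturb\<^sup>2 \<le> (perturb_const k * log_rate N)\<^sup>2"
            by (rule power_mono[OF le(1) mt.perturb_nonneg])
        qed (rule g)
        also have "\<dots> = K * (log_rate N)\<^sup>2"
          by (simp add: K_def power_mult_distrib algebra_simps)
        finally show "\<bar>offset_error Q p N \<omega> - lin N (error_weight p N) \<omega>\<bar> \<le> K * (log_rate N)\<^sup>2" .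
      qed
    qed
  qed
qed

lemma remainder_tendsto_0:
  assumes p: "p < L" and Q: "\<And>N. 2 \<le> Q N" and poly: "(\<lambda>N. real (Q N)) \<in> O(\<lambda>N. real N ^ K)"
  shows "(\<lambda>N. real N * expectation (\<lambda>\<omega>. (offset_error Q p N \<omega> - lin N (error_weight p N) \<omega>)\<^sup>2)) \<longlonglongrightarrow> 0"
proof -
  \<comment> \<open>The squared crude bound grows like \<open>N^(2*K+2)\<close>; with this
    \<open>k\<close> the exceptional event has probability of order \<open>1 / N^(2*K+4)\<close>,
    which leaves \<open>1/N\<close> after the final multiplication by \<open>N\<close>.\<close>
  define k where "k = 2 * K + 3"
  let ?Z = "\<lambda>N. lin N (error_weight p N)"
  obtain C where C: "\<forall>\<^sub>F N in sequentially. \<forall>\<omega>\<in>quiet k N. \<bar>offset_error Q p N \<omega> - ?Z N \<omega>\<bar> \<le> C * (log_rate N)\<^sup>2"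
    using quiet_error[where Q = Q, OF p Q] by blast
  obtain c where c: "0 < c" "\<forall>\<^sub>F N in sequentially. norm (real (Q N)) \<le> c * norm (real N ^ K)"
    using landau_o.bigE[OF poly] by blast
  define D where "D = 2 * (c * angle_bound + 1)\<^sup>2 + 2"
  define E where "E = 48 * (\<sigma>\<^sup>2 * (pi\<^sup>2 / (32 * (cmod (A p))\<^sup>2)))\<^sup>2"
  have angle: "0 \<le> angle_bound" using abs_Im_Ln_le[of 1] by simp
  have Ap: "A p \<noteq> 0" by (rule A_nonzero[OF p])
  have "\<forall>\<^sub>F N in sequentially. norm (real N * expectation (\<lambda>\<omega>. (offset_error Q p N \<omega> - ?Z N \<omega>)\<^sup>2))
      \<le> C\<^sup>2 * (ln (real N))\<^sup>2 / real N + 8 * real L * D / real N + E / real N"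
    using C c(2) eventually_ge_at_top[of 3]
  proof eventually_elim
    case (elim N)
    then have N: "N > 0" "2 \<le> N" "1 \<le> real N" by auto
    let ?r = "C * (log_rate N)\<^sup>2"
    let ?B = "error_bound Q N"
    define V where "V = pi\<^sup>2 / (32 * (cmod (A p))\<^sup>2 * real N)"
    have V: "energy N (error_weight p N) \<le> V" "0 < V"
      using error_weight_energy[OF N(2), of p] Ap N by (simp_all add: V_def)
    note Z4 = lin_fourth_moment[OF V]
    have B: "2 * ?B\<^sup>2 + 2 \<le> D * real N ^ (2 * K + 2)"
    proof -
      have "?B \<le> (c * real N ^ K) * (real N * angle_bound) + 1"
        using elim(2) angle unfolding error_bound_def by (intro add_mono mult_right_mono) auto
      also have "\<dots> \<le> (c * real N ^ K) * (real N * angle_bound) + real N ^ (K + 1)"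
        using one_le_power[OF N(3), of "K + 1"] by simp
      also have "\<dots> = (c * angle_bound + 1) * real N ^ (K + 1)" by (simp add: algebra_simps)
      finally have "?B\<^sup>2 \<le> ((c * angle_bound + 1) * real N ^ (K + 1))\<^sup>2"
        using angle by (intro power_mono) (auto simp: error_bound_def)
      also have "\<dots> = (c * angle_bound + 1)\<^sup>2 * real N ^ (2 * K + 2)"
      proof -
        have "(K + 1) * 2 = 2 * K + 2" by simp
        then show ?thesis by (simp only: power_mult_distrib power_mult[symmetric])
      qed
      finally have "2 * ?B\<^sup>2 + 2 \<le> 2 * ((c * angle_bound + 1)\<^sup>2 * real N ^ (2 * K + 2)) + 2 * real N ^ (2 * K + 2)"
        using one_le_power[OF N(3), of "2 * K + 2"] by (intro add_mono) auto
      then show ?thesis by (simp add: D_def algebra_simps)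
    qed
    \<comment> \<open>On the exceptional event \<open>Z\<^sup>2 \<le> 1 + Z^4\<close>: the 1 joins
      the indicator, and the fourth moment, of order \<open>1/N\<^sup>2\<close>, may be kept on the
      whole space. The second moment could not be, as it is of order \<open>1/N\<close>.\<close>
    have point: "(offset_error Q p N \<omega> - ?Z N \<omega>)\<^sup>2
        \<le> ?r\<^sup>2 + (2 * ?B\<^sup>2 + 2) * indicator (noisy k L (f N) N) \<omega> + 2 * (?Z N \<omega>) ^ 4" if \<omega>: "\<omega> \<in> space M" for \<omega>
    proof (cases "\<omega> \<in> noisy k L (f N) N")
      case True
      have "(offset_error Q p N \<omega> - ?Z N \<omega>)\<^sup>2 \<le> 2 * (offset_error Q p N \<omega>)\<^sup>2 + 2 * (?Z N \<omega>)\<^sup>2"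
        using zero_le_power2[of "offset_error Q p N \<omega> + ?Z N \<omega>"] by (simp add: power2_eq_square algebra_simps)
      moreover have "(offset_error Q p N \<omega>)\<^sup>2 \<le> ?B\<^sup>2"
        using power_mono[OF offset_error_bound[OF N(1) \<omega> p, of Q], of 2] by simp
      moreover have "(?Z N \<omega>)\<^sup>2 \<le> 1 + (?Z N \<omega>) ^ 4"
      proof -
        have "0 \<le> ((?Z N \<omega>)\<^sup>2 - 1)\<^sup>2" by simp
        also have "\<dots> = (?Z N \<omega>) ^ 4 - 2 * (?Z N \<omega>)\<^sup>2 + 1"
          by (simp add: power2_diff flip: power_mult)
        finally show ?thesis using zero_le_power2[of "?Z N \<omega>"] by linarith
      qed
      moreover have "0 \<le> ?r\<^sup>2" by simp
      moreover have ind: "indicator (noisy k L (f N) N) \<omega> = (1 :: real)" using True by simp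
      ultimately show ?thesis unfolding ind mult_1_right by linarith
    next
      case False
      then have "\<bar>offset_error Q p N \<omega> - ?Z N \<omega>\<bar> \<le> ?r"
        using elim(1) \<omega> by (auto simp: quiet_def)
      from power_mono[OF this, of 2] have "(offset_error Q p N \<omega> - ?Z N \<omega>)\<^sup>2 \<le> ?r\<^sup>2" by simp
      moreover have "0 \<le> (?Z N \<omega>) ^ 4" by (rule zero_le_even_power) simp
      moreover have ind: "indicator (noisy k L (f N) N) \<omega> = (0 :: real)" using False by simp
      ultimately show ?thesis unfolding ind mult_zero_right by linarith
    qed
    have int_ind: "integrable M (\<lambda>\<omega>. (2 * ?B\<^sup>2 + 2) * indicator (noisy k L (f N) N) \<omega> :: real)"
      by (intro integrable_mult_right integrable_real_indicator noisy_sets) (simp add: emeasure_eq_measure)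
    have int_rhs: "integrable M (\<lambda>\<omega>. ?r\<^sup>2 + (2 * ?B\<^sup>2 + 2) * indicator (noisy k L (f N) N) \<omega> + 2 * (?Z N \<omega>) ^ 4)"
      by (intro Bochner_Integration.integrable_add int_ind integrable_mult_right Z4(1) integrable_const)
    have "expectation (\<lambda>\<omega>. (offset_error Q p N \<omega> - ?Z N \<omega>)\<^sup>2)
        \<le> expectation (\<lambda>\<omega>. ?r\<^sup>2 + (2 * ?B\<^sup>2 + 2) * indicator (noisy k L (f N) N) \<omega> + 2 * (?Z N \<omega>) ^ 4)"
      by (intro integral_mono' int_rhs point) simp_all
    also have "\<dots> = ?r\<^sup>2 + (2 * ?B\<^sup>2 + 2) * prob (noisy k L (f N) N) + 2 * expectation (\<lambda>\<omega>. (?Z N \<omega>) ^ 4)"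
      using int_ind Z4(1) by (simp add: prob_space)
    also have "\<dots> \<le> ?r\<^sup>2 + (D * real N ^ (2 * K + 2)) * (8 * real L / real N ^ (k + 1)) + 2 * (24 * (\<sigma>\<^sup>2 * V)\<^sup>2)"
      using B noisy_prob[OF N(1), of k L "f N"] Z4(2) N
      by (intro add_mono mult_mono order_refl) (auto simp: D_def)
    finally have "real N * expectation (\<lambda>\<omega>. (offset_error Q p N \<omega> - ?Z N \<omega>)\<^sup>2)
        \<le> real N * (?r\<^sup>2 + (D * real N ^ (2 * K + 2)) * (8 * real L / real N ^ (k + 1)) + 2 * (24 * (\<sigma>\<^sup>2 * V)\<^sup>2))"
      by (intro mult_left_mono) auto
    also have "\<dots> = C\<^sup>2 * (ln (real N))\<^sup>2 / real N + 8 * real L * D / real N + E / real N"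
    proof -
      have "real N * ?r\<^sup>2 = C\<^sup>2 * (ln (real N))\<^sup>2 / real N"
        using N unfolding log_rate_sq[OF N(1)] by (simp add: power_mult_distrib power_divide power2_eq_square)
      moreover have "real N * ((D * real N ^ (2 * K + 2)) * (8 * real L / real N ^ (k + 1))) = 8 * real L * D / real N"
      proof -
        define P where "P = real N ^ (2 * K + 2)"
        have "k + 1 = (2 * K + 2) + 2" by (simp add: k_def)
        then have "real N ^ (k + 1) = P * (real N * real N)"
          by (simp only: power_add power2_eq_square P_def)
        moreover have "0 < P" using N by (simp add: P_def)
        ultimately show ?thesis unfolding P_def[symmetric] using N by (simp add: field_simps)
      qed
      moreover have "real N * (2 * (24 * (\<sigma>\<^sup>2 * V)\<^sup>2)) = E / real N"
        using N by (simp add: V_def E_def power_mult_distrib power_divide power2_eq_square field_simps)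
      ultimately show ?thesis by (simp only: distrib_left)
    qed
    finally show ?case by simp
  qed
  moreover have "(\<lambda>N. C\<^sup>2 * (ln (real N))\<^sup>2 / real N + 8 * real L * D / real N + E / real N) \<longlonglongrightarrow> 0"
    by real_asymp
  ultimately show ?thesis by (rule Lim_null_comparison)
qed

text \<open>\<open>N powr (-3/2)\<close> is the order of the standard deviation, so the third claim
  says that the bias is negligible against it. The number of sweeps may grow polynomially because
  the crude bound on the exceptional event grows linearly in it.\<close>

lemma final_freq_est_moments:
  assumes p: "p < L" and Q: "\<And>N. 2 \<le> Q N" and poly: "(\<lambda>N. real (Q N)) \<in> O(\<lambda>N. real N ^ K)"
  shows "N > 0 \<Longrightarrow> integrable M (\<lambda>\<omega>. final_freq_est L N (x N \<omega>) (m N \<omega>) (Q N) p)"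
    and "N > 0 \<Longrightarrow> integrable M (\<lambda>\<omega>. (final_freq_est L N (x N \<omega>) (m N \<omega>) (Q N) p)\<^sup>2)"
    and "(\<lambda>N. real N powr (3/2) *
        (expectation (\<lambda>\<omega>. final_freq_est L N (x N \<omega>) (m N \<omega>) (Q N) p) - f N p)) \<longlonglongrightarrow> 0"
    and "(\<lambda>N. variance (\<lambda>\<omega>. final_freq_est L N (x N \<omega>) (m N \<omega>) (Q N) p))
        \<sim>[sequentially] (\<lambda>N. pi\<^sup>2 / (64 * SNR (A p) \<sigma> * real N ^ 3))"
proof -
  let ?Y = "offset_error Q p"
  define v where "v = pi\<^sup>2 / (64 * SNR (A p) \<sigma>)"
  have Ap: "A p \<noteq> 0" by (rule A_nonzero[OF p])
  have v: "0 < v" using Ap \<sigma>_pos by (simp add: v_def SNR_def)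
  have int: "integrable M (?Y N)" "integrable M (\<lambda>\<omega>. (?Y N \<omega>)\<^sup>2)" if "N > 0" for N
    using offset_error_integrable[OF that p] by auto
  show "integrable M (\<lambda>\<omega>. final_freq_est L N (x N \<omega>) (m N \<omega>) (Q N) p)" if "N > 0"
    unfolding final_freq_est_eq[OF that] using int[OF that] by simp
  show "integrable M (\<lambda>\<omega>. (final_freq_est L N (x N \<omega>) (m N \<omega>) (Q N) p)\<^sup>2)" if "N > 0"
  proof -
    have "(f N p + ?Y N \<omega> / real N)\<^sup>2 = (f N p)\<^sup>2 + 2 * f N p / real N * ?Y N \<omega> + (?Y N \<omega>)\<^sup>2 / (real N)\<^sup>2" for \<omega>
      by (simp add: power2_sum power_divide)
    then show ?thesis unfolding final_freq_est_eq[OF that] using int[OF that] by simp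
  qed
  have E: "expectation (\<lambda>\<omega>. final_freq_est L N (x N \<omega>) (m N \<omega>) (Q N) p) = f N p + expectation (?Y N) / real N" if "N > 0" for N
    unfolding final_freq_est_eq[OF that] using int[OF that] by (simp add: prob_space)
  have var: "variance (\<lambda>\<omega>. final_freq_est L N (x N \<omega>) (m N \<omega>) (Q N) p) = variance (?Y N) / (real N)\<^sup>2" if "N > 0" for N
  proof -
    have "f N p + y / real N - (f N p + z / real N) = (y - z) / real N" for y z
      by (simp add: diff_divide_distrib)
    then show ?thesis
      unfolding E[OF that] unfolding final_freq_est_eq[OF that] by (simp add: power_divide)
  qed
  have Z2: "\<forall>\<^sub>F N in sequentially. real N * expectation (\<lambda>\<omega>. (lin N (error_weight p N) \<omega>)\<^sup>2) = v"
    using eventually_ge_at_top[of 2]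
  proof eventually_elim
    case (elim N)
    then show ?case
      unfolding lin_moments error_weight_energy[OF elim] v_def SNR_def using Ap by (simp add: field_simps)
  qed
  have lims: "(\<lambda>N. sqrt (real N) * expectation (?Y N)) \<longlonglongrightarrow> 0" "(\<lambda>N. real N * variance (?Y N)) \<longlonglongrightarrow> v"
    using asymptotic_variance[of ?Y "\<lambda>N. lin N (error_weight p N)" v,
        OF offset_error_measurable[OF p] int(2) lin_measurable lin_moments(3) lin_moments(2) Z2
          remainder_tendsto_0[where Q = Q, OF p Q poly]] by auto
  show "(\<lambda>N. real N powr (3/2) *
        (expectation (\<lambda>\<omega>. final_freq_est L N (x N \<omega>) (m N \<omega>) (Q N) p) - f N p)) \<longlonglongrightarrow> 0"
  proof (rule Lim_transform_eventually[OF lims(1)])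
    show "\<forall>\<^sub>F N in sequentially. sqrt (real N) * expectation (?Y N) = real N powr (3/2) *
        (expectation (\<lambda>\<omega>. final_freq_est L N (x N \<omega>) (m N \<omega>) (Q N) p) - f N p)"
      using eventually_gt_at_top[of 0]
    proof eventually_elim
      case (elim N)
      have "real N powr (3/2) = real N powr (1 + 1/2)" by simp
      also have "\<dots> = real N * sqrt (real N)" unfolding powr_add by (simp add: powr_half_sqrt)
      finally show ?case using elim by (simp add: E)
    qed
  qed
  show "(\<lambda>N. variance (\<lambda>\<omega>. final_freq_est L N (x N \<omega>) (m N \<omega>) (Q N) p))
        \<sim>[sequentially] (\<lambda>N. pi\<^sup>2 / (64 * SNR (A p) \<sigma> * real N ^ 3))"
  proof (rule asymp_equivI')
    have "(\<lambda>N. real N * variance (?Y N) / v) \<longlonglongrightarrow> v / v"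
      using v by (intro tendsto_divide lims(2) tendsto_const) auto
    then have "(\<lambda>N. real N * variance (?Y N) / v) \<longlonglongrightarrow> 1" using v by simp
    then show "(\<lambda>N. variance (\<lambda>\<omega>. final_freq_est L N (x N \<omega>) (m N \<omega>) (Q N) p)
        / (pi\<^sup>2 / (64 * SNR (A p) \<sigma> * real N ^ 3))) \<longlonglongrightarrow> 1"
    proof (rule Lim_transform_eventually)
      show "\<forall>\<^sub>F N in sequentially. real N * variance (?Y N) / v
          = variance (\<lambda>\<omega>. final_freq_est L N (x N \<omega>) (m N \<omega>) (Q N) p) / (pi\<^sup>2 / (64 * SNR (A p) \<sigma> * real N ^ 3))"
        using eventually_gt_at_top[of 0]
      proof eventually_elim
        case (elim N)
        have "pi\<^sup>2 / (64 * SNR (A p) \<sigma> * real N ^ 3) = v / real N ^ 3" by (simp add: v_def)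
        then show ?case unfolding var[OF elim] using elim v by (simp add: power2_eq_square power3_eq_cube)
      qed
    qed
  qed
qed

end

text \<open>The quotient is \<open>pi ^ 4 / 96\<close>, about 1.01468.\<close>

lemma variance_over_ACRLB:
  assumes "0 < \<rho>" "N > 0"
  shows "\<bar>(pi\<^sup>2 / (64 * \<rho> * real N ^ 3)) / ACRLB \<rho> N - 1.0147\<bar> < 0.00005"
proof -
  have "(pi\<^sup>2 / (64 * \<rho> * real N ^ 3)) / ACRLB \<rho> N = pi ^ 4 / 96"
    using assms by (simp add: ACRLB_def field_simps flip: power_add)
  moreover have "3.14158 ^ 4 \<le> pi ^ 4" "pi ^ 4 \<le> 3.1416 ^ 4"
    using pi_approx by (intro power_mono; simp)+
  ultimately show ?thesis by (simp add: power4_eq_xxxx abs_less_iff)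
qed

text \<open>The true residuals vary with \<open>N\<close>, so the asymptotic fixed point is
  expressed by \<open>\<nu> N - \<delta> N\<close> tending to 0, while convergence in the number of
  sweeps is stated for each large \<open>N\<close>. In the moment claims two sweeps are the minimum,
  since one is spent on reaching the region where the linearisation has a second-order
  remainder.\<close>

theorem theorem2:
  fixes M :: "'a measure"
    and w :: "nat \<Rightarrow> 'a \<Rightarrow> complex"
    and L :: nat
    and A :: "nat \<Rightarrow> complex"
    and f :: "nat \<Rightarrow> nat \<Rightarrow> real"
    and m :: "nat \<Rightarrow> 'a \<Rightarrow> nat \<Rightarrow> int"
    and \<delta> :: "nat \<Rightarrow> 'a \<Rightarrow> nat \<Rightarrow> real"
    and x :: "nat \<Rightarrow> 'a \<Rightarrow> nat \<Rightarrow> complex"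
    and \<sigma> \<Delta> \<epsilon> :: real
  assumes "prob_space M"
    and "\<sigma> > 0" and "white_circular_gaussian M w \<sigma>"
    and "L \<ge> 2"
    and "\<And>l. l < L \<Longrightarrow> A l \<noteq> 0"
    and "\<And>N l. l < L \<Longrightarrow> f N l \<in> {-1/2..1/2}"
    and separation: "\<Delta> > 0" "\<And>N. \<Delta> \<le> min_separation L (f N)"
    and no_aliasing: "\<epsilon> > 0"
      "\<And>N p l. p < L \<Longrightarrow> l < L \<Longrightarrow> p \<noteq> l \<Longrightarrow> \<bar>f N p - f N l\<bar> \<le> 1 - \<epsilon>"
    and observations: "\<And>N \<omega> n. x N \<omega> n = observation L A (f N) w \<omega> n"
    and bins_measurable: "\<And>N l. l < L \<Longrightarrow> (\<lambda>\<omega>. m N \<omega> l) \<in> measurable M (count_space UNIV)"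
    and bins_correct: "\<And>N \<omega> l. N > 0 \<Longrightarrow> \<omega> \<in> space M \<Longrightarrow> l < L \<Longrightarrow>
      f N l = (real_of_int (m N \<omega> l) + \<delta> N \<omega> l) / real N \<and> \<delta> N \<omega> l \<in> {-1/2..1/2}"
  shows
    "(AE \<omega> in M. \<exists>\<nu> :: nat \<Rightarrow> nat \<Rightarrow> real.
        (\<forall>\<^sub>F N in sequentially.
           is_fixed_point L N (x N \<omega>) (m N \<omega>) (\<nu> N) \<and>
           (\<forall>\<mu>\<in>residual_cube L. is_fixed_point L N (x N \<omega>) (m N \<omega>) \<mu> \<longrightarrow>
              (\<forall>l<L. \<mu> l = \<nu> N l)) \<and>
           (\<forall>l<L. (\<lambda>Q. residual_est L N (x N \<omega>) (m N \<omega>) Q l) \<longlonglongrightarrow> \<nu> N l)) \<and>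
        (\<forall>l<L. (\<lambda>N. \<nu> N l - \<delta> N \<omega> l) \<longlonglongrightarrow> 0))
     \<and> (\<exists>C>0. AE \<omega> in M. \<forall>\<^sub>F N in sequentially.
          convergence_rate L N (x N \<omega>) (m N \<omega>)
            \<le> ereal (sqrt (real L) * (C * rate_bound L A (f N) N)))
     \<and> (\<forall>l<L. \<forall>p<L. l \<noteq> p \<longrightarrow>
          (\<lambda>N. leakage_Gamma A (f N) N l p) \<in> O(\<lambda>N. (cmod (A l))\<^sup>2 * (1 / (real N)\<^sup>2)))
     \<and> (\<forall>(Q :: nat \<Rightarrow> nat) (K :: nat).
          (\<forall>N. 2 \<le> Q N) \<and> (\<lambda>N. real (Q N)) \<in> O(\<lambda>N. real N ^ K) \<longrightarrow>
          (\<forall>p<L.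
             (\<forall>N>0. integrable M (\<lambda>\<omega>. final_freq_est L N (x N \<omega>) (m N \<omega>) (Q N) p) \<and>
                    integrable M (\<lambda>\<omega>. (final_freq_est L N (x N \<omega>) (m N \<omega>) (Q N) p)\<^sup>2)) \<and>
             (\<lambda>N. real N powr (3/2) *
                (prob_space.expectation M
                   (\<lambda>\<omega>. final_freq_est L N (x N \<omega>) (m N \<omega>) (Q N) p) - f N p)) \<longlonglongrightarrow> 0 \<and>
             (\<lambda>N. prob_space.variance M
                   (\<lambda>\<omega>. final_freq_est L N (x N \<omega>) (m N \<omega>) (Q N) p))
               \<sim>[sequentially] (\<lambda>N. pi\<^sup>2 / (64 * SNR (A p) \<sigma> * real N ^ 3))))
     \<and> (\<forall>p<L. \<forall>N>0.
          \<bar>(pi\<^sup>2 / (64 * SNR (A p) \<sigma> * real N ^ 3)) / ACRLB (SNR (A p) \<sigma>) N - 1.0147\<bar> < 0.00005)"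
proof -
  \<comment> \<open>\<Delta> separates the frequencies on the line, \<epsilon> across the ends of
    the interval, where -1/2 and 1/2 describe the same tone.\<close>
  define \<gamma> where "\<gamma> = min \<Delta> \<epsilon>"
  have \<gamma>: "0 < \<gamma>" using separation(1) no_aliasing(1) by (simp add: \<gamma>_def)
  have sep: "\<Delta> \<le> \<bar>f N l - f N p\<bar>" if "p < L" "l < L" "p \<noteq> l" for N p l
  proof -
    have "finite {\<bar>f N p - f N l\<bar> | p l. p < L \<and> l < L \<and> p \<noteq> l}"
      by (rule finite_subset[of _ "(\<lambda>(p, l). \<bar>f N p - f N l\<bar>) ` ({..<L} \<times> {..<L})"]) auto
    then have "min_separation L (f N) \<le> \<bar>f N l - f N p\<bar>"
      unfolding min_separation_def using that by (intro Min_le) auto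
    then show ?thesis using separation(2)[of N] by linarith
  qed
  interpret gaussian_noise M w \<sigma>
    using assms(1-3) by (simp add: gaussian_noise_def gaussian_noise_axioms_def)
  interpret estimation M w \<sigma> L A f m \<delta> x \<gamma>
  proof
    fix N p l assume pl: "p < L" "l < L" "p \<noteq> l"
    show "\<gamma> \<le> \<bar>f N l - f N p\<bar> \<and> \<bar>f N l - f N p\<bar> \<le> 1 - \<gamma>"
      using sep[OF pl, of N] no_aliasing(2)[OF pl, of N] by (auto simp: \<gamma>_def abs_minus_commute)
  qed (use assms \<gamma> in auto)
  have SNR_pos: "0 < SNR (A p) \<sigma>" if "p < L" for p
    using A_nonzero[OF that] \<sigma>_pos by (simp add: SNR_def)
  show ?thesis
    by (intro conjI allI impI)
      (rule fixed_point_limit, rule convergence_rate_bound,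
       rule leakage_Gamma_bigo, assumption, assumption, assumption,
       rule final_freq_est_moments(1), assumption, blast, erule conjunct2, assumption,
       rule final_freq_est_moments(2), assumption, blast, erule conjunct2, assumption,
       rule final_freq_est_moments(3), assumption, blast, erule conjunct2,
       rule final_freq_est_moments(4), assumption, blast, erule conjunct2,
       rule variance_over_ACRLB, rule SNR_pos, assumption, assumption)
qed

end
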